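(* Let $n\ge3$ and let $M_j=(\mathbb{T}^n,g_j)$, $j\ge 1$, be a sequence of Riemannian manifolds satisfying $$R_{g_j}\ge-\frac1j,\qquad \operatorname{Diam}(M_j)\le D_0,\qquad \operatorname{Vol}(M_j)\le V_0$$ for constants $D_0,V_0$ independent of $j$. Let $g_0$ be a flat Riemannian metric on $\mathbb{T}^n$, and assume that $g_j=e^{2f_j}\tilde g_{0,j}$ for functions $f_j$ on $\mathbb{T}^n$, where $\tilde g_{0,j}$ is a Riemannian metric on $\mathbb{T}^n$ with constant zero or constant negative scalar curvature and unit volume. Assume furthermore that $$\tilde g_{0,j}\to g_0\quad\text{in } C^1$$ and that there is a constant $C$ independent of $j$ such that $$\int_{\mathbb{T}^n}e^{-2f_j}\,dV_{\tilde g_{0,j}}\le C.$$ Then for any $0<\varepsilon<\operatorname{Vol}_{g_0}(\mathbb{T}^n)$ there exist a subsequence $(g_k)$ of $(g_j)$ and a set $U_\varepsilon\subset\mathbb{T}^n$ with $\operatorname{Vol}_{g_0}(U_\varepsilon)=\operatorname{Vol}_{g_0}(\mathbb{T}^n)-\varepsilon$ such that $$d_k(q_1,q_2)\to d_\infty(q_1,q_2)$$ uniformly for $q_1,q_2\in U_\varepsilon$, where $d_\infty$ is the distance function of the flat torus $(\mathbb{T}^n,\bar g_0=c_\infty^2g_0)$ and $$c_\infty^2=\lim_{k\to\infty}\left(\frac{1}{\operatorname{Vol}_{\tilde g_{0,k}}(\mathbb{T}^n)}\int_{\mathbb{T}^n}e^{-f_k}\,dV_{\tilde g_{0,k}}\right)^{-2},$$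 the limit being taken along the subsequence.
   Context: $\mathbb{T}^n$ is the $n$-dimensional torus. $R_g$ denotes the scalar curvature, $\operatorname{Diam}$ the diameter, $\operatorname{Vol}$ the volume, and $dV_g$ the Riemannian volume measure of a metric $g$. $d_k$ is the Riemannian distance function of $g_k$ on $\mathbb{T}^n$. *)

theory Defs
  imports "HOL-Analysis.Analysis"
begin

text \<open>
  The torus is the quotient of \<open>\<real>\<^sup>n\<close> by the lattice \<open>\<int>\<^sup>n\<close>, with \<open>n = CARD('n)\<close>.  Its tangent
  bundle is trivialised by the coordinate fields of \<open>\<real>\<^sup>n\<close>, which descend to the quotient, so a
  \<open>(0,2)\<close>-tensor field is a matrix-valued function on the torus.
\<close>

definition lattice_rel :: "real^'n \<Rightarrow> real^'n \<Rightarrow> bool" where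
  "lattice_rel x y \<longleftrightarrow> (\<forall>i. x $ i - y $ i \<in> \<int>)"

quotient_type 'n torus = "real^'n" / "lattice_rel :: real^'n \<Rightarrow> real^'n \<Rightarrow> bool"
  morphisms rep_torus torus_proj
proof (rule equivpI)
  show "reflp (lattice_rel :: real^'n \<Rightarrow> real^'n \<Rightarrow> bool)"
    by (simp add: reflp_def lattice_rel_def)
  show "symp (lattice_rel :: real^'n \<Rightarrow> real^'n \<Rightarrow> bool)"
    unfolding symp_def lattice_rel_def by (metis Ints_minus minus_diff_eq)
  show "transp (lattice_rel :: real^'n \<Rightarrow> real^'n \<Rightarrow> bool)"
  proof (rule transpI)
    fix x y z :: "real^'n"
    assume xy: "lattice_rel x y" and yz: "lattice_rel y z"
    have "x $ i - z $ i \<in> \<int>" for i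
      using Ints_add [of "x $ i - y $ i" "y $ i - z $ i"] xy yz
      by (simp add: lattice_rel_def)
    then show "lattice_rel x z"
      by (simp add: lattice_rel_def)
  qed
qed

instantiation torus :: (finite) topological_space
begin

definition open_torus :: "'a torus set \<Rightarrow> bool" where
  "open_torus U \<longleftrightarrow> open (torus_proj -` U)"

instance
  by standard (auto simp: open_torus_def vimage_Union)

end

text \<open>
  The partial derivative does not depend on the representative \<open>rep_torus p\<close>, because the lift
  of \<open>h\<close> to \<open>\<real>\<^sup>n\<close> is periodic.
\<close>

definition partial :: "'n::finite \<Rightarrow> ('n torus \<Rightarrow> real) \<Rightarrow> 'n torus \<Rightarrow> real" where
  "partial i h p = deriv (\<lambda>t. h (torus_proj (rep_torus p + t *\<^sub>R axis i 1))) 0"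

primrec C_k :: "nat \<Rightarrow> ('n::finite torus \<Rightarrow> real) \<Rightarrow> bool" where
  "C_k 0 h \<longleftrightarrow> continuous_on UNIV h"
| "C_k (Suc k) h \<longleftrightarrow> (\<forall>x. (h \<circ> torus_proj) differentiable (at x)) \<and> (\<forall>i. C_k k (partial i h))"

definition smooth :: "('n::finite torus \<Rightarrow> real) \<Rightarrow> bool" where
  "smooth h \<longleftrightarrow> (\<forall>k. C_k k h)"

type_synonym 'n tensor2 = "'n torus \<Rightarrow> real^'n^'n"

definition riemannian_metric :: "'n::finite tensor2 \<Rightarrow> bool" where
  "riemannian_metric g \<longleftrightarrow>
     (\<forall>i j. smooth (\<lambda>p. g p $ i $ j)) \<and>
     (\<forall>p. transpose (g p) = g p) \<and>
     (\<forall>p v. v \<noteq> 0 \<longrightarrow> v \<bullet> (g p *v v) > 0)"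

text \<open>\<open>christoffel g k i j\<close> is \<open>\<Gamma>\<^sup>k\<^sub>i\<^sub>j\<close>.\<close>

definition christoffel :: "'n::finite tensor2 \<Rightarrow> 'n \<Rightarrow> 'n \<Rightarrow> 'n \<Rightarrow> 'n torus \<Rightarrow> real" where
  "christoffel g k i j p =
     (1/2) * (\<Sum>l\<in>UNIV. matrix_inv (g p) $ k $ l *
       (partial i (\<lambda>q. g q $ j $ l) p + partial j (\<lambda>q. g q $ i $ l) p
        - partial l (\<lambda>q. g q $ i $ j) p))"

text \<open>
  \<open>riemann g l i j k\<close> is the \<open>l\<close>-th component of \<open>R(\<partial>\<^sub>i, \<partial>\<^sub>j) \<partial>\<^sub>k\<close>, where
  \<open>R(X,Y)Z = \<nabla>\<^sub>X \<nabla>\<^sub>Y Z - \<nabla>\<^sub>Y \<nabla>\<^sub>X Z - \<nabla>\<^bsub>[X,Y]\<^esub> Z\<close>; the Ricci tensor \<open>Ric(Y,Z)\<close> is the trace of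
  \<open>X \<mapsto> R(X,Y)Z\<close>, so that round spheres have positive scalar curvature.
\<close>

definition riemann :: "'n::finite tensor2 \<Rightarrow> 'n \<Rightarrow> 'n \<Rightarrow> 'n \<Rightarrow> 'n \<Rightarrow> 'n torus \<Rightarrow> real" where
  "riemann g l i j k p =
     partial i (christoffel g l j k) p - partial j (christoffel g l i k) p
     + (\<Sum>m\<in>UNIV. christoffel g l i m p * christoffel g m j k p
                 - christoffel g l j m p * christoffel g m i k p)"

definition ricci :: "'n::finite tensor2 \<Rightarrow> 'n \<Rightarrow> 'n \<Rightarrow> 'n torus \<Rightarrow> real" where
  "ricci g j k p = (\<Sum>i\<in>UNIV. riemann g i i j k p)"

definition scalar_curvature :: "'n::finite tensor2 \<Rightarrow> 'n torus \<Rightarrow> real" where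
  "scalar_curvature g p = (\<Sum>j\<in>UNIV. \<Sum>k\<in>UNIV. matrix_inv (g p) $ j $ k * ricci g j k p)"

definition flat :: "'n::finite tensor2 \<Rightarrow> bool" where
  "flat g \<longleftrightarrow> (\<forall>l i j k p. riemann g l i j k p = 0)"

definition fundamental_cube :: "(real^'n) set" where
  "fundamental_cube = {x. \<forall>i. 0 \<le> x $ i \<and> x $ i < 1}"

definition volume_measure :: "'n::finite tensor2 \<Rightarrow> 'n torus measure" where
  "volume_measure g =
     distr (density (restrict_space lborel fundamental_cube)
              (\<lambda>x. ennreal (sqrt (det (g (torus_proj x))))))
       borel torus_proj"

definition riem_volume :: "'n::finite tensor2 \<Rightarrow> real" where
  "riem_volume g = measure (volume_measure g) UNIV"

text \<open>
  A curve in the torus is given by a lift \<open>\<gamma>\<close> to \<open>\<real>\<^sup>n\<close>.  The length is extended-valued since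
  \<^const>\<open>valid_path\<close> (continuous, and continuously differentiable off a finite set) does not bound
  the speed near the exceptional points; curves of infinite length do not affect the infimum.
\<close>

definition curve_length :: "'n::finite tensor2 \<Rightarrow> (real \<Rightarrow> real^'n) \<Rightarrow> ennreal" where
  "curve_length g \<gamma> =
     (\<integral>\<^sup>+t\<in>{0..1}. ennreal (sqrt (vector_derivative \<gamma> (at t) \<bullet>
        (g (torus_proj (\<gamma> t)) *v vector_derivative \<gamma> (at t)))) \<partial>lborel)"

definition riem_dist :: "'n::finite tensor2 \<Rightarrow> 'n torus \<Rightarrow> 'n torus \<Rightarrow> real" where
  "riem_dist g p q =
     enn2real (INF \<gamma>\<in>{\<gamma>. valid_path \<gamma> \<and> torus_proj (\<gamma> 0) = p \<and> torus_proj (\<gamma> 1) = q}.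
       curve_length g \<gamma>)"

definition riem_diameter :: "'n::finite tensor2 \<Rightarrow> real" where
  "riem_diameter g = (SUP (p, q)\<in>UNIV. riem_dist g p q)"

definition C1_converges :: "(nat \<Rightarrow> 'n::finite tensor2) \<Rightarrow> 'n tensor2 \<Rightarrow> bool" where
  "C1_converges h g \<longleftrightarrow>
     (\<forall>a b. uniform_limit UNIV (\<lambda>j p. h j p $ a $ b) (\<lambda>p. g p $ a $ b) sequentially \<and>
        (\<forall>l. uniform_limit UNIV (\<lambda>j. partial l (\<lambda>p. h j p $ a $ b))
               (partial l (\<lambda>p. g p $ a $ b)) sequentially))"

end

theory Submission imports Defs begin

text \<open>
  Write \<open>u = exp (-f)\<close> and \<open>w = u\<^sup>2\<close>, so that the metric \<open>g = exp (2f) gt\<close> is \<open>gt / w\<close>, and let \<open>n\<close> be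
  the dimension.  The conformal transformation law of the scalar curvature, expressed in \<open>w\<close>, reads
  \<open>\<Delta>w \<ge> (n + 2) |\<nabla>u|\<^sup>2 - \<delta>\<close> with \<open>\<delta> = 1 / (j (n - 1))\<close>, because \<open>gt\<close> has nonpositive and \<open>g\<close> has almost
  nonnegative scalar curvature (\<open>conformal_change.almost_subharmonic\<close>).  Everything follows from this
  inequality, the bound on the mean of \<open>w\<close> and the bound on the volume.

  Integrated over the torus, the inequality gives \<open>\<integral>|\<nabla>u|\<^sup>2 \<rightarrow> 0\<close>, hence by the Poincare inequality \<open>u\<close> is
  close in \<open>L\<^sup>2\<close> to its mean (\<open>conformal_torus.variance_bound\<close>).  The means are bounded, and bounded away
  from zero since the volume is the integral of \<open>u\<close> to the power \<open>-n\<close>; so a subsequence of them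
  converges to some \<open>a > 0\<close>, and the limit distance is that of \<open>c\<^sup>2 g0\<close> with \<open>c = 1 / a\<close>.

  Lower bound for the distances.  As \<open>w\<close> is almost subharmonic, a mean value inequality bounds it from
  above by \<open>a\<^sup>2 + o(1)\<close> at every point.  The coefficients of the Laplacian are uniformly Lipschitz by
  the \<open>C\<^sup>1\<close> convergence of the backgrounds; this makes the error of freezing them at the centre of a
  ball of radius \<open>r\<close> of relative size \<open>r\<close>, and the error is absorbed
  (\<open>mean_value.mean_value_bound\<close>, \<open>conformal_torus.sup_bound\<close>).  Therefore
  \<open>g \<ge> (1 - o(1)) c\<^sup>2 g0\<close> everywhere, and no curve can be a shortcut.

  Upper bound for the distances.  The functions \<open>1 / u\<close> converge to \<open>c\<close> only in \<open>L\<^sup>1\<close>, so a single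
  \<open>g0\<close>-short curve \<open>\<gamma>\<close> may be long for \<open>g\<close>.  Instead, \<open>\<gamma>\<close> is translated by the vectors \<open>y\<close> of a small
  box and its endpoints are joined to the translated ones by segments.  On average over \<open>y\<close> the
  translated curves have almost the expected length, by translation invariance of the integral of
  \<open>|1 / u - c|\<close>.  The segments at an endpoint \<open>x\<close> are controlled by the mean of \<open>|1 / u - c|\<close> over all
  segments at \<open>x\<close>, which is not small for every \<open>x\<close> but has small integral over the torus; along a
  fast subsequence it tends to zero uniformly outside a set of small volume.  This produces the set
  \<open>U\<close> (\<open>distance_average_bound\<close>, \<open>small_segment_means\<close>).
\<close>

section \<open>The torus and periodic functions\<close>

lemma torus_proj_eq_iff: "torus_proj x = torus_proj y \<longleftrightarrow> (\<forall>i. x $ i - y $ i \<in> \<int>)"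
  unfolding torus.abs_eq_iff lattice_rel_def ..

lemma torus_proj_rep [simp]: "torus_proj (rep_torus p) = p"
  using Quotient3_torus Quotient3_abs_rep by fastforce

lemma torus_proj_shift:
  assumes "torus_proj x = torus_proj y" shows "torus_proj (x + z) = torus_proj (y + z)"
  using assms by (simp add: torus_proj_eq_iff)

lemma continuous_torus_proj: "continuous_on UNIV (torus_proj :: real^'n::finite \<Rightarrow> _)"
  by (simp add: continuous_on_open_vimage open_torus_def)

lemma continuous_on_torus_iff:
  fixes h :: "'n::finite torus \<Rightarrow> 'a::topological_space"
  shows "continuous_on UNIV h \<longleftrightarrow> continuous_on UNIV (h \<circ> torus_proj)"
  by (simp add: continuous_on_open_vimage open_torus_def vimage_comp o_def)

section \<open>Partial derivatives on the covering space\<close>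

text \<open>
  Functions on the torus are studied through their lifts, which are periodic.  The next two notions are
  the counterparts on the covering space of \<^const>\<open>partial\<close> and \<^const>\<open>C_k\<close>; they need no choice of
  a representative.
\<close>

definition pd :: "'n::finite \<Rightarrow> (real^'n \<Rightarrow> real) \<Rightarrow> real^'n \<Rightarrow> real" where
  "pd i F x = deriv (\<lambda>t. F (x + t *\<^sub>R axis i 1)) 0"

primrec Ck :: "nat \<Rightarrow> (real^'n::finite \<Rightarrow> real) \<Rightarrow> bool" where
  "Ck 0 F \<longleftrightarrow> continuous_on UNIV F"
| "Ck (Suc k) F \<longleftrightarrow> (\<forall>x. F differentiable (at x)) \<and> (\<forall>i. Ck k (pd i F))"

lemma partial_torus_proj: "partial i h (torus_proj x) = pd i (h \<circ> torus_proj) x"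
proof -
  have "torus_proj (rep_torus (torus_proj x) + t *\<^sub>R axis i 1) = torus_proj (x + t *\<^sub>R axis i 1)" for t
    by (rule torus_proj_shift) simp
  then show ?thesis by (simp add: partial_def pd_def)
qed

lemma partial_comp_torus_proj: "partial i h \<circ> torus_proj = pd i (h \<circ> torus_proj)"
  by (auto simp: partial_torus_proj fun_eq_iff)

lemma C_k_iff_Ck: "C_k k h \<longleftrightarrow> Ck k (h \<circ> torus_proj)"
  by (induction k arbitrary: h) (auto simp: continuous_on_torus_iff partial_comp_torus_proj)

lemma has_derivative_pd:
  fixes F :: "real^'n::finite \<Rightarrow> real"
  assumes "F differentiable (at x)"
  shows "(F has_derivative (\<lambda>v. \<Sum>i\<in>UNIV. v $ i * pd i F x)) (at x)"
proof -
  from assms obtain F' where F': "(F has_derivative F') (at x)"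
    unfolding differentiable_def by blast
  have lin: "linear F'" using F' has_derivative_linear by blast
  have pd: "pd i F x = F' (axis i 1)" for i
  proof -
    have F'': "(F has_derivative F') (at (x + 0 *\<^sub>R axis i 1))" using F' by simp
    have "((\<lambda>t. F (x + t *\<^sub>R axis i 1)) has_derivative (\<lambda>t. F' (t *\<^sub>R axis i 1))) (at 0)"
      by (rule has_derivative_compose[where f = "\<lambda>t. x + t *\<^sub>R axis i 1" and g = F, OF _ F''])
         (auto intro!: derivative_eq_intros)
    then have "((\<lambda>t. F (x + t *\<^sub>R axis i 1)) has_field_derivative F' (axis i 1)) (at 0)"
      by (rule has_derivative_imp_has_field_derivative) (simp add: linear_scale[OF lin])
    then show ?thesis unfolding pd_def by (rule DERIV_imp_deriv)
  qed
  have "F' v = (\<Sum>i\<in>UNIV. v $ i * pd i F x)" for v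
  proof -
    have "F' v = F' (\<Sum>i\<in>UNIV. v $ i *\<^sub>R axis i 1)"
      by (simp add: basis_expansion flip: scalar_mult_eq_scaleR)
    then show ?thesis
      by (simp add: linear_sum[OF lin] linear_scale[OF lin] pd)
  qed
  then show ?thesis using F' by presburger
qed

lemma pd_eqI:
  assumes "(F has_derivative F') (at x)"
  shows "pd i F x = F' (axis i 1)"
proof -
  have "F' = (\<lambda>v. \<Sum>i\<in>UNIV. v $ i * pd i F x)"
    using assms has_derivative_pd[of F x] has_derivative_unique
    unfolding differentiable_def by blast
  then show ?thesis
    by (simp add: axis_def if_distrib[of "\<lambda>t. t * _"] cong: if_cong)
qed

lemma DERIV_line:
  assumes "F differentiable (at (x + t *\<^sub>R v))"
  shows "((\<lambda>t. F (x + t *\<^sub>R v)) has_field_derivative (\<Sum>i\<in>UNIV. v $ i * pd i F (x + t *\<^sub>R v))) (at t)"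
proof (rule has_derivative_imp_has_field_derivative)
  show "((\<lambda>t. F (x + t *\<^sub>R v)) has_derivative
     (\<lambda>s. \<Sum>i\<in>UNIV. (s *\<^sub>R v) $ i * pd i F (x + t *\<^sub>R v))) (at t)"
    by (rule has_derivative_compose[where f = "\<lambda>t. x + t *\<^sub>R v" and g = F, OF _ has_derivative_pd[OF assms]])
       (auto intro!: derivative_eq_intros)
qed (simp add: sum_distrib_left sum_distrib_right mult_ac)

lemma DERIV_axis:
  assumes "F differentiable (at x)"
  shows "((\<lambda>t. F (x + t *\<^sub>R axis i 1)) has_field_derivative pd i F x) (at 0)"
  using DERIV_line[of F x 0 "axis i 1"] assms
  by (simp add: axis_def if_distrib[of "\<lambda>t. t * _"] cong: if_cong)

lemma pd_const [simp]: "pd i (\<lambda>x. c) = (\<lambda>x. 0)"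
  by (simp add: pd_def fun_eq_iff)

lemma pd_add:
  assumes "F differentiable (at x)" "G differentiable (at x)"
  shows "pd i (\<lambda>x. F x + G x) x = pd i F x + pd i G x"
  unfolding pd_def[of i "\<lambda>x. F x + G x"]
  by (rule DERIV_imp_deriv) (intro DERIV_add DERIV_axis assms)

lemma pd_diff:
  assumes "F differentiable (at x)" "G differentiable (at x)"
  shows "pd i (\<lambda>x. F x - G x) x = pd i F x - pd i G x"
  unfolding pd_def[of i "\<lambda>x. F x - G x"]
  by (rule DERIV_imp_deriv) (intro DERIV_diff DERIV_axis assms)

lemma pd_mult:
  assumes "F differentiable (at x)" "G differentiable (at x)"
  shows "pd i (\<lambda>x. F x * G x) x = pd i F x * G x + F x * pd i G x"
  unfolding pd_def[of i "\<lambda>x. F x * G x"]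
  by (rule DERIV_imp_deriv)
     (use DERIV_mult'[OF DERIV_axis[OF assms(1)] DERIV_axis[OF assms(2)]] in \<open>simp add: mult_ac add_ac\<close>)

lemma pd_cmult:
  assumes "F differentiable (at x)"
  shows "pd i (\<lambda>x. c * F x) x = c * pd i F x"
  using pd_mult[of "\<lambda>x. c" x F i] assms by simp

lemma pd_sum:
  assumes "\<And>a. a \<in> A \<Longrightarrow> F a differentiable (at x)"
  shows "pd i (\<lambda>x. \<Sum>a\<in>A. F a x) x = (\<Sum>a\<in>A. pd i (F a) x)"
  unfolding pd_def[of i "\<lambda>x. \<Sum>a\<in>A. F a x"]
  by (rule DERIV_imp_deriv) (intro DERIV_sum DERIV_axis assms)

lemma pd_chain:
  assumes "F differentiable (at x)" "(\<phi> has_field_derivative d) (at (F x))"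
  shows "pd i (\<lambda>x. \<phi> (F x)) x = d * pd i F x"
  unfolding pd_def[of i "\<lambda>x. \<phi> (F x)"]
  by (rule DERIV_imp_deriv)
     (rule DERIV_chain2[where f=\<phi>, OF _ DERIV_axis[OF assms(1)]], use assms(2) in simp)

lemma pd_inverse:
  assumes "F differentiable (at x)" "F x \<noteq> 0"
  shows "pd i (\<lambda>x. inverse (F x)) x = - (inverse (F x) * inverse (F x)) * pd i F x"
  by (rule pd_chain[OF assms(1)])
     (use DERIV_inverse[OF assms(2)] in \<open>simp add: numeral_2_eq_2\<close>)

lemma pd_scaled_shift:
  assumes "F differentiable (at (x + s *\<^sub>R y))"
  shows "pd i (\<lambda>y. F (x + s *\<^sub>R y)) y = s * pd i F (x + s *\<^sub>R y)"
proof -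
  have "((\<lambda>y. F (x + s *\<^sub>R y)) has_derivative
     (\<lambda>v. \<Sum>i\<in>UNIV. (s *\<^sub>R v) $ i * pd i F (x + s *\<^sub>R y))) (at y)"
    by (rule has_derivative_compose[where f = "\<lambda>y. x + s *\<^sub>R y" and g = F, OF _ has_derivative_pd[OF assms]])
       (auto intro!: derivative_eq_intros)
  from pd_eqI[OF this] show ?thesis
    by (simp add: axis_def if_distrib[of "\<lambda>t. _ * t"] if_distrib[of "\<lambda>t. t * _"] cong: if_cong)
qed

lemma differentiable_finite_prod:
  fixes F :: "'a \<Rightarrow> real^'n::finite \<Rightarrow> real"
  assumes "finite A" "\<And>a. a \<in> A \<Longrightarrow> F a differentiable (at x)"
  shows "(\<lambda>x. \<Prod>a\<in>A. F a x) differentiable (at x)"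
  using assms by (induction A rule: finite_induct) (auto intro: differentiable_mult)

lemma Ck_imp_continuous: "Ck k F \<Longrightarrow> continuous_on UNIV F"
  by (cases k) (auto intro!: differentiable_imp_continuous_on simp: differentiable_on_def
      intro: differentiable_at_withinI)

lemma Ck_SucD: "Ck (Suc k) F \<Longrightarrow> Ck k F"
proof (induction k arbitrary: F)
  case 0
  then show ?case using Ck_imp_continuous[of "Suc 0" F] by (simp only: Ck.simps(1))
qed auto

lemma Ck_pd: "Ck (Suc k) F \<Longrightarrow> Ck k (pd i F)"
  by simp

lemma Ck_const [intro]: "Ck k (\<lambda>x. c)"
  by (induction k arbitrary: c) auto

lemma Ck_add: "Ck k F \<Longrightarrow> Ck k G \<Longrightarrow> Ck k (\<lambda>x. F x + G x)"
proof (induction k arbitrary: F G)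
  case (Suc k)
  then have "pd i (\<lambda>x. F x + G x) = (\<lambda>x. pd i F x + pd i G x)" for i
    by (auto simp: fun_eq_iff pd_add)
  with Suc show ?case by (auto intro: differentiable_add)
qed (auto intro: continuous_intros)

lemma Ck_mult: "Ck k F \<Longrightarrow> Ck k G \<Longrightarrow> Ck k (\<lambda>x. F x * G x)"
proof (induction k arbitrary: F G)
  case (Suc k)
  then have *: "pd i (\<lambda>x. F x * G x) = (\<lambda>x. pd i F x * G x + F x * pd i G x)" for i
    by (auto simp: fun_eq_iff pd_mult)
  have "Ck k F" "Ck k G" using Suc.prems by (blast intro: Ck_SucD)+
  with Suc have "Ck k (pd i (\<lambda>x. F x * G x))" for i
    unfolding * by (intro Ck_add) (auto intro: Suc.IH)
  with Suc.prems show ?case by (auto intro: differentiable_mult)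
qed (auto intro: continuous_intros)

lemma Ck_diff: "Ck k F \<Longrightarrow> Ck k G \<Longrightarrow> Ck k (\<lambda>x. F x - G x)"
  using Ck_add[of k F "\<lambda>x. (-1) * G x"] Ck_mult[OF Ck_const[of k "-1"], of G] by simp

lemma Ck_sum: "(\<And>a. a \<in> A \<Longrightarrow> Ck k (F a)) \<Longrightarrow> Ck k (\<lambda>x. \<Sum>a\<in>A. F a x)"
  by (induction A rule: infinite_finite_induct) (auto intro: Ck_add)

lemma Ck_prod: "(\<And>a. a \<in> A \<Longrightarrow> Ck k (F a)) \<Longrightarrow> Ck k (\<lambda>x. \<Prod>a\<in>A. F a x)"
  by (induction A rule: infinite_finite_induct) (auto intro: Ck_mult)

lemma differentiable_inverse_real:
  fixes F :: "'a::real_normed_vector \<Rightarrow> real"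
  assumes "F differentiable (at x)" "F x \<noteq> 0"
  shows "(\<lambda>x. inverse (F x)) differentiable (at x)"
  using assms by (rule differentiable_inverse)

lemma Ck_inverse:
  assumes "Ck k F" "\<And>x. F x \<noteq> 0" shows "Ck k (\<lambda>x. inverse (F x))"
  using assms
proof (induction k)
  case (Suc k)
  then have *: "pd i (\<lambda>x. inverse (F x)) = (\<lambda>x. (-1) * (inverse (F x) * inverse (F x)) * pd i F x)" for i
    by (auto simp: fun_eq_iff pd_inverse)
  have "Ck k (\<lambda>x. inverse (F x))" using Suc.prems Suc.IH by (blast intro: Ck_SucD)
  with Suc.prems have "Ck k (pd i (\<lambda>x. inverse (F x)))" for i
    unfolding * by (intro Ck_mult Ck_const) auto
  with Suc.prems show ?case by (auto intro: differentiable_inverse_real)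
qed (auto intro: continuous_intros)

lemma Ck_divide:
  assumes "Ck k F" "Ck k G" "\<And>x. G x \<noteq> 0" shows "Ck k (\<lambda>x. F x / G x)"
  using Ck_mult[OF assms(1) Ck_inverse[OF assms(2,3)]] by (simp add: divide_inverse)

lemma Ck_det:
  fixes A :: "real^'n::finite \<Rightarrow> real^'m::finite^'m"
  assumes "\<And>i j. Ck k (\<lambda>x. A x $ i $ j)" shows "Ck k (\<lambda>x. det (A x))"
  unfolding det_def by (intro Ck_sum Ck_mult Ck_prod Ck_const assms)

lemma C1_sqrt:
  assumes "Ck 1 F" "\<And>x. F x > 0" shows "Ck 1 (\<lambda>x. sqrt (F x))"
    and "\<And>i x. pd i (\<lambda>x. sqrt (F x)) x = pd i F x / (2 * sqrt (F x))"
proof -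
  have d: "F differentiable (at x)" for x using assms by simp
  have ds: "(\<lambda>x. sqrt (F x)) differentiable (at x)" for x
  proof -
    obtain F' where "(F has_derivative F') (at x)" using d unfolding differentiable_def by blast
    from has_derivative_real_sqrt[OF assms(2) this] show ?thesis
      unfolding differentiable_def by blast
  qed
  show *: "pd i (\<lambda>x. sqrt (F x)) x = pd i F x / (2 * sqrt (F x))" for i x
    using pd_chain[OF d DERIV_real_sqrt[OF assms(2)], of i x]
    by (simp add: field_simps)
  have "continuous_on UNIV F" by (rule Ck_imp_continuous[OF assms(1)])
  moreover have "continuous_on UNIV (pd i F)" for i
    using assms(1) by simp
  ultimately have "continuous_on UNIV (pd i (\<lambda>x. sqrt (F x)))" for i
    unfolding * [abs_def] using assms(2) by (intro continuous_intros) (auto simp: less_imp_neq[THEN not_sym])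
  then show "Ck 1 (\<lambda>x. sqrt (F x))" using ds by simp
qed

section \<open>Positive definite matrices\<close>

definition posdef :: "real^'n::finite^'n \<Rightarrow> bool" where
  "posdef A \<longleftrightarrow> transpose A = A \<and> (\<forall>v. v \<noteq> 0 \<longrightarrow> v \<bullet> (A *v v) > 0)"

lemma posdef_sym: "posdef A \<Longrightarrow> A $ i $ j = A $ j $ i"
  unfolding posdef_def transpose_def vec_eq_iff by simp

lemma inner_mult_vec: "v \<bullet> (A *v w) = (\<Sum>i\<in>UNIV. \<Sum>j\<in>UNIV. A $ i $ j * v $ i * w $ j)"
  for A :: "real^'n::finite^'n"
  by (simp add: inner_vec_def matrix_vector_mult_def sum_distrib_left mult_ac)

lemma posdef_invertible:
  assumes "posdef A" shows "invertible A"
proof -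
  have "A *v x = 0 \<Longrightarrow> x = 0" for x
    using assms unfolding posdef_def by (metis inner_zero_right less_irrefl)
  then show ?thesis
    by (simp add: invertible_left_inverse matrix_left_invertible_ker)
qed

text \<open>The segment from the identity to \<open>A\<close> stays in the invertible matrices, so the determinant
  keeps its sign along it.\<close>

lemma posdef_det_pos:
  fixes A :: "real^'n::finite^'n"
  assumes "posdef A" shows "det A > 0"
proof (rule ccontr)
  assume neg: "\<not> det A > 0"
  define B where "B t = (\<chi> i j. (1 - t) * (if i = j then 1 else 0) + t * A $ i $ j)" for t :: real
  have B: "B t *v v = (1 - t) *\<^sub>R v + t *\<^sub>R (A *v v)" for t v
  proof -
    have "B t = (1 - t) *\<^sub>R mat 1 + t *\<^sub>R A" by (simp add: B_def vec_eq_iff mat_def)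
    then show ?thesis
      by (simp add: matrix_vector_mult_add_rdistrib scaleR_matrix_vector_assoc[symmetric])
  qed
  have "continuous_on {0..1} (\<lambda>t. det (B t))"
    unfolding det_def B_def by (auto intro!: continuous_intros)
  moreover have "det (B 0) = 1"
  proof -
    have "B 0 = mat 1" by (simp add: B_def mat_def vec_eq_iff)
    then show ?thesis by simp
  qed
  moreover have "B 1 = A" by (simp add: B_def vec_eq_iff)
  ultimately obtain t where t: "0 \<le> t" "t \<le> 1" "det (B t) = 0"
    using IVT2'[of "\<lambda>t. det (B t)" 1 0 0] neg by auto
  then obtain v where v: "v \<noteq> 0" "B t *v v = 0"
    by (metis invertible_det_nz invertible_left_inverse matrix_left_invertible_ker)
  have Av: "v \<bullet> (A *v v) > 0" "v \<bullet> v > 0" using assms v by (auto simp: posdef_def)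
  have "0 = v \<bullet> (B t *v v)" using v by simp
  also have "\<dots> = (1 - t) * (v \<bullet> v) + t * (v \<bullet> (A *v v))"
    unfolding B by (simp add: inner_add_right)
  also have "\<dots> > 0"
  proof (cases "t = 0")
    case False
    then show ?thesis using t Av by (intro add_nonneg_pos mult_nonneg_nonneg mult_pos_pos) auto
  qed (use Av in simp)
  finally show False by simp
qed

lemma matrix_inv_left_right:
  fixes A :: "real^'n::finite^'n"
  assumes "invertible A"
  shows matrix_inv_left: "matrix_inv A ** A = mat 1" and matrix_inv_right: "A ** matrix_inv A = mat 1"
proof -
  have "\<exists>B. A ** B = mat 1 \<and> B ** A = mat 1" using assms by (simp add: invertible_def)
  from someI_ex[OF this] show "matrix_inv A ** A = mat 1" "A ** matrix_inv A = mat 1"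
    by (simp_all add: matrix_inv_def)
qed

lemma matrix_inv_left_entries:
  fixes A :: "real^'n::finite^'n"
  assumes "invertible A"
  shows "(\<Sum>k\<in>UNIV. matrix_inv A $ i $ k * A $ k $ j) = (if i = j then 1 else 0)"
  using matrix_inv_left[OF assms] by (simp add: vec_eq_iff matrix_matrix_mult_def mat_def)

lemma matrix_inv_right_entries:
  fixes A :: "real^'n::finite^'n"
  assumes "invertible A"
  shows "(\<Sum>k\<in>UNIV. A $ i $ k * matrix_inv A $ k $ j) = (if i = j then 1 else 0)"
  using matrix_inv_right[OF assms] by (simp add: vec_eq_iff matrix_matrix_mult_def mat_def)

lemma matrix_inv_unique_right:
  fixes A :: "real^'n::finite^'n"
  assumes "A ** B = mat 1" shows "matrix_inv A = B"
proof -
  have i: "invertible A" using assms by (auto simp: invertible_right_inverse)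
  have "matrix_inv A = matrix_inv A ** (A ** B)" using assms by simp
  also have "\<dots> = B" by (simp add: matrix_mul_assoc matrix_inv_left[OF i])
  finally show ?thesis .
qed

lemma posdef_inv_sym:
  assumes "posdef A" shows "matrix_inv A $ i $ j = matrix_inv A $ j $ i"
proof -
  have "A ** transpose (matrix_inv A) = transpose (matrix_inv A ** A)"
    using assms by (simp add: matrix_transpose_mul posdef_def)
  also have "\<dots> = mat 1" by (simp add: matrix_inv_left posdef_invertible assms)
  finally have "matrix_inv A = transpose (matrix_inv A)"
    by (rule matrix_inv_unique_right)
  then show ?thesis unfolding transpose_def vec_eq_iff by simp
qed

lemma matrix_inv_scaleR:
  fixes A :: "real^'n::finite^'n"
  assumes "invertible A" "c \<noteq> 0"
  shows "matrix_inv (c *\<^sub>R A) = inverse c *\<^sub>R matrix_inv A"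
proof (rule matrix_inv_unique_right)
  show "(c *\<^sub>R A) ** (inverse c *\<^sub>R matrix_inv A) = mat 1"
    using matrix_inv_right[OF assms(1)] assms(2)
    by (simp add: vec_eq_iff matrix_matrix_mult_def mult_ac flip: sum_distrib_left)
qed

lemma det_scaleR:
  fixes A :: "real^'n::finite^'n"
  shows "det (c *\<^sub>R A) = c ^ CARD('n) * det A"
  by (simp add: det_def prod.distrib sum_distrib_left mult_ac)

lemma matrix_inv_cramer:
  fixes A :: "real^'n::finite^'n"
  assumes "invertible A"
  shows "matrix_inv A $ k $ l = det (\<chi> i j. if j = k then axis l 1 $ i else A $ i $ j) / det A"
proof -
  have "A *v column l (matrix_inv A) = axis l 1"
    using matrix_inv_right_entries[OF assms]
    by (simp add: vec_eq_iff matrix_vector_mult_def column_def axis_def)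
  then have "column l (matrix_inv A) = (\<chi> k. det (\<chi> i j. if j = k then axis l 1 $ i else A $ i $ j) / det A)"
    using cramer[of A] assms invertible_det_nz by blast
  then show ?thesis by (simp add: column_def vec_eq_iff)
qed

text \<open>By Cramer's rule the entries of the inverse are rational functions of the entries of the matrix.\<close>

lemma Ck_matrix_inv:
  fixes G :: "real^'n::finite \<Rightarrow> real^'m::finite^'m"
  assumes "\<And>i j. Ck k (\<lambda>x. G x $ i $ j)" "\<And>x. posdef (G x)"
  shows "Ck k (\<lambda>x. matrix_inv (G x) $ a $ b)"
proof -
  have "(\<lambda>x. matrix_inv (G x) $ a $ b) =
     (\<lambda>x. det (\<chi> i j. if j = a then axis b 1 $ i else G x $ i $ j) / det (G x))"
    using assms(2) by (simp add: matrix_inv_cramer posdef_invertible)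
  moreover have "Ck k (\<lambda>x. (\<chi> i j. if j = a then axis b 1 $ i else G x $ i $ j) $ i $ j)" for i j
    using assms(1) by (cases "j = a") (auto simp: Ck_const)
  ultimately show ?thesis
    using posdef_det_pos[OF assms(2)]
    by (auto intro!: Ck_divide Ck_det assms simp: less_imp_neq[THEN not_sym])
qed

section \<open>Derivatives of the inverse and of the determinant\<close>

lemma pd_prod:
  fixes F :: "'a \<Rightarrow> real^'n::finite \<Rightarrow> real"
  assumes "finite A" "\<And>a. a \<in> A \<Longrightarrow> F a differentiable (at x)"
  shows "pd l (\<lambda>x. \<Prod>a\<in>A. F a x) x = (\<Sum>a\<in>A. pd l (F a) x * (\<Prod>b\<in>A-{a}. F b x))"
  using assms
proof (induction A rule: finite_induct)
  case (insert c A)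
  have d: "(\<lambda>x. \<Prod>a\<in>A. F a x) differentiable (at x)"
    using insert by (intro differentiable_finite_prod) auto
  have *: "insert c A - {a} = insert c (A - {a})" "c \<notin> A - {a}" if "a \<in> A" for a
    using insert that by auto
  have "pd l (\<lambda>x. F c x * (\<Prod>a\<in>A. F a x)) x
     = pd l (F c) x * (\<Prod>a\<in>A. F a x) + F c x * (\<Sum>a\<in>A. pd l (F a) x * (\<Prod>b\<in>A-{a}. F b x))"
    using insert d by (subst pd_mult) auto
  moreover have "(\<Sum>a\<in>A. pd l (F a) x * (\<Prod>b\<in>insert c A-{a}. F b x))
      = F c x * (\<Sum>a\<in>A. pd l (F a) x * (\<Prod>b\<in>A-{a}. F b x))"
    unfolding sum_distrib_left using insert.hyps
    by (intro sum.cong refl) (simp add: * mult_ac)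
  moreover have "insert c A - {c} = A" using insert by auto
  ultimately show ?case using insert.hyps by simp
qed simp

lemma pd_det_at_identity:
  fixes B :: "real^'m::finite \<Rightarrow> real^'n::finite^'n"
  assumes d: "\<And>i j. (\<lambda>x. B x $ i $ j) differentiable (at x)" and B: "B x = mat 1"
  shows "pd l (\<lambda>x. det (B x)) x = (\<Sum>i\<in>UNIV. pd l (\<lambda>x. B x $ i $ i) x)"
proof -
  have dp: "(\<lambda>x. of_int (sign p) * (\<Prod>i\<in>UNIV. B x $ i $ p i)) differentiable (at x)" for p
    by (intro differentiable_mult differentiable_finite_prod d) auto
  have "pd l (\<lambda>x. det (B x)) x =
     (\<Sum>p | p permutes UNIV. pd l (\<lambda>x. of_int (sign p) * (\<Prod>i\<in>UNIV. B x $ i $ p i)) x)"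
    unfolding det_def by (rule pd_sum) (rule dp)
  also have "\<dots> = (\<Sum>p | p permutes (UNIV::'n set). if p = id then \<Sum>i\<in>UNIV. pd l (\<lambda>x. B x $ i $ i) x else 0)"
  proof (intro sum.cong refl)
    fix p :: "'n \<Rightarrow> 'n" assume "p \<in> {p. p permutes UNIV}"
    then have p: "p permutes UNIV" by simp
    have "pd l (\<lambda>x. of_int (sign p) * (\<Prod>i\<in>UNIV. B x $ i $ p i)) x
        = of_int (sign p) * (\<Sum>i\<in>UNIV. pd l (\<lambda>x. B x $ i $ p i) x * (\<Prod>k\<in>UNIV-{i}. B x $ k $ p k))"
      by (subst pd_cmult) (auto intro!: differentiable_finite_prod d simp: pd_prod d)
    also have "\<dots> = (if p = id then \<Sum>i\<in>UNIV. pd l (\<lambda>x. B x $ i $ i) x else 0)"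
    proof (cases "p = id")
      case True
      then show ?thesis by (simp add: B mat_def sign_id)
    next
      case False
      \<comment> \<open>A permutation other than the identity moves at least two points.\<close>
      have "(\<Prod>k\<in>UNIV-{i}. B x $ k $ p k) = 0" for i
      proof -
        obtain k where k: "p k \<noteq> k" using False by (auto simp: fun_eq_iff)
        then have "p (p k) \<noteq> p k" using p by (metis permutes_inverses(2))
        with k obtain k' where "k' \<noteq> i" "p k' \<noteq> k'" by metis
        then have "k' \<in> UNIV - {i}" "B x $ k' $ p k' = 0" by (auto simp: B mat_def)
        then show ?thesis by (meson finite prod_zero)
      qed
      then have "(\<Sum>i\<in>UNIV. pd l (\<lambda>x. B x $ i $ p i) x * (\<Prod>k\<in>UNIV-{i}. B x $ k $ p k)) = 0"
        by (simp only: mult_zero_right sum.neutral_const)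
      then show ?thesis using False by simp
    qed
    finally show "pd l (\<lambda>x. of_int (sign p) * (\<Prod>i\<in>UNIV. B x $ i $ p i)) x
       = (if p = id then \<Sum>i\<in>UNIV. pd l (\<lambda>x. B x $ i $ i) x else 0)" .
  qed
  also have "\<dots> = (\<Sum>i\<in>UNIV. pd l (\<lambda>x. B x $ i $ i) x)"
    by (subst sum.delta) (auto simp: permutes_id finite_permutations)
  finally show ?thesis .
qed

text \<open>Jacobi's formula follows from the case of the identity because \<open>det (G x\<^sub>0\<inverse> G) = det G / det (G x\<^sub>0)\<close>.\<close>

lemma pd_det:
  fixes G :: "real^'m::finite \<Rightarrow> real^'n::finite^'n"
  assumes d: "\<And>i j. (\<lambda>x. G x $ i $ j) differentiable (at x)" and inv: "invertible (G x)"
  shows "pd l (\<lambda>x. det (G x)) x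
     = det (G x) * (\<Sum>i\<in>UNIV. \<Sum>j\<in>UNIV. matrix_inv (G x) $ i $ j * pd l (\<lambda>x. G x $ j $ i) x)"
proof -
  define H where "H = matrix_inv (G x)"
  have HG: "H ** G x = mat 1" by (simp add: H_def matrix_inv_left inv)
  then have dd: "det H * det (G x) = 1" by (metis det_I det_mul)
  have ddet: "(\<lambda>x. det (G x)) differentiable (at x)"
    unfolding det_def by (auto intro!: differentiable_sum differentiable_mult differentiable_finite_prod d)
  have ent: "(H ** G y) $ i $ j = (\<Sum>k\<in>UNIV. H $ i $ k * G y $ k $ j)" for y i j
    by (simp add: matrix_matrix_mult_def)
  have "det H * pd l (\<lambda>x. det (G x)) x = pd l (\<lambda>x. det (H ** G x)) x"
    using ddet by (simp add: det_mul pd_cmult)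
  also have "\<dots> = (\<Sum>i\<in>UNIV. pd l (\<lambda>x. (H ** G x) $ i $ i) x)"
    by (rule pd_det_at_identity[where B = "\<lambda>x. H ** G x", OF _ HG]) (auto simp: ent intro!: differentiable_sum differentiable_mult d)
  also have "\<dots> = (\<Sum>i\<in>UNIV. \<Sum>j\<in>UNIV. H $ i $ j * pd l (\<lambda>x. G x $ j $ i) x)"
    unfolding ent using d by (intro sum.cong refl) (subst pd_sum, auto simp: pd_cmult)
  finally have "det (G x) * (det H * pd l (\<lambda>x. det (G x)) x) = det (G x) * \<dots>" by simp
  moreover have "det (G x) * (det H * X) = X" for X
    using dd by (simp add: mult.commute[of "det (G x)"] mult.assoc[symmetric])
  ultimately show ?thesis unfolding H_def by (simp only:)
qed

lemma pd_matrix_inv: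
  fixes G :: "real^'m::finite \<Rightarrow> real^'n::finite^'n"
  assumes G: "\<And>i j. Ck 1 (\<lambda>x. G x $ i $ j)" and pos: "\<And>x. posdef (G x)"
  shows "pd l (\<lambda>x. matrix_inv (G x) $ a $ b) x =
    - (\<Sum>c\<in>UNIV. \<Sum>d\<in>UNIV. matrix_inv (G x) $ a $ c * pd l (\<lambda>x. G x $ c $ d) x * matrix_inv (G x) $ d $ b)"
proof -
  define H where "H x = matrix_inv (G x)" for x
  have inv: "invertible (G x)" for x by (simp add: posdef_invertible pos)
  have dG: "(\<lambda>x. G x $ i $ j) differentiable (at x)" for i j x using G by simp
  have dH: "(\<lambda>x. H x $ i $ j) differentiable (at x)" for i j x
    using Ck_matrix_inv[OF G pos] by (simp add: H_def)
  have 0: "(\<Sum>c\<in>UNIV. pd l (\<lambda>x. H x $ a $ c) x * G x $ c $ d + H x $ a $ c * pd l (\<lambda>x. G x $ c $ d) x) = 0" for d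
  proof -
    have "pd l (\<lambda>x. \<Sum>c\<in>UNIV. H x $ a $ c * G x $ c $ d) x = 0"
      unfolding H_def matrix_inv_left_entries[OF inv] by simp
    then show ?thesis
      by (simp add: pd_sum pd_mult dG dH differentiable_mult)
  qed
  have "pd l (\<lambda>x. H x $ a $ b) x = (\<Sum>c\<in>UNIV. pd l (\<lambda>x. H x $ a $ c) x * (if c = b then 1 else 0))"
    by (simp add: if_distrib cong: if_cong)
  also have "\<dots> = (\<Sum>c\<in>UNIV. \<Sum>d\<in>UNIV. pd l (\<lambda>x. H x $ a $ c) x * (G x $ c $ d * H x $ d $ b))"
    unfolding H_def by (simp add: matrix_inv_right_entries[OF inv] flip: sum_distrib_left)
  also have "\<dots> = (\<Sum>d\<in>UNIV. (\<Sum>c\<in>UNIV. pd l (\<lambda>x. H x $ a $ c) x * G x $ c $ d) * H x $ d $ b)"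
    by (subst sum.swap) (simp add: sum_distrib_right sum_distrib_left mult_ac)
  also have "\<dots> = (\<Sum>d\<in>UNIV. - (\<Sum>c\<in>UNIV. H x $ a $ c * pd l (\<lambda>x. G x $ c $ d) x) * H x $ d $ b)"
    using 0 unfolding sum.distrib by (intro sum.cong refl arg_cong2[where f = "(*)"]) (simp add: eq_neg_iff_add_eq_0)
  also have "\<dots> = - (\<Sum>c\<in>UNIV. \<Sum>d\<in>UNIV. H x $ a $ c * pd l (\<lambda>x. G x $ c $ d) x * H x $ d $ b)"
    by (subst sum.swap) (simp add: sum_distrib_right sum_negf)
  finally show ?thesis by (simp add: H_def)
qed

text \<open>
  The logarithmic derivative of the volume density is the trace that turns the Laplacian into a
  divergence.
\<close>

lemma volume_density:
  fixes G :: "real^'m::finite \<Rightarrow> real^'n::finite^'n"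
  assumes G: "\<And>i j. Ck 1 (\<lambda>x. G x $ i $ j)" and pos: "\<And>x. posdef (G x)"
  shows "Ck 1 (\<lambda>x. sqrt (det (G x)))"
    and "pd l (\<lambda>x. sqrt (det (G x))) x =
      1/2 * sqrt (det (G x)) * (\<Sum>i\<in>UNIV. \<Sum>j\<in>UNIV. matrix_inv (G x) $ i $ j * pd l (\<lambda>x. G x $ i $ j) x)"
proof -
  note dp = posdef_det_pos[OF pos]
  have C: "Ck 1 (\<lambda>x. det (G x))" by (rule Ck_det[OF G])
  show "Ck 1 (\<lambda>x. sqrt (det (G x)))" by (rule C1_sqrt(1)[OF C dp])
  have s: "G x $ i $ j = G x $ j $ i" for x i j by (rule posdef_sym[OF pos])
  have "pd l (\<lambda>x. sqrt (det (G x))) x = pd l (\<lambda>x. det (G x)) x / (2 * sqrt (det (G x)))"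
    by (rule C1_sqrt(2)[OF C dp])
  also have "pd l (\<lambda>x. det (G x)) x = det (G x) *
     (\<Sum>i\<in>UNIV. \<Sum>j\<in>UNIV. matrix_inv (G x) $ i $ j * pd l (\<lambda>x. G x $ j $ i) x)"
    by (rule pd_det) (use G pos in \<open>auto simp: posdef_invertible\<close>)
  also have "(\<Sum>i\<in>UNIV. \<Sum>j\<in>UNIV. matrix_inv (G x) $ i $ j * pd l (\<lambda>x. G x $ j $ i) x)
     = (\<Sum>i\<in>UNIV. \<Sum>j\<in>UNIV. matrix_inv (G x) $ i $ j * pd l (\<lambda>x. G x $ i $ j) x)"
    using s by (intro sum.cong refl arg_cong2[where f = "(*)"]) (metis ext)
  also have "det (G x) * S / (2 * sqrt (det (G x))) = 1/2 * sqrt (det (G x)) * S" for S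
    using real_div_sqrt[of "det (G x)"] dp[of x] by (simp add: divide_simps)
  finally show "pd l (\<lambda>x. sqrt (det (G x))) x =
      1/2 * sqrt (det (G x)) * (\<Sum>i\<in>UNIV. \<Sum>j\<in>UNIV. matrix_inv (G x) $ i $ j * pd l (\<lambda>x. G x $ i $ j) x)" .
qed

section \<open>Scalar curvature under a conformal change\<close>

definition chr :: "(real^'n::finite \<Rightarrow> real^'n^'n) \<Rightarrow> 'n \<Rightarrow> 'n \<Rightarrow> 'n \<Rightarrow> real^'n \<Rightarrow> real" where
  "chr G k i j x = (1/2) * (\<Sum>l\<in>UNIV. matrix_inv (G x) $ k $ l *
       (pd i (\<lambda>y. G y $ j $ l) x + pd j (\<lambda>y. G y $ i $ l) x - pd l (\<lambda>y. G y $ i $ j) x))"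

definition ric :: "(real^'n::finite \<Rightarrow> real^'n^'n) \<Rightarrow> 'n \<Rightarrow> 'n \<Rightarrow> real^'n \<Rightarrow> real" where
  "ric G j k x = (\<Sum>i\<in>UNIV. pd i (chr G i j k) x - pd j (chr G i i k) x
     + (\<Sum>m\<in>UNIV. chr G i i m x * chr G m j k x - chr G i j m x * chr G m i k x))"

lemma christoffel_torus_proj: "christoffel g k i j \<circ> torus_proj = chr (g \<circ> torus_proj) k i j"
  by (auto simp: fun_eq_iff christoffel_def chr_def partial_torus_proj o_def)

lemma ricci_torus_proj: "ricci g j k (torus_proj x) = ric (g \<circ> torus_proj) j k x"
proof -
  have "christoffel g k i j (torus_proj x) = chr (g \<circ> torus_proj) k i j x" for k i j
    using christoffel_torus_proj[of g k i j] by (simp add: fun_eq_iff)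
  then show ?thesis
    by (simp add: ricci_def ric_def riemann_def partial_torus_proj christoffel_torus_proj)
qed

text \<open>
  The pointwise identity behind the conformal change, with the metric \<open>G\<close>, its inverse \<open>H\<close> and the
  one-form \<open>f\<close> at a point replaced by numbers: \<open>F\<close> is the gradient, \<open>df\<close>, \<open>dF\<close> and \<open>dG\<close> are
  derivatives (first index), and \<open>S\<close> is the difference of the two Levi-Civita connections.  Each term of
  the difference of the Ricci tensors is contracted separately; the derivatives of the Christoffel
  symbols cancel in the difference, which is why only first derivatives of \<open>G\<close> occur.
  The Laplacian enters as a divergence, \<open>(\<Sum>i. dF i i) + (\<Sum>i. tr i * F i)\<close>.
\<close>

lemma conformal_ricci_contraction:
  fixes G H :: "'n::finite \<Rightarrow> 'n \<Rightarrow> real" and f F :: "'n \<Rightarrow> real"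
    and \<Gamma> dG :: "'n \<Rightarrow> 'n \<Rightarrow> 'n \<Rightarrow> real" and df dF :: "'n \<Rightarrow> 'n \<Rightarrow> real"
  defines "S \<equiv> \<lambda>l j k. (if l = j then f k else 0) + (if l = k then f j else 0) - G j k * F l"
    and "dS \<equiv> \<lambda>i l j k. (if l = j then df i k else 0) + (if l = k then df i j else 0)
            - (dG i j k * F l + G j k * dF i l)"
    and "tr \<equiv> \<lambda>i. \<Sum>m\<in>UNIV. \<Gamma> m m i"
    and "n \<equiv> real CARD('n)"
  assumes symG: "\<And>i j. G i j = G j i" and symH: "\<And>i j. H i j = H j i"
    and HG: "\<And>i j. (\<Sum>k\<in>UNIV. H i k * G k j) = (if i = j then 1 else 0)"
    and fF: "\<And>i. (\<Sum>k\<in>UNIV. G i k * F k) = f i"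
    and dfF: "\<And>j k. (\<Sum>i\<in>UNIV. dG j i k * F i + G i k * dF j i) = df j k"
    and \<Gamma>: "\<And>k i j. \<Gamma> k i j = 1/2 * (\<Sum>l\<in>UNIV. H k l * (dG i j l + dG j i l - dG l i j))"
    and dGsym: "\<And>i j k. dG i j k = dG i k j"
  shows "(\<Sum>j\<in>UNIV. \<Sum>k\<in>UNIV. H j k * (\<Sum>i\<in>UNIV. dS i i j k - dS j i i k
       + (\<Sum>m\<in>UNIV. (\<Gamma> i i m + S i i m) * (\<Gamma> m j k + S m j k) - \<Gamma> i i m * \<Gamma> m j k
           - ((\<Gamma> i j m + S i j m) * (\<Gamma> m i k + S m i k) - \<Gamma> i j m * \<Gamma> m i k))))
     = - 2 * (n - 1) * ((\<Sum>i\<in>UNIV. dF i i) + (\<Sum>i\<in>UNIV. tr i * F i)) - (n - 1) * (n - 2) * (\<Sum>i\<in>UNIV. f i * F i)"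
proof -
  define V T N where "V = (\<Sum>i\<in>UNIV. dF i i)" and "T = (\<Sum>i\<in>UNIV. tr i * F i)" and "N = (\<Sum>i\<in>UNIV. f i * F i)"
  define P Q where "P = (\<Sum>j\<in>UNIV. \<Sum>k\<in>UNIV. H j k * df j k)"
    and "Q = (\<Sum>j\<in>UNIV. \<Sum>k\<in>UNIV. H j k * (\<Sum>m\<in>UNIV. \<Gamma> m j k * f m))"
  have fF': "(\<Sum>k\<in>UNIV. F k * G k i) = f i" for i using fF[of i] symG by (simp add: mult.commute)
  have HG': "(\<Sum>k\<in>UNIV. G j k * H k i) = (if i = j then 1 else 0)" for i j
    using HG[of i j] symG symH by (simp add: mult.commute)
  have Hf: "(\<Sum>k\<in>UNIV. H i k * f k) = F i" for i
  proof -
    have "(\<Sum>k\<in>UNIV. H i k * f k) = (\<Sum>l\<in>UNIV. (\<Sum>k\<in>UNIV. H i k * G k l) * F l)"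
      unfolding fF[symmetric] sum_distrib_left sum_distrib_right by (subst sum.swap) (simp add: mult_ac)
    then show ?thesis by (simp add: HG if_distrib[of "\<lambda>t. t * _"] cong: if_cong)
  qed
  have \<Gamma>sym: "\<Gamma> k i j = \<Gamma> k j i" for k i j
    unfolding \<Gamma> by (intro arg_cong2[where f = "(*)"] sum.cong refl) (simp add: dGsym[of _ i j])
  have delta: "(\<Sum>i\<in>UNIV. (if i = a then b i else 0)) = b a" "(\<Sum>i\<in>UNIV. (if a = i then b i else 0)) = b a"
    for a :: 'n and b :: "'n \<Rightarrow> real" by simp_all
  have mif: "(if c then a else 0) * b = (if c then a * b else 0)"
     "b * (if c then a else 0) = (if c then b * a else 0)" for c and a b :: real by auto
  have c1: "(\<Sum>j\<in>UNIV. \<Sum>k\<in>UNIV. H j k * G j k) = n"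
  proof -
    have "(\<Sum>k\<in>UNIV. H j k * G j k) = (\<Sum>k\<in>UNIV. H j k * G k j)" for j
      by (intro sum.cong refl arg_cong2[where f = "(*)"] symG)
    then have "(\<Sum>k\<in>UNIV. H j k * G j k) = 1" for j using HG[of j j] by simp
    then show ?thesis by (simp add: n_def)
  qed
  have c2: "(\<Sum>j\<in>UNIV. \<Sum>k\<in>UNIV. H j k * (a j * f k)) = (\<Sum>j\<in>UNIV. a j * F j)" for a
    unfolding Hf[symmetric] sum_distrib_left by (simp add: mult_ac)
  have c3: "(\<Sum>j\<in>UNIV. \<Sum>k\<in>UNIV. H j k * (f j * a k)) = (\<Sum>j\<in>UNIV. a j * F j)" for a
    using c2[of a] by (subst sum.swap) (simp add: symH[of _ j for j] mult_ac symH)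
  have tr: "(\<Sum>j\<in>UNIV. \<Sum>k\<in>UNIV. H j k * dG i j k) = 2 * tr i" for i
  proof -
    have "2 * tr i = (\<Sum>m\<in>UNIV. \<Sum>l\<in>UNIV. H m l * dG m i l) + (\<Sum>m\<in>UNIV. \<Sum>l\<in>UNIV. H m l * dG i m l)
         - (\<Sum>m\<in>UNIV. \<Sum>l\<in>UNIV. H m l * dG l m i)"
      unfolding tr_def \<Gamma> by (simp add: sum_distrib_left sum.distrib sum_subtractf ring_distribs)
    moreover have "(\<Sum>m\<in>UNIV. \<Sum>l\<in>UNIV. H m l * dG l m i) = (\<Sum>m\<in>UNIV. \<Sum>l\<in>UNIV. H m l * dG m i l)"
      by (subst sum.swap) (intro sum.cong refl, metis symH dGsym)
    ultimately show ?thesis by simp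
  qed
  have c4: "(\<Sum>j\<in>UNIV. \<Sum>k\<in>UNIV. H j k * (\<Sum>i\<in>UNIV. dG i j k * F i)) = 2 * T"
  proof -
    have "(\<Sum>j\<in>UNIV. \<Sum>k\<in>UNIV. H j k * (\<Sum>i\<in>UNIV. dG i j k * F i))
       = (\<Sum>i\<in>UNIV. (\<Sum>j\<in>UNIV. \<Sum>k\<in>UNIV. H j k * dG i j k) * F i)"
      unfolding sum_distrib_left sum_distrib_right
      by (subst (2) sum.swap, subst sum.swap) (simp add: mult_ac)
    also have "\<dots> = 2 * T" unfolding tr T_def by (simp add: sum_distrib_left mult_ac)
    finally show ?thesis .
  qed
  have P': "(\<Sum>j\<in>UNIV. \<Sum>k\<in>UNIV. H j k * df k j) = P"
    unfolding P_def by (subst sum.swap) (simp add: symH)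
  have c5: "(\<Sum>j\<in>UNIV. \<Sum>k\<in>UNIV. H j k * (\<Sum>i\<in>UNIV. \<Sum>m\<in>UNIV. \<Gamma> i j m * G i k * F m)) = T"
  proof -
    have "(\<Sum>k\<in>UNIV. H j k * (\<Sum>i\<in>UNIV. \<Sum>m\<in>UNIV. \<Gamma> i j m * G i k * F m)) = (\<Sum>m\<in>UNIV. \<Gamma> j j m * F m)" for j
    proof -
      have "(\<Sum>k\<in>UNIV. H j k * (\<Sum>i\<in>UNIV. \<Sum>m\<in>UNIV. \<Gamma> i j m * G i k * F m))
          = (\<Sum>i\<in>UNIV. (\<Sum>k\<in>UNIV. H j k * G k i) * (\<Sum>m\<in>UNIV. \<Gamma> i j m * F m))"
        unfolding sum_product unfolding sum_distrib_left
        by (subst sum.swap) (simp add: mult_ac symG)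
      then show ?thesis by (simp add: HG mif delta)
    qed
    then have "(\<Sum>j\<in>UNIV. \<Sum>k\<in>UNIV. H j k * (\<Sum>i\<in>UNIV. \<Sum>m\<in>UNIV. \<Gamma> i j m * G i k * F m))
        = (\<Sum>j\<in>UNIV. \<Sum>m\<in>UNIV. \<Gamma> j j m * F m)" by simp
    also have "\<dots> = T" unfolding T_def tr_def sum_distrib_right by (subst sum.swap) simp
    finally show ?thesis .
  qed
  \<comment> \<open>The Laplacian as the trace of the Hessian, \<open>P - Q\<close>, and as a divergence, \<open>V + T\<close>.\<close>
  have PQ: "P - Q = V + T"
  proof -
    define Y where "Y = (\<Sum>j\<in>UNIV. \<Sum>k\<in>UNIV. H j k * (\<Sum>i\<in>UNIV. dG j i k * F i))"
    have "P = Y + (\<Sum>j\<in>UNIV. \<Sum>k\<in>UNIV. H j k * (\<Sum>i\<in>UNIV. G i k * dF j i))"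
      unfolding P_def dfF[symmetric] Y_def by (simp add: sum.distrib ring_distribs)
    moreover have "(\<Sum>k\<in>UNIV. H j k * (\<Sum>i\<in>UNIV. G i k * dF j i)) = dF j j" for j
    proof -
      have "(\<Sum>k\<in>UNIV. H j k * (\<Sum>i\<in>UNIV. G i k * dF j i)) = (\<Sum>i\<in>UNIV. (\<Sum>k\<in>UNIV. H j k * G k i) * dF j i)"
        unfolding sum_distrib_left sum_distrib_right by (subst sum.swap) (simp add: mult_ac symG)
      then show ?thesis by (simp add: HG mif delta)
    qed
    ultimately have P: "P = Y + V" by (simp add: V_def)
    have g: "(\<Sum>m\<in>UNIV. \<Gamma> m j k * f m) = 1/2 * (\<Sum>l\<in>UNIV. F l * (dG j k l + dG k j l - dG l j k))" for j k
    proof -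
      have "(\<Sum>m\<in>UNIV. \<Gamma> m j k * f m) = 1/2 * (\<Sum>l\<in>UNIV. (\<Sum>m\<in>UNIV. H l m * f m) * (dG j k l + dG k j l - dG l j k))"
        unfolding \<Gamma> sum_distrib_left sum_distrib_right by (subst sum.swap) (simp add: mult_ac symH)
      then show ?thesis by (simp add: Hf)
    qed
    have "2 * Q = Y + (\<Sum>j\<in>UNIV. \<Sum>k\<in>UNIV. H j k * (\<Sum>i\<in>UNIV. dG k i j * F i)) - 2 * T"
      unfolding Q_def g c4[symmetric] Y_def sum_distrib_left
      by (simp add: sum.distrib sum_subtractf ring_distribs sum_distrib_left mult_ac dGsym)
    also have "(\<Sum>j\<in>UNIV. \<Sum>k\<in>UNIV. H j k * (\<Sum>i\<in>UNIV. dG k i j * F i)) = Y"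
      unfolding Y_def by (subst sum.swap) (simp add: symH)
    finally show ?thesis using P by simp
  qed
  have S1: "(\<Sum>i\<in>UNIV. S i i m) = n * f m" for m
    unfolding S_def by (simp add: sum.distrib sum_subtractf delta n_def)
      (use fF[of m] symG in \<open>simp add: mult.commute\<close>)
  have dS1: "(\<Sum>i\<in>UNIV. dS j i i k) = n * df j k" for j k
    unfolding dS_def using dfF[of j k] by (simp add: sum.distrib sum_subtractf delta n_def)
  have dS2: "(\<Sum>i\<in>UNIV. dS i i j k) = df j k + df k j - (\<Sum>i\<in>UNIV. dG i j k * F i) - G j k * V" for j k
    unfolding dS_def V_def by (simp add: sum.distrib sum_subtractf delta sum_distrib_left)
  have aS: "(\<Sum>m\<in>UNIV. a m * S m j k) = a j * f k + a k * f j - G j k * (\<Sum>m\<in>UNIV. a m * F m)" for a j k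
    unfolding S_def by (simp add: sum.distrib sum_subtractf ring_distribs mif delta sum_distrib_left mult_ac)
  define A where "A j k = tr j * f k + (\<Sum>i\<in>UNIV. \<Gamma> i j k * f i) - (\<Sum>i\<in>UNIV. \<Sum>m\<in>UNIV. \<Gamma> i j m * G i k * F m)" for j k
  have A: "(\<Sum>i\<in>UNIV. \<Sum>m\<in>UNIV. \<Gamma> i j m * S m i k) = A j k" for j k
    unfolding aS A_def tr_def by (simp add: sum.distrib sum_subtractf sum_distrib_left sum_distrib_right \<Gamma>sym mult_ac)
  have A': "(\<Sum>i\<in>UNIV. \<Sum>m\<in>UNIV. S i j m * \<Gamma> m i k) = A k j" for j k
  proof -
    have "S i j m = S i m j" for i j m by (simp add: S_def symG)
    then have "(\<Sum>i\<in>UNIV. \<Sum>m\<in>UNIV. S i j m * \<Gamma> m i k) = (\<Sum>i\<in>UNIV. \<Sum>m\<in>UNIV. \<Gamma> m k i * S i m j)"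
      by (simp add: \<Gamma>sym mult.commute)
    also have "\<dots> = A k j" unfolding A[symmetric] by (rule sum.swap)
    finally show ?thesis .
  qed
  have SS: "(\<Sum>i\<in>UNIV. \<Sum>m\<in>UNIV. S i j m * S m i k) = (n + 2) * (f j * f k) - 2 * (G j k * N)" for j k
  proof -
    have "(\<Sum>m\<in>UNIV. S i j m * S m i k) = S i j i * f k + S i j k * f i - G i k * (\<Sum>m\<in>UNIV. S i j m * F m)" for i
      by (rule aS)
    moreover have "(\<Sum>m\<in>UNIV. S i j m * F m) = (if i = j then N else 0) + F i * f j - f j * F i" for i
    proof -
      have "(\<Sum>m\<in>UNIV. S i j m * F m) = (if i = j then N else 0) + F i * f j - (\<Sum>m\<in>UNIV. G j m * F m) * F i"
        unfolding S_def N_def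
        by (auto simp: sum.distrib sum_subtractf ring_distribs mif delta sum_distrib_left sum_distrib_right mult_ac)
      then show ?thesis unfolding fF .
    qed
    moreover have "(\<Sum>i\<in>UNIV. S i j i) = n * f j"
      using S1[of j] by (simp add: S_def symG add.commute)
    moreover have "(\<Sum>i\<in>UNIV. S i j k * f i) = 2 * (f j * f k) - G j k * N"
      using aS[of f j k] by (simp add: N_def mult_ac)
    ultimately show ?thesis
      by (simp add: sum.distrib sum_subtractf mif delta flip: sum_distrib_right)
         (simp add: algebra_simps symG)
  qed
  have inner: "(\<Sum>i\<in>UNIV. dS i i j k - dS j i i k
       + (\<Sum>m\<in>UNIV. (\<Gamma> i i m + S i i m) * (\<Gamma> m j k + S m j k) - \<Gamma> i i m * \<Gamma> m j k
           - ((\<Gamma> i j m + S i j m) * (\<Gamma> m i k + S m i k) - \<Gamma> i j m * \<Gamma> m i k)))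
     = df j k + df k j - (\<Sum>i\<in>UNIV. dG i j k * F i) - G j k * V - n * df j k
       + (tr j * f k + f j * tr k - G j k * T) + n * (\<Sum>m\<in>UNIV. \<Gamma> m j k * f m)
       + n * (2 * (f j * f k) - G j k * N) - A j k - A k j - ((n + 2) * (f j * f k) - 2 * (G j k * N))" for j k
  proof -
    have sw: "(\<Sum>m\<in>UNIV. (\<Sum>i\<in>UNIV. a i m) * b m) = (\<Sum>i\<in>UNIV. \<Sum>m\<in>UNIV. a i m * b m)"
      for a :: "'n \<Rightarrow> 'n \<Rightarrow> real" and b :: "'n \<Rightarrow> real"
      unfolding sum_distrib_right by (rule sum.swap)
    have "(\<Sum>i\<in>UNIV. \<Sum>m\<in>UNIV. (\<Gamma> i i m + S i i m) * (\<Gamma> m j k + S m j k) - \<Gamma> i i m * \<Gamma> m j k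
           - ((\<Gamma> i j m + S i j m) * (\<Gamma> m i k + S m i k) - \<Gamma> i j m * \<Gamma> m i k))
       = (\<Sum>m\<in>UNIV. (\<Sum>i\<in>UNIV. \<Gamma> i i m) * S m j k) + (\<Sum>m\<in>UNIV. (\<Sum>i\<in>UNIV. S i i m) * \<Gamma> m j k)
         + (\<Sum>m\<in>UNIV. (\<Sum>i\<in>UNIV. S i i m) * S m j k)
         - (\<Sum>i\<in>UNIV. \<Sum>m\<in>UNIV. \<Gamma> i j m * S m i k) - (\<Sum>i\<in>UNIV. \<Sum>m\<in>UNIV. S i j m * \<Gamma> m i k)
         - (\<Sum>i\<in>UNIV. \<Sum>m\<in>UNIV. S i j m * S m i k)"
      unfolding sw by (simp add: sum.distrib sum_subtractf algebra_simps)
    also have "(\<Sum>m\<in>UNIV. (\<Sum>i\<in>UNIV. \<Gamma> i i m) * S m j k) = tr j * f k + f j * tr k - G j k * T"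
      unfolding aS T_def tr_def by (simp add: mult.commute)
    also have "(\<Sum>m\<in>UNIV. (\<Sum>i\<in>UNIV. S i i m) * \<Gamma> m j k) = n * (\<Sum>m\<in>UNIV. \<Gamma> m j k * f m)"
      unfolding S1 sum_distrib_left by (simp add: mult_ac)
    also have "(\<Sum>m\<in>UNIV. (\<Sum>i\<in>UNIV. S i i m) * S m j k) = n * (2 * (f j * f k) - G j k * N)"
      using aS[of f j k] unfolding S1 N_def by (simp add: mult.assoc sum_distrib_left[symmetric]) 
    finally show ?thesis
      unfolding A A' SS by (simp add: sum.distrib sum_subtractf dS1 dS2)
  qed
  have AT: "(\<Sum>j\<in>UNIV. \<Sum>k\<in>UNIV. H j k * A j k) = Q"
  proof -
    have "(\<Sum>j\<in>UNIV. \<Sum>k\<in>UNIV. H j k * A j k) = T + Q - T"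
      unfolding A_def Q_def right_diff_distrib distrib_left sum.distrib sum_subtractf c2 c5
      by (simp add: T_def)
    then show ?thesis by simp
  qed
  have AT': "(\<Sum>j\<in>UNIV. \<Sum>k\<in>UNIV. H j k * A k j) = Q"
    using AT by (subst sum.swap) (simp add: symH)
  have scal: "(\<Sum>j\<in>UNIV. \<Sum>k\<in>UNIV. H j k * (c * X j k)) = c * (\<Sum>j\<in>UNIV. \<Sum>k\<in>UNIV. H j k * X j k)" for c X
    by (simp add: sum_distrib_left mult_ac)
  have Gc: "(\<Sum>j\<in>UNIV. \<Sum>k\<in>UNIV. H j k * (G j k * c)) = n * c" for c
    unfolding c1[symmetric] sum_distrib_right by (simp add: mult_ac)
  show ?thesis
    unfolding inner V_def[symmetric] T_def[symmetric] N_def[symmetric]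
    unfolding right_diff_distrib[of "H _ _"] distrib_left[of "H _ _"] sum.distrib sum_subtractf scal Gc AT AT' c2 c3 c4 P'
    unfolding P_def[symmetric] Q_def[symmetric] N_def[symmetric] T_def[symmetric]
    using PQ by (simp add: algebra_simps) 
qed

definition scal :: "(real^'n::finite \<Rightarrow> real^'n^'n) \<Rightarrow> real^'n \<Rightarrow> real" where
  "scal G x = (\<Sum>j\<in>UNIV. \<Sum>k\<in>UNIV. matrix_inv (G x) $ j $ k * ric G j k x)"

lemma scalar_curvature_torus_proj: "scalar_curvature g (torus_proj x) = scal (g \<circ> torus_proj) x"
  by (simp add: scalar_curvature_def scal_def ricci_torus_proj)

text \<open>The factor is written \<open>1/w\<close>, with \<open>w = exp (-2\<phi>)\<close>, because \<open>w\<close> will turn out to be almost subharmonic.\<close>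

locale conformal_change =
  fixes G :: "real^'n::finite \<Rightarrow> real^'n^'n" and w :: "real^'n \<Rightarrow> real"
  assumes G: "\<And>i j. Ck 2 (\<lambda>x. G x $ i $ j)" and pos: "\<And>x. posdef (G x)"
    and w: "Ck 2 w" and w_pos: "\<And>x. w x > 0"
begin

text \<open>
  With \<open>w = exp (-2\<phi>)\<close>, the one-form \<open>f\<close> is the differential of \<open>\<phi>\<close>, the vector field \<open>F\<close> its gradient,
  \<open>Gh\<close> the conformal metric and \<open>S\<close> the difference of the Christoffel symbols.
\<close>

definition H where "H x = matrix_inv (G x)"
definition f where "f i x = - pd i w x / (2 * w x)"
definition F where "F l x = (\<Sum>m\<in>UNIV. H x $ l $ m * f m x)"
definition Gh where "Gh x = inverse (w x) *\<^sub>R G x"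
definition S where "S l j k x = (if l = j then f k x else 0) + (if l = k then f j x else 0) - G x $ j $ k * F l x"
definition Dv where "Dv x = sqrt (det (G x))"

lemma inv: "invertible (G x)"
  by (simp add: posdef_invertible pos)

lemma G_sym: "G x $ i $ j = G x $ j $ i" and H_sym: "H x $ i $ j = H x $ j $ i"
  by (simp_all add: posdef_sym[OF pos] posdef_inv_sym[OF pos] H_def)

lemma HG: "(\<Sum>k\<in>UNIV. H x $ i $ k * G x $ k $ j) = (if i = j then 1 else 0)"
  unfolding H_def by (rule matrix_inv_left_entries[OF inv])

lemma GH: "(\<Sum>k\<in>UNIV. G x $ i $ k * H x $ k $ j) = (if i = j then 1 else 0)"
  unfolding H_def by (rule matrix_inv_right_entries[OF inv])

lemma C2: "Ck 2 (\<lambda>x. H x $ i $ j)" "Ck 2 w"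
  unfolding H_def by (intro Ck_matrix_inv G pos w)+

lemma C1: "Ck 1 (\<lambda>x. G x $ i $ j)" "Ck 1 (\<lambda>x. H x $ i $ j)" "Ck 1 w"
   "Ck 1 (pd l (\<lambda>x. G x $ i $ j))" "Ck 1 (pd l w)"
proof -
  have "Ck 1 u" "Ck 1 (pd l u)" if "Ck 2 u" for u :: "real^'n \<Rightarrow> real"
    using that by (metis Ck_SucD Suc_1, metis Ck_pd Suc_1)
  then show "Ck 1 (\<lambda>x. G x $ i $ j)" "Ck 1 (\<lambda>x. H x $ i $ j)" "Ck 1 w"
   "Ck 1 (pd l (\<lambda>x. G x $ i $ j))" "Ck 1 (pd l w)"
    using G C2 by blast+
qed

lemma f_C1: "Ck 1 (f i)"
proof -
  have "Ck 1 (\<lambda>x. (-1) * pd i w x / (2 * w x))"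
    by (intro Ck_divide Ck_mult Ck_const C1) (use w_pos in \<open>simp add: less_imp_neq[THEN not_sym]\<close>)
  then show ?thesis by (simp add: f_def [abs_def])
qed

lemma F_C1: "Ck 1 (F l)"
  unfolding F_def [abs_def] by (intro Ck_sum Ck_mult C1 f_C1)

lemma chr_C1: "Ck 1 (chr G k i j)"
  unfolding chr_def [abs_def] H_def [symmetric] by (intro Ck_mult Ck_sum Ck_add Ck_diff Ck_const C1)

lemma diff1: "Ck 1 u \<Longrightarrow> u differentiable (at x)" for u :: "real^'n \<Rightarrow> real"
  by simp

lemmas dfs = C1[THEN diff1] f_C1[THEN diff1] F_C1[THEN diff1] chr_C1[THEN diff1]

lemma pd_w: "pd i w x = - 2 * w x * f i x"
  using w_pos[of x] by (simp add: f_def)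

lemma chr_Gh: "chr Gh k i j x = chr G k i j x + S k i j x"
proof -
  have w0: "w x \<noteq> 0" "w y \<noteq> 0" for y using w_pos by (metis less_irrefl)+
  have inv': "matrix_inv (Gh x) = w x *\<^sub>R H x"
    using w0 by (simp add: Gh_def H_def matrix_inv_scaleR inv)
  have pdG: "pd a (\<lambda>y. Gh y $ b $ c) x = inverse (w x) * (pd a (\<lambda>y. G y $ b $ c) x + 2 * f a x * G x $ b $ c)" for a b c
  proof -
    have "pd a (\<lambda>y. Gh y $ b $ c) x = pd a (\<lambda>y. inverse (w y) * G y $ b $ c) x" by (simp add: Gh_def)
    also have "\<dots> = - (inverse (w x) * inverse (w x)) * pd a w x * G x $ b $ c + inverse (w x) * pd a (\<lambda>y. G y $ b $ c) x"
      by (simp add: pd_mult pd_inverse dfs w0 differentiable_inverse_real)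
    finally show ?thesis using w0 by (simp add: pd_w field_simps)
  qed
  have "chr Gh k i j x = (1/2) * (\<Sum>l\<in>UNIV. H x $ k $ l *
       (pd i (\<lambda>y. G y $ j $ l) x + pd j (\<lambda>y. G y $ i $ l) x - pd l (\<lambda>y. G y $ i $ j) x))
     + (\<Sum>l\<in>UNIV. H x $ k $ l * (f i x * G x $ j $ l + f j x * G x $ i $ l - f l x * G x $ i $ j))"
    unfolding chr_def inv' pdG sum_distrib_left sum.distrib[symmetric]
    using w0 by (intro sum.cong refl) (simp add: field_simps)
  also have "(\<Sum>l\<in>UNIV. H x $ k $ l * (f i x * G x $ j $ l + f j x * G x $ i $ l - f l x * G x $ i $ j))
     = f i x * (\<Sum>l\<in>UNIV. H x $ k $ l * G x $ l $ j) + f j x * (\<Sum>l\<in>UNIV. H x $ k $ l * G x $ l $ i) - G x $ i $ j * F k x"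
    unfolding F_def sum_distrib_left sum.distrib[symmetric] sum_subtractf[symmetric]
    by (intro sum.cong refl) (simp add: algebra_simps G_sym)
  also have "\<dots> = S k i j x" unfolding HG S_def by auto
  finally show ?thesis by (simp add: chr_def H_def)
qed

lemma GF: "(\<Sum>k\<in>UNIV. G x $ i $ k * F k x) = f i x"
proof -
  have "(\<Sum>k\<in>UNIV. G x $ i $ k * F k x) = (\<Sum>m\<in>UNIV. (\<Sum>k\<in>UNIV. G x $ i $ k * H x $ k $ m) * f m x)"
    unfolding F_def sum_distrib_left sum_distrib_right by (subst sum.swap) (simp add: mult_ac)
  then show ?thesis by (simp add: GH if_distrib[of "\<lambda>t. t * _"] cong: if_cong)
qed

definition trG where "trG i x = (\<Sum>m\<in>UNIV. chr G m m i x)"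
definition Lap where "Lap x = (\<Sum>i\<in>UNIV. pd i (F i) x) + (\<Sum>i\<in>UNIV. trG i x * F i x)"
definition nf where "nf x = (\<Sum>i\<in>UNIV. f i x * F i x)"

text \<open>
  The classical transformation law: \<open>Lap\<close> is the Laplacian of the function \<open>\<phi>\<close> with differential \<open>f\<close>, in
  divergence form, and \<open>nf\<close> the squared norm of \<open>f\<close>.
\<close>

lemma scal_Gh:
  "scal Gh x = w x * (scal G x - 2 * (real CARD('n) - 1) * Lap x - (real CARD('n) - 1) * (real CARD('n) - 2) * nf x)"
proof -
  define dS where "dS i l j k = (if l = j then pd i (f k) x else 0) + (if l = k then pd i (f j) x else 0)
            - (pd i (\<lambda>x. G x $ j $ k) x * F l x + G x $ j $ k * pd i (F l) x)" for i l j k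
  have dif_if: "(\<lambda>x. if c then u x else 0) differentiable (at x)" if "u differentiable (at x)"
    for c and u :: "real^'n \<Rightarrow> real" using that by (cases c) simp_all
  have pd_if: "pd i (\<lambda>x. if c then u x else 0) x = (if c then pd i u x else 0)" for c i and u :: "real^'n \<Rightarrow> real"
    by simp
  have dch: "pd i (chr Gh l j k) x = pd i (chr G l j k) x + dS i l j k" for i l j k
  proof -
    have "pd i (chr Gh l j k) x = pd i (\<lambda>x. chr G l j k x + ((if l = j then f k x else 0) + (if l = k then f j x else 0) - G x $ j $ k * F l x)) x"
      by (simp add: chr_Gh[abs_def] S_def)
    also have "\<dots> = pd i (chr G l j k) x + dS i l j k"
      by (simp add: pd_add pd_diff pd_mult dfs dif_if pd_if dS_def)
    finally show ?thesis .
  qed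
  have dfF: "(\<Sum>i\<in>UNIV. pd j (\<lambda>x. G x $ i $ k) x * F i x + G x $ i $ k * pd j (F i) x) = pd j (f k) x" for j k
  proof -
    have "pd j (f k) x = pd j (\<lambda>x. \<Sum>i\<in>UNIV. G x $ i $ k * F i x) x"
    proof -
      have "f k = (\<lambda>x. \<Sum>i\<in>UNIV. G x $ i $ k * F i x)"
        by (rule ext, subst GF[symmetric]) (intro sum.cong refl, simp add: G_sym)
      then show ?thesis by simp
    qed
    also have "\<dots> = (\<Sum>i\<in>UNIV. pd j (\<lambda>x. G x $ i $ k) x * F i x + G x $ i $ k * pd j (F i) x)"
      by (subst pd_sum) (auto simp: pd_mult dfs intro!: differentiable_mult)
    finally show ?thesis by simp
  qed
  have "ric Gh j k x = ric G j k x + (\<Sum>i\<in>UNIV. dS i i j k - dS j i i k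
       + (\<Sum>m\<in>UNIV. (chr G i i m x + S i i m x) * (chr G m j k x + S m j k x) - chr G i i m x * chr G m j k x
           - ((chr G i j m x + S i j m x) * (chr G m i k x + S m i k x) - chr G i j m x * chr G m i k x)))" for j k
    unfolding ric_def dch chr_Gh
    by (simp add: sum.distrib sum_subtractf)
  then have "(\<Sum>j\<in>UNIV. \<Sum>k\<in>UNIV. H x $ j $ k * ric Gh j k x) = scal G x + (\<Sum>j\<in>UNIV. \<Sum>k\<in>UNIV. H x $ j $ k *
     (\<Sum>i\<in>UNIV. dS i i j k - dS j i i k
       + (\<Sum>m\<in>UNIV. (chr G i i m x + S i i m x) * (chr G m j k x + S m j k x) - chr G i i m x * chr G m j k x
           - ((chr G i j m x + S i j m x) * (chr G m i k x + S m i k x) - chr G i j m x * chr G m i k x))))"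
    by (simp add: scal_def H_def sum.distrib ring_distribs)
  also have "\<dots> = scal G x + (- 2 * (real CARD('n) - 1) * Lap x - (real CARD('n) - 1) * (real CARD('n) - 2) * nf x)"
    unfolding Lap_def trG_def nf_def dS_def S_def
  proof (rule arg_cong2[where f = "(+)", OF refl], rule conformal_ricci_contraction
      [of "\<lambda>i j. G x $ i $ j" "\<lambda>i j. H x $ i $ j" "\<lambda>i. F i x" "\<lambda>i. f i x"
        "\<lambda>i j k. pd i (\<lambda>x. G x $ j $ k) x" "\<lambda>i j. pd i (F j) x" "\<lambda>i j. pd i (f j) x" "\<lambda>k i j. chr G k i j x"])
    show "pd i (\<lambda>x. G x $ j $ k) x = pd i (\<lambda>x. G x $ k $ j) x" for i j k
      by (intro arg_cong2[where f = "pd i"] ext refl G_sym)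
    show "chr G k i j x = 1 / 2 * (\<Sum>l\<in>UNIV. H x $ k $ l * (pd i (\<lambda>x. G x $ j $ l) x + pd j (\<lambda>x. G x $ i $ l) x
         - pd l (\<lambda>x. G x $ i $ j) x))" for k i j
      by (simp add: chr_def H_def)
  qed (auto simp: HG GF dfF intro: G_sym H_sym)
  finally have *: "(\<Sum>j\<in>UNIV. \<Sum>k\<in>UNIV. H x $ j $ k * ric Gh j k x)
     = scal G x - 2 * (real CARD('n) - 1) * Lap x - (real CARD('n) - 1) * (real CARD('n) - 2) * nf x" by (simp add: algebra_simps)
  have "matrix_inv (Gh x) = w x *\<^sub>R H x"
    using w_pos[of x] by (simp add: Gh_def H_def matrix_inv_scaleR inv)
  then have "scal Gh x = w x * (\<Sum>j\<in>UNIV. \<Sum>k\<in>UNIV. H x $ j $ k * ric Gh j k x)"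
    by (simp add: scal_def sum_distrib_left mult_ac)
  then show ?thesis using * by simp
qed

text \<open>
  The gradient of \<open>w\<close> times the volume density.  Its coordinate divergence is the density of the
  Laplacian of \<open>w\<close>, so that integration by parts can be done with Lebesgue measure.
\<close>

definition flux where "flux i x = (\<Sum>k\<in>UNIV. (Dv x * H x $ i $ k) * pd k w x)"

lemma Dv_C1: "Ck 1 Dv" and Dv_pos: "Dv x > 0" and pd_Dv: "pd i Dv x = Dv x * trG i x"
proof -
  show "Ck 1 Dv" unfolding Dv_def [abs_def] by (rule volume_density(1)[OF C1(1) pos])
  show "Dv x > 0" unfolding Dv_def using posdef_det_pos[OF pos] by simp
  have "(\<Sum>m\<in>UNIV. \<Sum>l\<in>UNIV. H x $ m $ l * pd l (\<lambda>y. G y $ m $ i) x)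
     = (\<Sum>m\<in>UNIV. \<Sum>l\<in>UNIV. H x $ m $ l * pd m (\<lambda>y. G y $ i $ l) x)"
    by (subst sum.swap) (intro sum.cong refl arg_cong2[where f = "(*)"] H_sym arg_cong2[where f = "pd _"] ext G_sym)
  moreover have "2 * trG i x = (\<Sum>m\<in>UNIV. \<Sum>l\<in>UNIV. H x $ m $ l * pd m (\<lambda>y. G y $ i $ l) x)
      + (\<Sum>m\<in>UNIV. \<Sum>l\<in>UNIV. H x $ m $ l * pd i (\<lambda>y. G y $ m $ l) x)
      - (\<Sum>m\<in>UNIV. \<Sum>l\<in>UNIV. H x $ m $ l * pd l (\<lambda>y. G y $ m $ i) x)"
    unfolding trG_def chr_def H_def[symmetric]
    by (simp add: sum_distrib_left sum.distrib sum_subtractf ring_distribs)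
  ultimately have "trG i x = 1/2 * (\<Sum>m\<in>UNIV. \<Sum>l\<in>UNIV. H x $ m $ l * pd i (\<lambda>y. G y $ m $ l) x)"
    by simp
  moreover have "pd i Dv x = 1/2 * Dv x * (\<Sum>m\<in>UNIV. \<Sum>l\<in>UNIV. H x $ m $ l * pd i (\<lambda>y. G y $ m $ l) x)"
    unfolding Dv_def [abs_def] H_def by (rule volume_density(2)[OF C1(1) pos])
  ultimately show "pd i Dv x = Dv x * trG i x" by (simp only: mult_ac)
qed

lemma flux_eq: "flux i x = - 2 * (Dv x * (w x * F i x))"
  unfolding flux_def F_def pd_w sum_distrib_left by (intro sum.cong refl) (simp add: mult_ac)

lemma flux_C1: "Ck 1 (flux i)"
  unfolding flux_def [abs_def] by (intro Ck_sum Ck_mult Dv_C1 C1)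

lemma div_flux: "(\<Sum>i\<in>UNIV. pd i (flux i) x) = Dv x * (- 2 * w x * Lap x + 4 * w x * nf x)"
proof -
  have "pd i (flux i) x = - 2 * (pd i Dv x * (w x * F i x) + Dv x * (pd i w x * F i x + w x * pd i (F i) x))" for i
    unfolding flux_eq [abs_def]
    by (subst pd_cmult) (auto intro!: differentiable_mult dfs diff1[OF Dv_C1]
        simp: pd_mult dfs diff1[OF Dv_C1] differentiable_mult)
  then have "(\<Sum>i\<in>UNIV. pd i (flux i) x) =
     (\<Sum>i\<in>UNIV. Dv x * (- 2 * w x * pd i (F i) x - 2 * w x * (trG i x * F i x) + 4 * w x * (f i x * F i x)))"
    unfolding pd_Dv pd_w by (intro sum.cong refl) (simp add: algebra_simps)
  also have "\<dots> = Dv x * (- 2 * w x * Lap x + 4 * w x * nf x)"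
    unfolding Lap_def nf_def by (simp add: sum_distrib_left sum.distrib sum_subtractf sum_negf algebra_simps)
  finally show ?thesis .
qed

lemma nf_eq: "4 * (w x)^2 * nf x = (\<Sum>i\<in>UNIV. \<Sum>k\<in>UNIV. H x $ i $ k * pd i w x * pd k w x)"
  unfolding nf_def F_def pd_w sum_distrib_left sum_distrib_right
  by (intro sum.cong refl) (simp add: power2_eq_square mult_ac)

text \<open>
  The Laplacian of \<open>w = exp (-2\<phi>)\<close> is \<open>w (4 |d\<phi>|\<^sup>2 - 2 \<Delta>\<phi>)\<close>, and the transformation law bounds
  \<open>- 2 \<Delta>\<phi>\<close> from below by \<open>(n - 2) |d\<phi>|\<^sup>2\<close> up to the error.  The two gradient terms have the same sign, so
  \<open>w\<close> is almost subharmonic and the defect controls its gradient.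
\<close>

lemma almost_subharmonic:
  assumes n: "CARD('n) \<ge> 2" and G0: "scal G x \<le> 0" and Gh: "scal Gh x \<ge> - \<delta>"
  shows "(\<Sum>i\<in>UNIV. pd i (flux i) x) \<ge>
    Dv x * ((real CARD('n) + 2) / (4 * w x) * (\<Sum>i\<in>UNIV. \<Sum>k\<in>UNIV. H x $ i $ k * pd i w x * pd k w x) - \<delta> / (real CARD('n) - 1))"
proof -
  define N where "N = real CARD('n)"
  have N: "N - 1 > 0" using n by (simp add: N_def)
  have "- \<delta> \<le> w x * (scal G x - 2 * (N - 1) * Lap x - (N - 1) * (N - 2) * nf x)"
    using Gh scal_Gh[of x] by (simp add: N_def)
  also have "\<dots> \<le> w x * (0 - 2 * (N - 1) * Lap x - (N - 1) * (N - 2) * nf x)"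
    by (intro mult_left_mono diff_right_mono G0 less_imp_le[OF w_pos])
  also have "\<dots> = (N - 1) * (- 2 * w x * Lap x - (N - 2) * (w x * nf x))" by (simp add: algebra_simps)
  finally have "- \<delta> / (N - 1) \<le> - 2 * w x * Lap x - (N - 2) * (w x * nf x)"
    using N by (simp add: field_simps)
  moreover have "(N + 2) / (4 * w x) * (\<Sum>i\<in>UNIV. \<Sum>k\<in>UNIV. H x $ i $ k * pd i w x * pd k w x) = (N + 2) * (w x * nf x)"
    using nf_eq[of x, symmetric] w_pos[of x] by (simp add: field_simps power2_eq_square)
  moreover have "(N + 2) * (w x * nf x) = 4 * w x * nf x + (N - 2) * (w x * nf x)" by (simp add: algebra_simps)
  ultimately have "(N + 2) / (4 * w x) * (\<Sum>i\<in>UNIV. \<Sum>k\<in>UNIV. H x $ i $ k * pd i w x * pd k w x) - \<delta> / (N - 1)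
      \<le> - 2 * w x * Lap x + 4 * w x * nf x"
    by linarith
  then show ?thesis unfolding div_flux N_def by (rule mult_left_mono) (use Dv_pos[of x] in simp)
qed

end

section \<open>Integration over a period\<close>

definition periodic :: "(real^'n::finite \<Rightarrow> 'a) \<Rightarrow> bool" where
  "periodic F \<longleftrightarrow> (\<forall>x y. torus_proj x = torus_proj y \<longrightarrow> F x = F y)"

text \<open>A density, in contrast to a restriction, keeps all Borel sets of the whole space measurable.\<close>

abbreviation cubeM :: "(real^'n::finite) measure" where
  "cubeM \<equiv> density lborel (indicator fundamental_cube)"

lemma periodicD: "periodic F \<Longrightarrow> torus_proj x = torus_proj y \<Longrightarrow> F x = F y"
  unfolding periodic_def by blast

lemma periodic_shift: "periodic F \<Longrightarrow> periodic (\<lambda>x. F (x + z))"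
  unfolding periodic_def using torus_proj_shift by blast

lemma periodic_comp: "periodic F \<Longrightarrow> periodic (\<lambda>x. \<phi> (F x))"
  unfolding periodic_def by metis

lemma periodic_pd: "periodic F \<Longrightarrow> periodic (pd i F)"
  unfolding periodic_def pd_def
  by (intro allI impI arg_cong2[where f = deriv] ext refl) (blast intro: torus_proj_shift)

lemma exists_cube_representative:
  fixes x :: "real^'n::finite"
  obtains y where "y \<in> fundamental_cube" "torus_proj y = torus_proj x"
proof
  show "(\<chi> i. frac (x $ i)) \<in> fundamental_cube"
    by (simp add: fundamental_cube_def frac_lt_1)
  show "torus_proj (\<chi> i. frac (x $ i)) = torus_proj x"
    by (simp add: torus_proj_eq_iff frac_def)
qed

lemma periodic_forall_cube:
  assumes "periodic F" "\<And>x. x \<in> fundamental_cube \<Longrightarrow> P (F x)" shows "P (F x)"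
  by (metis assms exists_cube_representative periodicD)

lemma One_nth: "(One :: real^'n::finite) $ i = 1"
proof -
  have "(One :: real^'n) \<bullet> axis i 1 = 1" by (rule inner_sum_Basis) simp
  then show ?thesis by (simp add: inner_axis)
qed

lemma cube_subset_cbox: "fundamental_cube \<subseteq> cbox 0 (One :: real^'n::finite)"
  by (auto simp: fundamental_cube_def mem_box_cart One_nth less_imp_le simp del: sum_component)

lemma box_subset_cube: "box 0 (One :: real^'n::finite) \<subseteq> fundamental_cube"
  by (auto simp: fundamental_cube_def mem_box_cart One_nth less_imp_le simp del: sum_component)

lemma fundamental_cube_borel [measurable]: "(fundamental_cube :: (real^'n::finite) set) \<in> sets borel"
proof -
  have eq: "(fundamental_cube :: (real^'n) set) = (\<Inter>i\<in>UNIV. {x. 0 \<le> x $ i} \<inter> {x. x $ i < 1})"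
    by (auto simp: fundamental_cube_def)
  have "{x::real^'n. 0 \<le> x $ i} \<inter> {x. x $ i < 1} \<in> sets borel" for i
    by (intro sets.Int borel_closed borel_open closed_Collect_le open_Collect_less continuous_intros)
  then show ?thesis unfolding eq by (intro sets.finite_INT) auto
qed

lemma emeasure_cube: "emeasure lborel (fundamental_cube :: (real^'n::finite) set) = 1"
proof (rule antisym)
  have "emeasure lborel (fundamental_cube :: (real^'n) set) \<le> emeasure lborel (cbox 0 (One :: real^'n))"
    by (intro emeasure_mono cube_subset_cbox) simp
  then show "emeasure lborel (fundamental_cube :: (real^'n) set) \<le> 1"
    by (simp add: emeasure_lborel_cbox_eq)
  have "emeasure lborel (box 0 (One :: real^'n)) \<le> emeasure lborel (fundamental_cube :: (real^'n) set)"
    by (intro emeasure_mono box_subset_cube) simp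
  then show "1 \<le> emeasure lborel (fundamental_cube :: (real^'n) set)"
    by (simp add: emeasure_lborel_box_eq)
qed

lemma emeasure_cubeM: "emeasure cubeM UNIV = 1"
  by (simp add: emeasure_density emeasure_cube)

interpretation cubeM: finite_measure cubeM
  by standard (simp add: emeasure_cubeM)

lemma nn_integral_cubeM:
  "F \<in> borel_measurable borel \<Longrightarrow> (\<integral>\<^sup>+x. F x \<partial>cubeM) = (\<integral>\<^sup>+x. F x * indicator fundamental_cube x \<partial>lborel)"
  by (simp add: nn_integral_density mult.commute)

lemma AE_cubeM: "(\<And>x. x \<in> fundamental_cube \<Longrightarrow> P x) \<Longrightarrow> AE x in cubeM. P x"
  by (auto simp: AE_density indicator_def)

lemma nn_integral_lborel_translate:
  fixes F :: "'a::euclidean_space \<Rightarrow> ennreal"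
  assumes [measurable]: "F \<in> borel_measurable borel"
  shows "(\<integral>\<^sup>+x. F (x + z) \<partial>lborel) = (\<integral>\<^sup>+x. F x \<partial>lborel)"
proof -
  have "(\<integral>\<^sup>+x. F x \<partial>lborel) = (\<integral>\<^sup>+x. F x \<partial>distr lborel borel ((+) z))"
    by (simp add: lborel_distr_plus)
  also have "\<dots> = (\<integral>\<^sup>+x. F (z + x) \<partial>lborel)" by (subst nn_integral_distr) auto
  finally show ?thesis by (simp add: add.commute)
qed

text \<open>A translation by \<open>t\<close> in one coordinate moves the slab \<open>x\<^sub>i \<ge> 1 - t\<close> out of the cube, and a lattice
  translation brings it back.\<close>

lemma nn_integral_cube_translate_axis:
  fixes F :: "real^'n::finite \<Rightarrow> ennreal"
  assumes per: "periodic F" and [measurable]: "F \<in> borel_measurable borel" and t: "0 \<le> t" "t < 1"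
  shows "(\<integral>\<^sup>+x. F (x + t *\<^sub>R axis i 1) \<partial>cubeM) = (\<integral>\<^sup>+x. F x \<partial>cubeM)"
proof -
  define e where "e = (axis i 1 :: real^'n)"
  define A where "A x = (indicator fundamental_cube (x - t *\<^sub>R e) * indicator {x. x $ i < 1} x :: ennreal)" for x
  define B where "B x = (indicator fundamental_cube (x - t *\<^sub>R e) * indicator {x. x $ i \<ge> 1} x :: ennreal)" for x
  have [measurable]: "{x::real^'n. x $ i < 1} \<in> sets borel" "{x::real^'n. x $ i \<ge> 1} \<in> sets borel"
    by (intro borel_closed borel_open closed_Collect_le open_Collect_less continuous_intros)+
  have [measurable]: "A \<in> borel_measurable borel" "B \<in> borel_measurable borel"
    unfolding A_def [abs_def] B_def [abs_def] by measurable
  have ei: "e $ j = (if j = i then 1 else 0)" for j by (simp add: e_def axis_def)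
  have Fe: "F (x + e) = F x" for x
    by (rule periodicD[OF per]) (simp add: torus_proj_eq_iff ei)
  have AB: "A x + B (x + e) = indicator fundamental_cube x" for x
  proof -
    have "x - t *\<^sub>R e \<in> fundamental_cube \<longleftrightarrow> (\<forall>j\<in>-{i}. 0 \<le> x $ j \<and> x $ j < 1) \<and> t \<le> x $ i \<and> x $ i < 1 + t"
      "x + e - t *\<^sub>R e \<in> fundamental_cube \<longleftrightarrow> (\<forall>j\<in>-{i}. 0 \<le> x $ j \<and> x $ j < 1) \<and> t - 1 \<le> x $ i \<and> x $ i < t"
      "x \<in> fundamental_cube \<longleftrightarrow> (\<forall>j\<in>-{i}. 0 \<le> x $ j \<and> x $ j < 1) \<and> 0 \<le> x $ i \<and> x $ i < 1"
      by (force simp: fundamental_cube_def ei)+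
    then show ?thesis using t unfolding A_def B_def by (auto simp: indicator_def ei)
  qed
  have "(\<integral>\<^sup>+x. F (x + t *\<^sub>R e) \<partial>cubeM) =
      (\<integral>\<^sup>+x. (\<lambda>x. F x * indicator fundamental_cube (x - t *\<^sub>R e)) (x + t *\<^sub>R e) \<partial>lborel)"
    by (simp add: nn_integral_cubeM)
  also have "\<dots> = (\<integral>\<^sup>+x. F x * indicator fundamental_cube (x - t *\<^sub>R e) \<partial>lborel)"
    by (rule nn_integral_lborel_translate) measurable
  also have "\<dots> = (\<integral>\<^sup>+x. F x * A x + F x * B x \<partial>lborel)"
    by (intro nn_integral_cong) (auto simp: A_def B_def indicator_def)
  also have "\<dots> = (\<integral>\<^sup>+x. F x * A x \<partial>lborel) + (\<integral>\<^sup>+x. F x * B x \<partial>lborel)"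
    by (intro nn_integral_add) measurable
  also have "(\<integral>\<^sup>+x. F x * B x \<partial>lborel) = (\<integral>\<^sup>+x. F (x + e) * B (x + e) \<partial>lborel)"
    by (rule nn_integral_lborel_translate[symmetric]) measurable
  also have "(\<integral>\<^sup>+x. F x * A x \<partial>lborel) + \<dots> = (\<integral>\<^sup>+x. F x * A x + F x * B (x + e) \<partial>lborel)"
    unfolding Fe by (intro nn_integral_add[symmetric]) measurable
  also have "\<dots> = (\<integral>\<^sup>+x. F x \<partial>cubeM)"
    unfolding distrib_left[symmetric] AB by (simp add: nn_integral_cubeM)
  finally show ?thesis unfolding e_def .
qed

lemma nn_integral_cube_translate:
  fixes F :: "real^'n::finite \<Rightarrow> ennreal"
  assumes per: "periodic F" and meas: "F \<in> borel_measurable borel"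
  shows "(\<integral>\<^sup>+x. F (x + z) \<partial>cubeM) = (\<integral>\<^sup>+x. F x \<partial>cubeM)"
proof -
  have axis: "(\<integral>\<^sup>+x. F (x + t *\<^sub>R axis i 1) \<partial>cubeM) = (\<integral>\<^sup>+x. F x \<partial>cubeM)"
    if "periodic F" "F \<in> borel_measurable borel" for F :: "real^'n \<Rightarrow> ennreal" and t i
  proof -
    have "F (x + t *\<^sub>R axis i 1) = F (x + frac t *\<^sub>R axis i 1)" for x
      by (rule periodicD[OF that(1)]) (auto simp: torus_proj_eq_iff axis_def frac_def)
    then show ?thesis
      using nn_integral_cube_translate_axis[OF that, of "frac t" i] by (simp add: frac_lt_1)
  qed
  have "(\<integral>\<^sup>+x. F (x + (\<Sum>i\<in>I. z $ i *\<^sub>R axis i 1)) \<partial>cubeM) = (\<integral>\<^sup>+x. F x \<partial>cubeM)"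
    if "finite I" for I :: "'n set"
    using that
  proof (induction I)
    case (insert i I)
    let ?F = "\<lambda>x. F (x + (\<Sum>i\<in>I. z $ i *\<^sub>R axis i 1))"
    have "?F \<in> borel_measurable borel" using meas by measurable
    from axis[OF periodic_shift[OF per] this, of "z $ i" i] insert show ?case
      by (simp add: add_ac)
  qed simp
  from this[of UNIV] show ?thesis by (simp add: basis_expansion flip: scalar_mult_eq_scaleR)
qed

lemma periodic_bounded:
  fixes F :: "real^'n::finite \<Rightarrow> real"
  assumes "periodic F" "continuous_on UNIV F"
  obtains M where "M > 0" "\<And>x. \<bar>F x\<bar> \<le> M"
proof -
  have "compact (F ` cbox 0 (One :: real^'n))"
    using assms(2) continuous_on_subset by (intro compact_continuous_image) auto
  then obtain M where M: "M > 0" "\<forall>y\<in>F ` cbox 0 One. norm y \<le> M"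
    using compact_imp_bounded bounded_pos by blast
  have "\<bar>F x\<bar> \<le> M" for x
    by (rule periodic_forall_cube[OF assms(1), of "\<lambda>y. \<bar>y\<bar> \<le> M"]) (use M cube_subset_cbox in auto)
  with M that show ?thesis by blast
qed

lemma integrable_cube:
  fixes F :: "real^'n::finite \<Rightarrow> real"
  assumes "periodic F" "continuous_on UNIV F"
  shows "integrable cubeM F"
proof -
  obtain M where "\<And>x. \<bar>F x\<bar> \<le> M" using periodic_bounded[OF assms] by blast
  moreover have "F \<in> borel_measurable borel" by (rule borel_measurable_continuous_onI[OF assms(2)])
  ultimately show ?thesis
    by (intro cubeM.integrable_const_bound[where B = M]) auto
qed

lemma continuous_shift: "continuous_on UNIV F \<Longrightarrow> continuous_on UNIV (\<lambda>x. F (x + z))"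
  for F :: "real^'n::finite \<Rightarrow> real"
  by (rule continuous_on_compose2[of UNIV F]) (auto intro!: continuous_intros)

lemma integral_cube_translate:
  fixes F :: "real^'n::finite \<Rightarrow> real"
  assumes "periodic F" "continuous_on UNIV F"
  shows "(\<integral>x. F (x + z) \<partial>cubeM) = (\<integral>x. F x \<partial>cubeM)"
proof -
  have [measurable]: "F \<in> borel_measurable borel" by (rule borel_measurable_continuous_onI[OF assms(2)])
  have m: "(\<lambda>x. ennreal (F x)) \<in> borel_measurable borel" "(\<lambda>x. ennreal (- F x)) \<in> borel_measurable borel"
    by measurable
  have p: "periodic (\<lambda>x. ennreal (F x))" "periodic (\<lambda>x. ennreal (- F x))"
    by (rule periodic_comp[OF assms(1)])+
  show ?thesis
    unfolding real_lebesgue_integral_def[OF integrable_cube[OF assms]]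
      real_lebesgue_integral_def[OF integrable_cube[OF periodic_shift[OF assms(1)] continuous_shift[OF assms(2)]]]
      nn_integral_cube_translate[OF p(1) m(1), of z] nn_integral_cube_translate[OF p(2) m(2), of z] ..
qed

section \<open>Integrals of derivatives\<close>

abbreviation unitM :: "real measure" where
  "unitM \<equiv> density lborel (indicator {0..1})"

lemma emeasure_unitM: "emeasure unitM UNIV = 1"
  by (simp add: emeasure_density)

interpretation unitM: finite_measure unitM
  by standard (simp add: emeasure_unitM)

lemma integral_unitM:
  fixes \<phi> :: "real \<Rightarrow> real"
  assumes "continuous_on UNIV \<phi>"
  shows "integrable unitM \<phi>" "(\<integral>t. \<phi> t \<partial>unitM) = (\<integral>t. indicator {0..1} t *\<^sub>R \<phi> t \<partial>lborel)"
proof -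
  have m: "\<phi> \<in> borel_measurable lborel" using borel_measurable_continuous_onI[OF assms] by simp
  have d: "unitM = density lborel (\<lambda>t. ennreal (indicator {0..1} t))" by (simp add: ennreal_indicator)
  have "integrable lborel (\<lambda>t. indicator {0..1} t *\<^sub>R \<phi> t)"
    using borel_integrable_atLeastAtMost'[of 0 1 \<phi>] continuous_on_subset[OF assms]
    by (simp add: set_integrable_def)
  then show "integrable unitM \<phi>" unfolding d using m by (subst integrable_density) auto
  show "(\<integral>t. \<phi> t \<partial>unitM) = (\<integral>t. indicator {0..1} t *\<^sub>R \<phi> t \<partial>lborel)"
    unfolding d using m by (subst integral_density) auto
qed

lemma integral_unitM_FTC:
  fixes \<phi> :: "real \<Rightarrow> real"
  assumes "\<And>t. (\<phi> has_field_derivative \<phi>' t) (at t)" "continuous_on UNIV \<phi>'"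
  shows "integrable unitM \<phi>'" "(\<integral>t. \<phi>' t \<partial>unitM) = \<phi> 1 - \<phi> 0"
proof -
  have c: "continuous_on {0..1} \<phi>'" using assms(2) continuous_on_subset by blast
  show "integrable unitM \<phi>'" by (rule integral_unitM(1)[OF assms(2)])
  have "(\<integral>t. \<phi>' t \<partial>unitM) = (\<integral>t. indicator {0..1} t *\<^sub>R \<phi>' t \<partial>lborel)"
    by (rule integral_unitM(2)[OF assms(2)])
  also have "\<dots> = \<phi> 1 - \<phi> 0"
    by (rule integral_FTC_Icc[OF _ _ c])
       (use assms(1) in \<open>auto simp: has_real_derivative_iff_has_vector_derivative intro: has_vector_derivative_at_within\<close>)
  finally show "(\<integral>t. \<phi>' t \<partial>unitM) = \<phi> 1 - \<phi> 0" .
qed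

lemma continuous_on_line:
  fixes F :: "real^'n::finite \<Rightarrow> 'a::topological_space"
  assumes "continuous_on UNIV F" shows "continuous_on UNIV (\<lambda>t. F (x + t *\<^sub>R v))"
  by (rule continuous_on_compose2[OF assms]) (auto intro!: continuous_intros)

lemma line_FTC:
  fixes F :: "real^'n::finite \<Rightarrow> real"
  assumes "Ck 1 F"
  shows "integrable unitM (\<lambda>t. \<Sum>i\<in>UNIV. v $ i * pd i F (x + t *\<^sub>R v))"
    and "(\<integral>t. (\<Sum>i\<in>UNIV. v $ i * pd i F (x + t *\<^sub>R v)) \<partial>unitM) = F (x + v) - F x"
proof -
  have 1: "((\<lambda>t. F (x + t *\<^sub>R v)) has_field_derivative (\<Sum>i\<in>UNIV. v $ i * pd i F (x + t *\<^sub>R v))) (at t)" for t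
    by (rule DERIV_line) (use assms in simp)
  have 2: "continuous_on UNIV (\<lambda>t. \<Sum>i\<in>UNIV. v $ i * pd i F (x + t *\<^sub>R v))"
    using assms by (intro continuous_intros continuous_on_line) auto
  show "integrable unitM (\<lambda>t. \<Sum>i\<in>UNIV. v $ i * pd i F (x + t *\<^sub>R v))"
    "(\<integral>t. (\<Sum>i\<in>UNIV. v $ i * pd i F (x + t *\<^sub>R v)) \<partial>unitM) = F (x + v) - F x"
    using integral_unitM_FTC[OF 1 2] by simp_all
qed

text \<open>
  For a translation invariant measure the integral of a partial derivative vanishes, because its
  average along unit segments is a difference of two translates.
\<close>

lemma integral_pd_eq_0_if_invariant:
  fixes F :: "real^'n::finite \<Rightarrow> real" and \<mu> :: "(real^'n) measure"
  assumes sf: "sigma_finite_measure \<mu>" and [measurable_cong]: "sets \<mu> = sets borel" and F: "Ck 1 F"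
    and int: "\<And>z. integrable \<mu> (\<lambda>x. F (x + z))" "\<And>z. integrable \<mu> (\<lambda>x. pd i F (x + z))"
    and inv: "\<And>z. (\<integral>x. F (x + z) \<partial>\<mu>) = (\<integral>x. F x \<partial>\<mu>)" "\<And>z. (\<integral>x. pd i F (x + z) \<partial>\<mu>) = (\<integral>x. pd i F x \<partial>\<mu>)"
      "\<And>z. (\<integral>x. \<bar>pd i F (x + z)\<bar> \<partial>\<mu>) = (\<integral>x. \<bar>pd i F x\<bar> \<partial>\<mu>)"
  shows "(\<integral>x. pd i F x \<partial>\<mu>) = 0"
proof -
  define e where "e = (axis i 1 :: real^'n)"
  interpret sigma_finite_measure \<mu> by (rule sf)
  interpret P: pair_sigma_finite unitM \<mu> ..
  have [measurable]: "pd i F \<in> borel_measurable borel"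
    using F by (intro borel_measurable_continuous_onI) simp
  have "integrable (unitM \<Otimes>\<^sub>M \<mu>) (\<lambda>(t, x). pd i F (x + t *\<^sub>R e))"
  proof (rule P.Fubini_integrable)
    show "(\<lambda>(t, x). pd i F (x + t *\<^sub>R e)) \<in> borel_measurable (unitM \<Otimes>\<^sub>M \<mu>)"
      by measurable
    show "integrable unitM (\<lambda>t. \<integral>x. norm (case (t, x) of (t, x) \<Rightarrow> pd i F (x + t *\<^sub>R e)) \<partial>\<mu>)"
      using inv(3) by simp
    show "AE t in unitM. integrable \<mu> (\<lambda>x. case (t, x) of (t, x) \<Rightarrow> pd i F (x + t *\<^sub>R e))"
      using int by simp
  qed
  from P.Fubini_integral[OF this]
  have "(\<integral>x. (\<integral>t. pd i F (x + t *\<^sub>R e) \<partial>unitM) \<partial>\<mu>) = (\<integral>t. (\<integral>x. pd i F (x + t *\<^sub>R e) \<partial>\<mu>) \<partial>unitM)"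
    by simp
  also have "\<dots> = (\<integral>x. pd i F x \<partial>\<mu>)"
    unfolding inv(2) using emeasure_unitM by (simp add: measure_def)
  also have "(\<integral>t. pd i F (x + t *\<^sub>R e) \<partial>unitM) = F (x + e) - F x" for x
    using line_FTC(2)[OF F, of e x] by (simp add: e_def axis_def if_distrib[of "\<lambda>t. t * _"] cong: if_cong)
  then have "(\<integral>x. (\<integral>t. pd i F (x + t *\<^sub>R e) \<partial>unitM) \<partial>\<mu>) = 0"
    using int(1)[of e] int(1)[of 0] inv(1)[of e] by simp
  finally show ?thesis by simp
qed

lemma integral_cube_pd_eq_0:
  fixes F :: "real^'n::finite \<Rightarrow> real"
  assumes "periodic F" "Ck 1 F"
  shows "(\<integral>x. pd i F x \<partial>cubeM) = 0"
proof (rule integral_pd_eq_0_if_invariant[OF _ _ assms(2)])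
  have c: "continuous_on UNIV F" "continuous_on UNIV (pd i F)"
    using assms(2) Ck_imp_continuous[OF assms(2)] by simp_all
  note p = assms(1) periodic_pd[OF assms(1)]
  show "integrable cubeM (\<lambda>x. F (x + z))" "integrable cubeM (\<lambda>x. pd i F (x + z))" for z
    by (intro integrable_cube periodic_shift continuous_shift p c)+
  show "(\<integral>x. F (x + z) \<partial>cubeM) = (\<integral>x. F x \<partial>cubeM)" "(\<integral>x. pd i F (x + z) \<partial>cubeM) = (\<integral>x. pd i F x \<partial>cubeM)" for z
    by (intro integral_cube_translate p c)+
  show "(\<integral>x. \<bar>pd i F (x + z)\<bar> \<partial>cubeM) = (\<integral>x. \<bar>pd i F x\<bar> \<partial>cubeM)" for z
  proof (rule integral_cube_translate)
    show "periodic (\<lambda>x. \<bar>pd i F x\<bar>)" by (rule periodic_comp[OF p(2)])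
    show "continuous_on UNIV (\<lambda>x. \<bar>pd i F x\<bar>)" by (intro continuous_intros c)
  qed
  show "sigma_finite_measure (cubeM :: (real^'n) measure)" by (rule cubeM.sigma_finite_measure_axioms)
qed simp

lemma integrable_lborel_compact_support:
  fixes F :: "real^'n::finite \<Rightarrow> real"
  assumes "continuous_on UNIV F" "\<And>x. x \<notin> cbox a b \<Longrightarrow> F x = 0"
  shows "integrable lborel F"
proof -
  have "set_integrable lborel (cbox a b) F"
    using assms(1) unfolding set_integrable_def
    by (intro borel_integrable_compact) (auto intro: continuous_on_subset)
  moreover have "(\<lambda>x. indicator (cbox a b) x *\<^sub>R F x) = F"
    by (rule ext) (use assms(2) in \<open>auto simp: indicator_def\<close>)
  ultimately show ?thesis by (simp add: set_integrable_def)
qed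

lemma lborel_translate:
  fixes F :: "'a::euclidean_space \<Rightarrow> real"
  shows integrable_lborel_translate: "integrable lborel F \<Longrightarrow> integrable lborel (\<lambda>x. F (x + z))"
    and integral_lborel_translate: "F \<in> borel_measurable borel \<Longrightarrow> (\<integral>x. F (x + z) \<partial>lborel) = (\<integral>x. F x \<partial>lborel)"
proof -
  assume that: "integrable lborel F"
  then have "integrable (distr lborel borel ((+) z)) F" by (simp add: lborel_distr_plus)
  then show "integrable lborel (\<lambda>x. F (x + z))"
    using borel_measurable_integrable[OF that] by (subst (asm) integrable_distr_eq) (auto simp: add.commute)
next
  assume that: "F \<in> borel_measurable borel"
  have "(\<integral>x. F x \<partial>lborel) = (\<integral>x. F x \<partial>distr lborel borel ((+) z))" by (simp add: lborel_distr_plus)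
  also have "\<dots> = (\<integral>x. F (z + x) \<partial>lborel)" using that by (subst integral_distr) auto
  finally show "(\<integral>x. F (x + z) \<partial>lborel) = (\<integral>x. F x \<partial>lborel)" by (simp add: add.commute)
qed

lemma integral_lborel_pd_eq_0:
  fixes F :: "real^'n::finite \<Rightarrow> real"
  assumes F: "Ck 1 F" and supp: "\<And>x. x \<notin> cbox a b \<Longrightarrow> F x = 0"
  shows "integrable lborel (pd i F)" "(\<integral>x. pd i F x \<partial>lborel) = 0"
proof -
  have c: "continuous_on UNIV F" "continuous_on UNIV (pd i F)"
    using F Ck_imp_continuous[OF F] by simp_all
  have "pd i F x = 0" if "x \<notin> cbox a b" for x
  proof -
    have "(F has_derivative (\<lambda>v. 0)) (at x)"
      by (rule has_derivative_transform_within_open[of "\<lambda>y. 0" _ x UNIV "- cbox a b"])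
         (use supp that in \<open>auto simp: closed_cbox open_Compl\<close>)
    then show ?thesis using pd_eqI[of F "\<lambda>v. 0" x i] by simp
  qed
  with c(2) show i: "integrable lborel (pd i F)" by (rule integrable_lborel_compact_support)
  have i0: "integrable lborel F" by (rule integrable_lborel_compact_support[OF c(1) supp])
  have m: "F \<in> borel_measurable borel" "pd i F \<in> borel_measurable borel" "(\<lambda>x. \<bar>pd i F x\<bar>) \<in> borel_measurable borel"
    using c by (auto intro!: borel_measurable_continuous_onI continuous_intros)
  show "(\<integral>x. pd i F x \<partial>lborel) = 0"
    by (rule integral_pd_eq_0_if_invariant[OF _ _ F])
       (auto intro!: integrable_lborel_translate i i0 m integral_lborel_translate
          integral_lborel_translate[of "\<lambda>x. \<bar>pd i F x\<bar>"] sigma_finite_lborel)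
qed

section \<open>A Poincare inequality\<close>

lemma segment_inequality:
  fixes u :: "real^'n::finite \<Rightarrow> real"
  assumes u: "Ck 1 u" and z: "z \<in> fundamental_cube"
  shows "ennreal ((u x - u (x + z))\<^sup>2) \<le> (\<integral>\<^sup>+t. ennreal (real CARD('n) * (\<Sum>i\<in>UNIV. (pd i u (x + t *\<^sub>R z))\<^sup>2)) \<partial>unitM)"
proof -
  define c where "c = u (x + z) - u x"
  define e where "e y = real CARD('n) * (\<Sum>i\<in>UNIV. (pd i u y)\<^sup>2)" for y
  define \<phi> where "\<phi> t = (\<Sum>i\<in>UNIV. z $ i * pd i u (x + t *\<^sub>R z))" for t
  have le: "(\<phi> t)\<^sup>2 \<le> e (x + t *\<^sub>R z)" for t
  proof -
    have "(\<phi> t)\<^sup>2 \<le> (\<Sum>i\<in>UNIV. (z $ i)\<^sup>2) * (\<Sum>i\<in>UNIV. (pd i u (x + t *\<^sub>R z))\<^sup>2)"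
      unfolding \<phi>_def by (rule Cauchy_Schwarz_ineq_sum)
    also have "(\<Sum>i\<in>UNIV. (z $ i)\<^sup>2) \<le> (\<Sum>i\<in>(UNIV::'n set). 1)"
      using z by (intro sum_mono power_le_one) (auto simp: fundamental_cube_def less_imp_le)
    finally show ?thesis by (simp add: e_def mult_right_mono sum_nonneg)
  qed
  have cpd: "continuous_on UNIV (pd i u)" for i using u by simp
  have ie: "integrable unitM (\<lambda>t. e (x + t *\<^sub>R z))"
    unfolding e_def by (intro integral_unitM continuous_intros continuous_on_line[OF cpd])
  \<comment> \<open>Integrating \<open>(\<phi> - c)\<^sup>2 \<ge> 0\<close> spares the Cauchy-Schwarz inequality for integrals.\<close>
  have "2 * c * \<phi> t - c\<^sup>2 \<le> e (x + t *\<^sub>R z)" for t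
    using le[of t] zero_le_power2[of "\<phi> t - c"] by (simp add: power2_diff algebra_simps)
  then have "(\<integral>t. 2 * c * \<phi> t - c\<^sup>2 \<partial>unitM) \<le> (\<integral>t. e (x + t *\<^sub>R z) \<partial>unitM)"
    using line_FTC(1)[OF u, of z x] ie by (intro integral_mono) (auto simp: \<phi>_def)
  moreover have "(\<integral>t. 2 * c * \<phi> t - c\<^sup>2 \<partial>unitM) = c\<^sup>2"
    using line_FTC[OF u, of z x] emeasure_unitM
    by (simp add: \<phi>_def c_def[symmetric] measure_def power2_eq_square)
  ultimately have "ennreal (c\<^sup>2) \<le> ennreal (\<integral>t. e (x + t *\<^sub>R z) \<partial>unitM)" by (simp add: ennreal_leI)
  also have "\<dots> = (\<integral>\<^sup>+t. ennreal (e (x + t *\<^sub>R z)) \<partial>unitM)"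
    by (rule nn_integral_eq_integral[symmetric, OF ie]) (simp add: e_def sum_nonneg)
  finally show ?thesis by (simp add: c_def e_def power2_commute)
qed

text \<open>
  With \<open>y = x + z\<close> the difference \<open>u x - u y\<close> is an integral of the gradient along a segment of direction
  \<open>z\<close>.  By Fubini the points of the segments may be integrated over \<open>x\<close> first, and then translation
  invariance gives the same value for every \<open>z\<close> and every parameter of the segment.
\<close>

lemma Poincare_torus:
  fixes u :: "real^'n::finite \<Rightarrow> real"
  assumes per: "periodic u" and u: "Ck 1 u"
  shows "(\<integral>\<^sup>+x. \<integral>\<^sup>+y. ennreal ((u x - u y)\<^sup>2) \<partial>cubeM \<partial>cubeM)
     \<le> (\<integral>\<^sup>+x. ennreal (real CARD('n) * (\<Sum>i\<in>UNIV. (pd i u x)\<^sup>2)) \<partial>cubeM)"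
proof -
  define e where "e x = ennreal (real CARD('n) * (\<Sum>i\<in>UNIV. (pd i u x)\<^sup>2))" for x
  interpret P: pair_sigma_finite "cubeM :: (real^'n) measure" "cubeM :: (real^'n) measure" ..
  interpret Q: pair_sigma_finite "unitM" "cubeM :: (real^'n) measure" ..
  have [measurable]: "u \<in> borel_measurable borel" "pd i u \<in> borel_measurable borel" for i
    using u Ck_imp_continuous[OF u] by (auto intro!: borel_measurable_continuous_onI)
  have [measurable]: "e \<in> borel_measurable borel" unfolding e_def [abs_def] by measurable
  have seg: "ennreal ((u x - u (z + x))\<^sup>2) \<le> (\<integral>\<^sup>+t. e (x + t *\<^sub>R z) \<partial>unitM)" if "z \<in> fundamental_cube" for x z
    using segment_inequality[OF u that, of x] by (simp add: e_def add.commute[of z x])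
  have pe: "periodic e"
    unfolding periodic_def e_def
    by (intro allI impI arg_cong[where f = ennreal] arg_cong2[where f = "(*)"] sum.cong refl
        arg_cong2[where f = power] periodicD[OF periodic_pd[OF per]])
  have "(\<integral>\<^sup>+x. \<integral>\<^sup>+y. ennreal ((u x - u y)\<^sup>2) \<partial>cubeM \<partial>cubeM) = (\<integral>\<^sup>+x. \<integral>\<^sup>+z. ennreal ((u x - u (z + x))\<^sup>2) \<partial>cubeM \<partial>cubeM)"
    by (intro nn_integral_cong nn_integral_cube_translate[symmetric])
       (auto intro: periodic_comp[OF per])
  also have "\<dots> \<le> (\<integral>\<^sup>+x. \<integral>\<^sup>+z. \<integral>\<^sup>+t. e (x + t *\<^sub>R z) \<partial>unitM \<partial>cubeM \<partial>cubeM)"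
    by (rule nn_integral_mono, rule nn_integral_mono_AE, rule AE_cubeM, rule seg)
  also have "\<dots> = (\<integral>\<^sup>+z. \<integral>\<^sup>+x. \<integral>\<^sup>+t. e (x + t *\<^sub>R z) \<partial>unitM \<partial>cubeM \<partial>cubeM)"
    by (rule P.Fubini') measurable
  also have "\<dots> = (\<integral>\<^sup>+z. \<integral>\<^sup>+t. \<integral>\<^sup>+x. e (x + t *\<^sub>R z) \<partial>cubeM \<partial>unitM \<partial>cubeM)"
    by (intro nn_integral_cong Q.Fubini') measurable
  also have "\<dots> = (\<integral>\<^sup>+x. e x \<partial>cubeM)"
    by (subst nn_integral_cube_translate[OF pe]) (auto simp: emeasure_unitM emeasure_cubeM)
  finally show ?thesis by (simp add: e_def)
qed

section \<open>A mean value inequality for almost subsolutions\<close>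

lemma DERIV_max0_power:
  "((\<lambda>z::real. (max 0 z) ^ Suc (Suc k)) has_field_derivative real (Suc (Suc k)) * (max 0 z) ^ Suc k) (at z)"
proof -
  consider "z > 0" | "z < 0" | "z = 0" by linarith
  then show ?thesis
  proof cases
    case 1
    have "((\<lambda>z. z ^ Suc (Suc k)) has_field_derivative real (Suc (Suc k)) * (max 0 z) ^ Suc k) (at z)"
      using 1 DERIV_pow[of "Suc (Suc k)" z UNIV] by (simp add: max_def)
    then show ?thesis
      by (rule DERIV_cong_ev[THEN iffD1, rotated -1]) (use 1 in \<open>auto intro: eventually_mono[OF eventually_nhds_in_open[of "{0<..}"]]\<close>)
  next
    case 2
    have "((\<lambda>z. 0) has_field_derivative real (Suc (Suc k)) * (max 0 z) ^ Suc k) (at z)"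
      using 2 by (simp add: max_def)
    then show ?thesis
      by (rule DERIV_cong_ev[THEN iffD1, rotated -1]) (use 2 in \<open>auto intro: eventually_mono[OF eventually_nhds_in_open[of "{..<0}"]]\<close>)
  next
    case 3
    have "((\<lambda>h::real. (max 0 h) ^ Suc (Suc k) / h) \<longlongrightarrow> 0) (at 0)"
    proof (rule Lim_null_comparison)
      show "\<forall>\<^sub>F h::real in at 0. norm ((max 0 h) ^ Suc (Suc k) / h) \<le> \<bar>h\<bar> ^ Suc k"
        by (rule always_eventually) (auto simp: max_def intro!: mult_nonpos_nonneg)
      have "((\<lambda>h::real. \<bar>h\<bar> ^ Suc k) \<longlongrightarrow> \<bar>0\<bar> ^ Suc k) (at 0)" by (intro tendsto_intros)
      then show "((\<lambda>h::real. \<bar>h\<bar> ^ Suc k) \<longlongrightarrow> 0) (at 0)" by simp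
    qed
    then show ?thesis using 3 by (simp add: DERIV_def)
  qed
qed

lemma Ck_coord: "Ck k (\<lambda>x. x $ i)"
proof -
  have D: "((\<lambda>x. x $ i) has_derivative (\<lambda>x. x $ i)) (at x)" for x :: "real^'a"
    by (rule bounded_linear_imp_has_derivative[OF bounded_linear_vec_nth])
  have pd: "pd j (\<lambda>x. x $ i) = (\<lambda>x. if i = j then 1 else 0)" for j
  proof
    fix x :: "real^'a"
    from pd_eqI[OF D] show "pd j (\<lambda>x. x $ i) x = (if i = j then 1 else 0)" by (simp add: axis_def)
  qed
  show ?thesis
  proof (cases k)
    case (Suc l)
    have "(\<lambda>x. x $ i) differentiable (at x)" for x :: "real^'a"
      by (rule differentiableI[OF D])
    then show ?thesis using Suc by (auto simp: pd Ck_const)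
  qed (auto intro: continuous_intros)
qed

lemma Ck_scaled_shift:
  assumes "Ck k F" shows "Ck k (\<lambda>y. F (x + s *\<^sub>R y))"
  using assms
proof (induction k arbitrary: F)
  case 0
  then have "continuous_on UNIV F" by simp
  then have "continuous_on UNIV (\<lambda>y. F (x + s *\<^sub>R y))"
    by (rule continuous_on_compose2) (auto intro!: continuous_intros)
  then show ?case by simp
next
  case (Suc k)
  have d: "F differentiable (at z)" for z using Suc.prems by simp
  have "(\<lambda>y. F (x + s *\<^sub>R y)) differentiable (at y)" for y
  proof -
    have "((\<lambda>y. F (x + s *\<^sub>R y)) has_derivative
       (\<lambda>v. \<Sum>i\<in>UNIV. (s *\<^sub>R v) $ i * pd i F (x + s *\<^sub>R y))) (at y)"
      by (rule has_derivative_compose[where f = "\<lambda>y. x + s *\<^sub>R y" and g = F, OF _ has_derivative_pd[OF d]])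
         (auto intro!: derivative_eq_intros)
    then show ?thesis by (rule differentiableI)
  qed
  moreover have "Ck k (pd i (\<lambda>y. F (x + s *\<^sub>R y)))" for i
  proof -
    have "pd i (\<lambda>y. F (x + s *\<^sub>R y)) = (\<lambda>y. s * pd i F (x + s *\<^sub>R y))"
      by (rule ext) (rule pd_scaled_shift[OF d])
    then show ?thesis using Suc by (simp add: Ck_mult Ck_const)
  qed
  ultimately show ?case by simp
qed

lemma pd_bound_imp_Lipschitz:
  fixes F :: "real^'n::finite \<Rightarrow> real"
  assumes F: "Ck 1 F" and b: "\<And>i x. \<bar>pd i F x\<bar> \<le> B" and v: "\<And>i. \<bar>v $ i\<bar> \<le> r"
  shows "\<bar>F (x + v) - F x\<bar> \<le> real CARD('n) * (r * B)"
proof -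
  have "\<exists>t>0. t < 1 \<and> F (x + 1 *\<^sub>R v) - F (x + 0 *\<^sub>R v) = (1 - 0) * (\<Sum>i\<in>UNIV. v $ i * pd i F (x + t *\<^sub>R v))"
    by (rule MVT2) (use F in \<open>auto intro!: DERIV_line\<close>)
  then obtain t where "F (x + v) - F x = (\<Sum>i\<in>UNIV. v $ i * pd i F (x + t *\<^sub>R v))" by auto
  also have "\<bar>\<dots>\<bar> \<le> (\<Sum>i\<in>(UNIV::'n set). r * B)"
    by (rule order_trans[OF sum_abs])
       (intro sum_mono, simp add: abs_mult, intro mult_mono b v, use abs_ge_zero order_trans[OF abs_ge_zero v] in auto)
  finally show ?thesis by simp
qed

text \<open>The rescaled box has side less than \<open>1\<close>, hence a translate of it lies in the period cube.\<close>

lemma integral_periodic_small_box: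
  fixes h :: "real^'n::finite \<Rightarrow> real"
  assumes per: "periodic h" and h: "continuous_on UNIV h" "\<And>x. h x \<ge> 0"
    and r: "r > 0" "r * R < 1/2"
  shows "(\<integral>\<^sup>+y. indicator (cbox (\<chi> i. - R) (\<chi> i. R)) y * ennreal (h (x0 + r *\<^sub>R y)) \<partial>lborel)
     \<le> ennreal ((1/r) ^ CARD('n) * (\<integral>x. h x \<partial>cubeM))"
proof -
  have [measurable]: "h \<in> borel_measurable borel" by (rule borel_measurable_continuous_onI[OF h(1)])
  define p :: "real^'n" where "p = (\<chi> i. 1/2)"
  define H where "H x = indicator fundamental_cube (x - x0 + p) * ennreal (h x)" for x
  have [measurable]: "H \<in> borel_measurable borel" unfolding H_def [abs_def] by measurable
  have 1: "indicator (cbox (\<chi> i. - R) (\<chi> i. R)) y * ennreal (h (x0 + r *\<^sub>R y)) \<le> H (x0 + r *\<^sub>R y)" for y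
  proof (cases "y \<in> cbox (\<chi> i. - R) (\<chi> i. R)")
    case True
    have "0 \<le> r * y $ i + 1/2 \<and> r * y $ i + 1/2 < 1" for i
    proof -
      have "- R \<le> y $ i" "y $ i \<le> R" using True by (auto simp: mem_box_cart)
      then have "r * (- R) \<le> r * y $ i" "r * y $ i \<le> r * R"
        using mult_left_mono[of "- R" "y $ i" r] mult_left_mono[of "y $ i" R r] r by simp_all
      then show ?thesis using r(2) by simp
    qed
    then have "x0 + r *\<^sub>R y - x0 + p \<in> fundamental_cube" by (simp add: fundamental_cube_def p_def)
    then show ?thesis using True by (simp add: H_def)
  qed simp
  have "(\<integral>\<^sup>+x. H x \<partial>lborel) = ennreal (r ^ CARD('n)) * (\<integral>\<^sup>+y. H (x0 + r *\<^sub>R y) \<partial>lborel)"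
    by (subst lborel_affine[of r x0]) (use r in \<open>simp_all add: nn_integral_density nn_integral_distr nn_integral_cmult\<close>)
  moreover have "(\<integral>\<^sup>+x. H x \<partial>lborel) = (\<integral>\<^sup>+x. H (x + (x0 - p)) \<partial>lborel)"
    by (rule nn_integral_lborel_translate[symmetric]) measurable
  moreover have "\<dots> = (\<integral>\<^sup>+x. ennreal (h (x + (x0 - p))) \<partial>cubeM)"
    by (subst nn_integral_cubeM) (auto simp: H_def mult.commute)
  moreover have "\<dots> = (\<integral>\<^sup>+x. ennreal (h x) \<partial>cubeM)"
    by (rule nn_integral_cube_translate) (auto intro: periodic_comp[OF per])
  moreover have "\<dots> = ennreal (\<integral>x. h x \<partial>cubeM)"
    by (intro nn_integral_eq_integral integrable_cube per h AE_I2)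
  ultimately have "ennreal (\<integral>x. h x \<partial>cubeM) = ennreal (r ^ CARD('n)) * (\<integral>\<^sup>+y. H (x0 + r *\<^sub>R y) \<partial>lborel)" by simp
  then have "ennreal ((1/r) ^ CARD('n)) * ennreal (\<integral>x. h x \<partial>cubeM)
      = (ennreal ((1/r) ^ CARD('n)) * ennreal (r ^ CARD('n))) * (\<integral>\<^sup>+y. H (x0 + r *\<^sub>R y) \<partial>lborel)"
    by (simp add: mult.assoc)
  also have "ennreal ((1/r) ^ CARD('n)) * ennreal (r ^ CARD('n)) = 1"
    using r by (simp add: ennreal_mult[symmetric] power_mult_distrib[symmetric])
  finally have "(\<integral>\<^sup>+y. H (x0 + r *\<^sub>R y) \<partial>lborel) = ennreal ((1/r) ^ CARD('n) * (\<integral>x. h x \<partial>cubeM))"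
    using r h by (simp add: ennreal_mult integral_nonneg_AE)
  moreover have "(\<integral>\<^sup>+y. indicator (cbox (\<chi> i. - R) (\<chi> i. R)) y * ennreal (h (x0 + r *\<^sub>R y)) \<partial>lborel)
      \<le> (\<integral>\<^sup>+y. H (x0 + r *\<^sub>R y) \<partial>lborel)"
    by (intro nn_integral_mono 1)
  ultimately show ?thesis by simp
qed

text \<open>
  A bound for the divergence of the error field \<open>Z\<close> below, per unit of the scale \<open>s\<close>, in terms of the
  dimension, the radius of the support and the bounds \<open>L\<close> on \<open>G\<close> and \<open>L1\<close> on the derivatives of \<open>a\<close>.
\<close>

definition mvK :: "real \<Rightarrow> real \<Rightarrow> real \<Rightarrow> real \<Rightarrow> real" where
  "mvK n R L L1 = n\<^sup>2 * (L1 * (n * (R * L)) + n * (R * L1) * (4 * (n * (R * L))\<^sup>2 + L))"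

text \<open>
  An operator in divergence form with Lipschitz coefficients \<open>a\<close>, an almost subsolution \<open>w\<close>, and a matrix
  \<open>G\<close> proportional to the inverse of the coefficients at the centre \<open>x0\<close>.
\<close>

locale mean_value =
  fixes a :: "'n::finite \<Rightarrow> 'n \<Rightarrow> real^'n \<Rightarrow> real" and G :: "'n \<Rightarrow> 'n \<Rightarrow> real" and w :: "real^'n \<Rightarrow> real"
    and x0 :: "real^'n" and d0 \<nu> \<Lambda> \<Lambda>1 \<delta> M k B R :: real
  assumes a: "\<And>i j. Ck 1 (a i j)" and w: "Ck 2 w"
    and aG: "\<And>j k. (\<Sum>i\<in>UNIV. a i j x0 * G i k) = (if j = k then d0 else 0)" and d0: "d0 > 0"
    and Gsym: "\<And>i j. G i j = G j i" and Gbd: "\<And>i j. \<bar>G i j\<bar> \<le> \<Lambda>"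
    and ell: "\<And>y::real^'n. (\<Sum>i\<in>UNIV. \<Sum>j\<in>UNIV. G i j * y $ i * y $ j) \<ge> \<nu> * (y \<bullet> y)" and lam: "\<nu> > 0"
    and abd: "\<And>l i j x. \<bar>pd l (a i j) x\<bar> \<le> \<Lambda>1"
    and sub: "\<And>x. (\<Sum>i\<in>UNIV. pd i (\<lambda>x. \<Sum>j\<in>UNIV. a i j x * pd j w x) x) \<ge> - \<delta>" and del: "\<delta> \<ge> 0"
    and wM: "\<And>x. \<bar>w x - k\<bar> \<le> M" and wB: "\<And>i x. \<bar>pd i w x\<bar> \<le> B" and R: "R > 0" "\<nu> * R\<^sup>2 = 1"
begin

text \<open>
  Averages of \<open>w (x0 + s y)\<close> are taken with the weight \<open>\<psi>\<close>.  Both \<open>\<psi>\<close> and its potential \<open>\<Theta>\<close> are functions of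
  the quadratic form \<open>Q\<close> of \<open>G\<close>, chosen such that the frozen coefficients map the gradient of \<open>\<Theta>\<close> to
  \<open>- d0 \<psi> y\<close>: a weighted radial derivative of \<open>w\<close> is then an integral against a gradient.  The powers make
  both functions continuously differentiable across the boundary of their support.
\<close>

definition Q where "Q y = (\<Sum>i\<in>UNIV. \<Sum>j\<in>UNIV. G i j * y $ i * y $ j)"
definition g where "g i y = (\<Sum>j\<in>UNIV. G i j * y $ j)" for y :: "real^'n"
definition m where "m y = max 0 (1 - Q y)"
definition \<psi> where "\<psi> y = (m y)\<^sup>2"
definition \<Theta> where "\<Theta> y = (m y) ^ 3 / 6"
definition box where "box = cbox (\<chi> i. - R) ((\<chi> i. R) :: real^'n)"
lemma Ck_Q: "Ck l Q" and Ck_g: "Ck l (g i)"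
  unfolding Q_def [abs_def] g_def [abs_def] by (intro Ck_sum Ck_mult Ck_const Ck_coord)+

lemma diff1: "Ck 1 u \<Longrightarrow> u differentiable (at x)" for u :: "real^'n \<Rightarrow> real"
  by simp

lemma pd_g: "pd i (g j) y = G j i"
proof -
  have "(g j has_derivative g j) (at y)"
    unfolding g_def [abs_def]
    by (intro has_derivative_sum has_derivative_mult_right bounded_linear_imp_has_derivative[OF bounded_linear_vec_nth])
  from pd_eqI[OF this] show ?thesis
    by (simp add: g_def axis_def if_distrib[of "\<lambda>t. _ * t"] cong: if_cong)
qed

lemma pd_Q: "pd i Q y = 2 * g i y"
proof -
  have Q: "Q = (\<lambda>y. \<Sum>j\<in>UNIV. y $ j * g j y)"
    by (simp add: Q_def g_def sum_distrib_left mult_ac fun_eq_iff)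
  have dc: "(\<lambda>y. y $ j) differentiable (at y)" for j and y :: "real^'n" by (rule diff1[OF Ck_coord])
  have pc: "pd i (\<lambda>y. y $ j) y = (if i = j then 1 else 0)" for j
  proof -
    have "((\<lambda>x. x $ j) has_derivative (\<lambda>x. x $ j)) (at y)"
      by (rule bounded_linear_imp_has_derivative[OF bounded_linear_vec_nth])
    from pd_eqI[OF this] show ?thesis by (simp add: axis_def)
  qed
  have "pd i Q y = (\<Sum>j\<in>UNIV. pd i (\<lambda>y. y $ j * g j y) y)"
    unfolding Q by (rule pd_sum) (intro differentiable_mult dc diff1[OF Ck_g])
  also have "\<dots> = (\<Sum>j\<in>UNIV. (if i = j then 1 else 0) * g j y + y $ j * G j i)"
    by (simp add: pd_mult dc diff1[OF Ck_g] pc pd_g)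
  also have "\<dots> = g i y + (\<Sum>j\<in>UNIV. y $ j * G j i)"
    by (simp add: sum.distrib if_distrib[of "\<lambda>t. t * _"] cong: if_cong)
  also have "(\<Sum>j\<in>UNIV. y $ j * G j i) = g i y"
    unfolding g_def by (intro sum.cong refl) (simp add: Gsym mult.commute)
  finally show ?thesis by simp
qed

lemma continuous_m: "continuous_on UNIV m"
  unfolding m_def [abs_def] by (intro continuous_intros Ck_imp_continuous[OF Ck_Q[of 0]])

lemma chain_m:
  assumes "\<And>z. (\<phi> has_field_derivative \<phi>' z) (at z)"
  shows "(\<lambda>y. \<phi> (1 - Q y)) differentiable (at y)" "pd i (\<lambda>y. \<phi> (1 - Q y)) y = - 2 * \<phi>' (1 - Q y) * g i y"
proof -
  have C: "Ck 1 (\<lambda>y. 1 - Q y)" by (intro Ck_diff Ck_const Ck_Q)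
  have p: "pd i (\<lambda>y. 1 - Q y) y = - 2 * g i y"
    by (subst pd_diff) (auto simp: diff1[OF Ck_Q] pd_Q)
  show "(\<lambda>y. \<phi> (1 - Q y)) differentiable (at y)"
  proof -
    obtain D where "((\<lambda>y. 1 - Q y) has_derivative D) (at y)" using diff1[OF C] unfolding differentiable_def by blast
    from has_derivative_compose[OF this assms[unfolded has_field_derivative_def]] show ?thesis
      by (rule differentiableI)
  qed
  show "pd i (\<lambda>y. \<phi> (1 - Q y)) y = - 2 * \<phi>' (1 - Q y) * g i y"
    using pd_chain[OF diff1[OF C] assms, of i y] p by simp
qed

lemma psi_C1: "Ck 1 \<psi>" and pd_psi: "pd i \<psi> y = - 4 * m y * g i y"
  and theta_C1: "Ck 1 \<Theta>" and pd_theta: "pd i \<Theta> y = - \<psi> y * g i y"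
proof -
  have e: "\<psi> = (\<lambda>y. (\<lambda>z. (max 0 z)\<^sup>2) (1 - Q y))" "\<Theta> = (\<lambda>y. (\<lambda>z. (max 0 z)^3 / 6) (1 - Q y))"
    by (simp_all add: \<psi>_def \<Theta>_def m_def fun_eq_iff)
  have 1: "((\<lambda>z. (max 0 z)\<^sup>2) has_field_derivative 2 * max 0 z) (at z)" for z :: real
    using DERIV_max0_power[of 0 z] by (simp add: numeral_2_eq_2)
  have 2: "((\<lambda>z. (max 0 z)^3 / 6) has_field_derivative (max 0 z)\<^sup>2 / 2) (at z)" for z :: real
    using DERIV_cdivide[OF DERIV_max0_power[of 1 z], of 6] by (simp add: numeral_2_eq_2 numeral_3_eq_3)
  show p: "pd i \<psi> y = - 4 * m y * g i y" for i y
    unfolding e chain_m(2)[OF 1] by (simp add: m_def)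
  show t: "pd i \<Theta> y = - \<psi> y * g i y" for i y
    unfolding e(2) chain_m(2)[OF 2] by (simp add: m_def \<psi>_def)
  have "continuous_on UNIV (pd i \<psi>)" for i
    unfolding p [abs_def] by (intro continuous_intros continuous_m Ck_imp_continuous[OF Ck_g[of 0]])
  then show psi: "Ck 1 \<psi>" using chain_m(1)[OF 1] by (simp add: e)
  have "continuous_on UNIV (pd i \<Theta>)" for i
    unfolding t [abs_def] by (intro continuous_intros Ck_imp_continuous[OF psi] Ck_imp_continuous[OF Ck_g[of 0]])
  then show "Ck 1 \<Theta>" using chain_m(1)[OF 2] by (simp add: e)
qed

lemma m_bounds: "0 \<le> m y" "m y \<le> 1"
proof -
  have "0 \<le> \<nu> * (y \<bullet> y)" using lam by simp
  also have "\<dots> \<le> Q y" unfolding Q_def by (rule ell)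
  finally show "m y \<le> 1" by (simp add: m_def)
qed (simp add: m_def)

lemma outside_box: assumes "y \<notin> box" shows "m y = 0"
proof -
  from assms obtain i where "\<not> (- R \<le> y $ i \<and> y $ i \<le> R)" unfolding box_def mem_box_cart by auto
  then have "R < \<bar>y $ i\<bar>" by auto
  then have "R\<^sup>2 \<le> (y $ i)\<^sup>2" using R by (metis abs_le_square_iff abs_of_pos less_imp_le)
  also have "\<dots> \<le> y \<bullet> y"
    using member_le_sum[of i UNIV "\<lambda>i. y $ i * y $ i"] by (simp add: inner_vec_def power2_eq_square)
  finally have "\<nu> * R\<^sup>2 \<le> \<nu> * (y \<bullet> y)" using lam by (intro mult_left_mono) auto
  also have "\<dots> \<le> Q y" unfolding Q_def by (rule ell)
  finally show ?thesis using R by (simp add: m_def)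
qed

lemma in_box: "y \<in> box \<Longrightarrow> \<bar>y $ i\<bar> \<le> R"
  unfolding box_def mem_box_cart by (auto simp: abs_le_iff minus_le_iff)

lemma Lam_nonneg: "\<Lambda> \<ge> 0" "\<Lambda>1 \<ge> 0" "M \<ge> 0" "B \<ge> 0"
  using order_trans[OF abs_ge_zero Gbd] order_trans[OF abs_ge_zero abd]
    order_trans[OF abs_ge_zero wM] order_trans[OF abs_ge_zero wB] by blast+

lemma g_bound: assumes "y \<in> box" shows "\<bar>g i y\<bar> \<le> real CARD('n) * (R * \<Lambda>)"
proof -
  have "\<bar>g i y\<bar> \<le> (\<Sum>j\<in>(UNIV::'n set). R * \<Lambda>)"
    unfolding g_def by (rule order_trans[OF sum_abs], intro sum_mono)
      (simp add: abs_mult mult.commute[of R], intro mult_mono Gbd in_box[OF assms] Lam_nonneg abs_ge_zero)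
  then show ?thesis by simp
qed

text \<open>
  One integration by parts in the rescaled variable \<open>y\<close>.  The coefficients are frozen at \<open>x0\<close>; since
  they are Lipschitz, the error field \<open>Z\<close> and its divergence carry a factor \<open>s\<close>, which cancels the factor
  \<open>1/s\<close> that comes from moving the derivative off \<open>w\<close>.
\<close>

lemma radial_derivative_lower_bound:
  assumes s: "0 < s"
  shows "d0 * (\<integral>y. \<psi> y * (\<Sum>j\<in>UNIV. y $ j * pd j w (x0 + s *\<^sub>R y)) \<partial>lborel) \<ge> - (s * \<delta> + M * mvK (real CARD('n)) R \<Lambda> \<Lambda>1) * measure lborel box"
proof -
  define V where "V i x = (\<Sum>j\<in>UNIV. a i j x * pd j w x)" for i x
  define b where "b j i y = a j i (x0 + s *\<^sub>R y) - a j i x0" for i j y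
  define Z where "Z i y = (\<Sum>j\<in>UNIV. b j i y * pd j \<Theta> y)" for i y
  define divZ where "divZ y = (\<Sum>i\<in>UNIV. pd i (Z i) y)" for y
  define F where "F i y = s * (\<Theta> y * V i (x0 + s *\<^sub>R y)) - (w (x0 + s *\<^sub>R y) - k) * Z i y" for i y
  have w1: "Ck 1 w" "Ck 1 (pd j w)" for j
    using w by (metis Ck_SucD Suc_1, metis Ck_pd Suc_1 w)
  have V1: "Ck 1 (V i)" for i unfolding V_def [abs_def] by (intro Ck_sum Ck_mult a w1)
  have b1: "Ck 1 (b j i)" for j i unfolding b_def [abs_def] by (intro Ck_diff Ck_const Ck_scaled_shift a)
  have th1: "Ck 1 (pd j \<Theta>)" for j
  proof -
    have "pd j \<Theta> = (\<lambda>y. (-1) * (\<psi> y * g j y))" by (simp add: pd_theta fun_eq_iff)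
    then show ?thesis by (simp only:) (intro Ck_mult Ck_const psi_C1 Ck_g)
  qed
  have Z1: "Ck 1 (Z i)" for i unfolding Z_def [abs_def] by (intro Ck_sum Ck_mult b1 th1)
  have F1: "Ck 1 (F i)" for i
    unfolding F_def [abs_def] by (intro Ck_diff Ck_mult Ck_const theta_C1 Ck_scaled_shift V1 w1 Z1)
  have F0: "F i y = 0" if "y \<notin> box" for i y
    using outside_box[OF that] by (simp add: F_def Z_def pd_theta \<psi>_def \<Theta>_def)
  have pdF: "(\<Sum>i\<in>UNIV. pd i (F i) y) = s\<^sup>2 * \<Theta> y * (\<Sum>i\<in>UNIV. pd i (V i) (x0 + s *\<^sub>R y))
      - s * d0 * (\<psi> y * (\<Sum>j\<in>UNIV. y $ j * pd j w (x0 + s *\<^sub>R y))) - (w (x0 + s *\<^sub>R y) - k) * divZ y" for y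
  proof -
    let ?x = "x0 + s *\<^sub>R y"
    have dV: "(\<lambda>y. V i (x0 + s *\<^sub>R y)) differentiable (at y)" and dw: "(\<lambda>y. w (x0 + s *\<^sub>R y) - k) differentiable (at y)" for i
      by (rule diff1, intro Ck_diff Ck_const Ck_scaled_shift V1 w1)+
    have pw: "pd i (\<lambda>y. w (x0 + s *\<^sub>R y) - k) y = s * pd i w ?x" for i
      by (subst pd_diff) (auto intro!: diff1 Ck_scaled_shift w1 simp: pd_scaled_shift[OF diff1[OF w1(1)]])
    have "pd i (F i) y = s * (pd i \<Theta> y * V i ?x + \<Theta> y * (s * pd i (V i) ?x))
        - (s * pd i w ?x * Z i y + (w ?x - k) * pd i (Z i) y)" for i
      unfolding F_def
      by (subst pd_diff)
         (auto intro!: differentiable_mult diff1[OF theta_C1] dV dw diff1[OF Z1]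
          simp: pd_cmult pd_mult diff1[OF theta_C1] dV dw diff1[OF Z1] differentiable_mult pw pd_scaled_shift[OF diff1[OF V1]])
    then have "(\<Sum>i\<in>UNIV. pd i (F i) y) = (\<Sum>i\<in>UNIV. s * (pd i \<Theta> y * V i ?x + \<Theta> y * (s * pd i (V i) ?x))
        - (s * pd i w ?x * Z i y + (w ?x - k) * pd i (Z i) y))" by (simp only:)
    also have "\<dots> = s\<^sup>2 * \<Theta> y * (\<Sum>i\<in>UNIV. pd i (V i) ?x)
       + s * ((\<Sum>i\<in>UNIV. pd i \<Theta> y * V i ?x) - (\<Sum>i\<in>UNIV. pd i w ?x * Z i y)) - (w ?x - k) * divZ y"
      unfolding divZ_def
      by (simp add: sum.distrib sum_subtractf sum_distrib_left algebra_simps power2_eq_square)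
    also have "(\<Sum>i\<in>UNIV. pd i w ?x * Z i y) = (\<Sum>i\<in>UNIV. \<Sum>j\<in>UNIV. b i j y * pd i \<Theta> y * pd j w ?x)"
      unfolding Z_def sum_distrib_left by (subst sum.swap) (simp add: mult_ac)
    also have "(\<Sum>i\<in>UNIV. pd i \<Theta> y * V i ?x) - \<dots> = (\<Sum>i\<in>UNIV. \<Sum>j\<in>UNIV. a i j x0 * pd i \<Theta> y * pd j w ?x)"
      unfolding V_def b_def sum_distrib_left sum_subtractf[symmetric]
      by (intro sum.cong refl) (simp add: algebra_simps)
    also have "\<dots> = - \<psi> y * (\<Sum>j\<in>UNIV. (\<Sum>i\<in>UNIV. a i j x0 * g i y) * pd j w ?x)"
      unfolding pd_theta sum_distrib_left sum_distrib_right
      by (subst sum.swap) (simp add: mult_ac)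
    finally have 1: "(\<Sum>i\<in>UNIV. pd i (F i) y) = s\<^sup>2 * \<Theta> y * (\<Sum>i\<in>UNIV. pd i (V i) ?x)
       + s * (- \<psi> y * (\<Sum>j\<in>UNIV. (\<Sum>i\<in>UNIV. a i j x0 * g i y) * pd j w ?x)) - (w ?x - k) * divZ y" .
    have "(\<Sum>i\<in>UNIV. a i j x0 * g i y) = d0 * y $ j" for j
    proof -
      have "(\<Sum>i\<in>UNIV. a i j x0 * g i y) = (\<Sum>k\<in>UNIV. (\<Sum>i\<in>UNIV. a i j x0 * G i k) * y $ k)"
        unfolding g_def sum_distrib_left sum_distrib_right by (subst sum.swap) (simp add: mult_ac)
      then show ?thesis by (simp add: aG if_distrib[of "\<lambda>t. t * _"] cong: if_cong)
    qed
    then show ?thesis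
      unfolding 1 by (simp add: sum_distrib_left sum_negf mult_ac)
  qed
  have divZ_bound: "\<bar>divZ y\<bar> \<le> s * mvK (real CARD('n)) R \<Lambda> \<Lambda>1 * indicator box y" for y
  proof (cases "y \<in> box")
    case False
    have Z0: "Z i y = 0" if "y \<notin> box" for i y
      using outside_box[OF that] by (simp add: Z_def pd_theta \<psi>_def)
    have "open (- box)" unfolding box_def by (simp add: closed_cbox open_Compl)
    then have "(Z i has_derivative (\<lambda>v. 0)) (at y)" for i
      by (rule has_derivative_transform_within_open[of "\<lambda>y. 0" _ y UNIV "- box", rotated 1])
         (simp_all add: False Z0)
    then have "pd i (Z i) y = 0" for i using pd_eqI by fastforce
    then show ?thesis using False by (simp add: divZ_def)
  next
    case True
    have psi: "0 \<le> \<psi> y" "\<psi> y \<le> 1" using m_bounds[of y] by (simp_all add: \<psi>_def power_le_one)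
    have th: "\<bar>pd j \<Theta> y\<bar> \<le> real CARD('n) * (R * \<Lambda>)" for j
    proof -
      have "\<bar>pd j \<Theta> y\<bar> \<le> 1 * (real CARD('n) * (R * \<Lambda>))"
        unfolding pd_theta abs_mult abs_minus_cancel using psi by (intro mult_mono g_bound[OF True]) auto
      then show ?thesis by simp
    qed
    have pdth: "\<bar>pd i (pd j \<Theta>) y\<bar> \<le> 4 * (real CARD('n) * (R * \<Lambda>))\<^sup>2 + \<Lambda>" for i j
    proof -
      have "pd i (pd j \<Theta>) y = pd i (\<lambda>y. (-1) * (\<psi> y * g j y)) y" by (simp add: pd_theta [abs_def])
      also have "\<dots> = 4 * m y * (g i y * g j y) - \<psi> y * G j i"
        by (subst pd_cmult, intro differentiable_mult diff1[OF psi_C1] diff1[OF Ck_g])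
           (simp add: pd_mult diff1[OF psi_C1] diff1[OF Ck_g] pd_psi pd_g algebra_simps)
      also have "\<bar>\<dots>\<bar> \<le> \<bar>4 * m y * (g i y * g j y)\<bar> + \<bar>\<psi> y * G j i\<bar>" by (rule abs_triangle_ineq4)
      also have "\<dots> \<le> 4 * 1 * (real CARD('n) * (R * \<Lambda>) * (real CARD('n) * (R * \<Lambda>))) + 1 * \<Lambda>"
        unfolding abs_mult using m_bounds[of y] psi Lam_nonneg R
        by (intro add_mono mult_mono g_bound[OF True] Gbd) auto
      finally show ?thesis by (simp add: power2_eq_square)
    qed
    have bb: "\<bar>b j i y\<bar> \<le> s * (real CARD('n) * (R * \<Lambda>1))" for j i
    proof -
      have "\<bar>a j i (x0 + s *\<^sub>R y) - a j i x0\<bar> \<le> real CARD('n) * ((s * R) * \<Lambda>1)"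
        by (rule pd_bound_imp_Lipschitz[OF a abd]) (use s in_box[OF True] in \<open>simp add: abs_mult mult_left_mono\<close>)
      then show ?thesis by (simp add: b_def mult_ac)
    qed
    have pb: "\<bar>pd i (b j i) y\<bar> \<le> s * \<Lambda>1" for j i
    proof -
      have "pd i (b j i) y = s * pd i (a j i) (x0 + s *\<^sub>R y)"
        unfolding b_def by (subst pd_diff) (auto intro!: diff1 Ck_scaled_shift a simp: pd_scaled_shift[OF diff1[OF a]])
      then show ?thesis using s abd by (simp add: abs_mult mult_left_mono)
    qed
    have "\<bar>pd i (Z i) y\<bar> \<le> (\<Sum>j\<in>(UNIV::'n set). s * \<Lambda>1 * (real CARD('n) * (R * \<Lambda>)) + s * (real CARD('n) * (R * \<Lambda>1)) * (4 * (real CARD('n) * (R * \<Lambda>))\<^sup>2 + \<Lambda>))" for i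
    proof -
      have "pd i (Z i) y = (\<Sum>j\<in>UNIV. pd i (b j i) y * pd j \<Theta> y + b j i y * pd i (pd j \<Theta>) y)"
        unfolding Z_def by (subst pd_sum) (auto intro!: differentiable_mult diff1[OF b1] diff1[OF th1]
           simp: pd_mult diff1[OF b1] diff1[OF th1])
      also have "\<bar>\<dots>\<bar> \<le> (\<Sum>j\<in>UNIV. \<bar>pd i (b j i) y * pd j \<Theta> y + b j i y * pd i (pd j \<Theta>) y\<bar>)" by (rule sum_abs)
      also have "\<dots> \<le> (\<Sum>j\<in>(UNIV::'n set). s * \<Lambda>1 * (real CARD('n) * (R * \<Lambda>)) + s * (real CARD('n) * (R * \<Lambda>1)) * (4 * (real CARD('n) * (R * \<Lambda>))\<^sup>2 + \<Lambda>))"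
        by (intro sum_mono order_trans[OF abs_triangle_ineq], unfold abs_mult)
           (use s Lam_nonneg R in \<open>intro add_mono mult_mono th pdth bb pb\<close>, auto)
      finally show ?thesis .
    qed
    then have "\<bar>divZ y\<bar> \<le> (\<Sum>i\<in>(UNIV::'n set). \<Sum>j\<in>(UNIV::'n set). s * \<Lambda>1 * (real CARD('n) * (R * \<Lambda>)) + s * (real CARD('n) * (R * \<Lambda>1)) * (4 * (real CARD('n) * (R * \<Lambda>))\<^sup>2 + \<Lambda>))"
      unfolding divZ_def by (intro order_trans[OF sum_abs] sum_mono)
    also have "\<dots> = s * mvK (real CARD('n)) R \<Lambda> \<Lambda>1" by (simp add: mvK_def power2_eq_square algebra_simps)
    finally show ?thesis using True by simp
  qed
  define J where "J y = \<psi> y * (\<Sum>j\<in>UNIV. y $ j * pd j w (x0 + s *\<^sub>R y))" for y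
  have cw: "continuous_on UNIV (\<lambda>y. pd j w (x0 + s *\<^sub>R y))" for j
    by (intro Ck_imp_continuous[of 1] Ck_scaled_shift w1)
  have iJ: "integrable lborel J"
  proof (rule integrable_lborel_compact_support)
    show "continuous_on UNIV J"
      unfolding J_def [abs_def] by (intro continuous_intros cw Ck_imp_continuous[OF psi_C1])
    show "J y = 0" if "y \<notin> cbox (\<chi> i. - R) (\<chi> i. R)" for y
      using outside_box[of y] that by (simp add: box_def J_def \<psi>_def)
  qed
  have iF: "integrable lborel (pd i (F i))" "(\<integral>y. pd i (F i) y \<partial>lborel) = 0" for i
    using integral_lborel_pd_eq_0[OF F1, of "\<chi> i. - R" "\<chi> i. R"] F0 by (auto simp: box_def)
  have ibox: "integrable lborel (indicator box :: _ \<Rightarrow> real)"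
    unfolding box_def by (simp add: integrable_indicator_iff emeasure_lborel_cbox_finite[unfolded infinity_ennreal_def])
  have low: "(\<Sum>i\<in>UNIV. pd i (F i) y) + s * d0 * J y \<ge> - ((s\<^sup>2 * \<delta> + M * (s * mvK (real CARD('n)) R \<Lambda> \<Lambda>1)) * indicator box y)" for y
  proof -
    have T: "0 \<le> \<Theta> y" "\<Theta> y \<le> indicator box y"
    proof -
      have "m y ^ 3 \<le> 1" using m_bounds[of y] by (simp add: power_le_one)
      then show "0 \<le> \<Theta> y" "\<Theta> y \<le> indicator box y"
        using m_bounds[of y] outside_box[of y] by (auto simp: \<Theta>_def indicator_def)
    qed
    have "\<Theta> y * (- (\<Sum>i\<in>UNIV. pd i (V i) (x0 + s *\<^sub>R y))) \<le> indicator box y * \<delta>"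
    proof -
      have "\<Theta> y * (- (\<Sum>i\<in>UNIV. pd i (V i) (x0 + s *\<^sub>R y))) \<le> \<Theta> y * \<delta>"
        using sub[of "x0 + s *\<^sub>R y"] T unfolding V_def by (intro mult_left_mono) auto
      also have "\<dots> \<le> indicator box y * \<delta>" using T del by (intro mult_right_mono)
      finally show ?thesis .
    qed
    then have 1: "s\<^sup>2 * (\<Theta> y * (- (\<Sum>i\<in>UNIV. pd i (V i) (x0 + s *\<^sub>R y)))) \<le> s\<^sup>2 * (indicator box y * \<delta>)"
      by (intro mult_left_mono) auto
    have "(w (x0 + s *\<^sub>R y) - k) * divZ y \<le> \<bar>w (x0 + s *\<^sub>R y) - k\<bar> * \<bar>divZ y\<bar>" by (metis abs_ge_self abs_mult)
    also have "\<dots> \<le> M * (s * mvK (real CARD('n)) R \<Lambda> \<Lambda>1 * indicator box y)"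
      using Lam_nonneg by (intro mult_mono wM divZ_bound) auto
    finally show ?thesis using 1 unfolding pdF J_def[symmetric] by (simp add: algebra_simps)
  qed
  have "(\<integral>y. - ((s\<^sup>2 * \<delta> + M * (s * mvK (real CARD('n)) R \<Lambda> \<Lambda>1)) * indicator box y) \<partial>lborel) \<le> (\<integral>y. (\<Sum>i\<in>UNIV. pd i (F i) y) + s * d0 * J y \<partial>lborel)"
    by (rule integral_mono[OF _ _ low]) (auto intro!: iF iJ ibox)
  also have "\<dots> = s * d0 * (\<integral>y. J y \<partial>lborel)"
    using iF iJ by simp
  also have "(\<integral>y. - ((s\<^sup>2 * \<delta> + M * (s * mvK (real CARD('n)) R \<Lambda> \<Lambda>1)) * indicator box y) \<partial>lborel) = - (s\<^sup>2 * \<delta> + M * (s * mvK (real CARD('n)) R \<Lambda> \<Lambda>1)) * measure lborel box"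
    by simp (simp add: algebra_simps)
  finally have "s * (- (s * \<delta> + M * mvK (real CARD('n)) R \<Lambda> \<Lambda>1) * measure lborel box) \<le> s * (d0 * (\<integral>y. J y \<partial>lborel))"
    by (simp add: algebra_simps power2_eq_square)
  then show ?thesis using s unfolding J_def by (simp add: mult_le_cancel_left)
qed

lemma integrable_psi_times:
  assumes "continuous_on UNIV h" shows "integrable lborel (\<lambda>y. \<psi> y * h y)"
proof (rule integrable_lborel_compact_support)
  show "continuous_on UNIV (\<lambda>y. \<psi> y * h y)"
    by (intro continuous_intros assms Ck_imp_continuous[OF psi_C1])
  show "\<psi> y * h y = 0" if "y \<notin> cbox (\<chi> i. - R) (\<chi> i. R)" for y
    using outside_box[of y] that by (simp add: box_def \<psi>_def)
qed

lemma psi_le_indicator: "0 \<le> \<psi> y" "\<psi> y \<le> indicator box y"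
  using m_bounds[of y] outside_box[of y] by (auto simp: \<psi>_def indicator_def power_le_one)

lemma finite_box: "integrable lborel (indicator box :: _ \<Rightarrow> real)" "0 \<le> measure lborel box"
  unfolding box_def by (simp_all add: integrable_indicator_iff emeasure_lborel_cbox_finite[unfolded infinity_ennreal_def])

text \<open>The radial derivative is integrated over the scales between \<open>0\<close> and \<open>r\<close>.\<close>

lemma average_lower_bound:
  assumes r: "0 < r"
  shows "d0 * (\<integral>y. \<psi> y * (w (x0 + r *\<^sub>R y) - w x0) \<partial>lborel)
     \<ge> - (r * ((r * \<delta> + M * mvK (real CARD('n)) R \<Lambda> \<Lambda>1) * measure lborel box))"
proof -
  have w1: "Ck 1 w" "Ck 1 (pd j w)" for j
    using w by (metis Ck_SucD Suc_1, metis Ck_pd Suc_1 w)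
  define f where "f t y = \<psi> y * (\<Sum>j\<in>UNIV. y $ j * pd j w (x0 + (t * r) *\<^sub>R y))" for t y
  have cpd: "continuous_on UNIV (pd j w)" for j by (rule Ck_imp_continuous[OF w1(2)])
  have cpsi: "continuous_on UNIV \<psi>" by (rule Ck_imp_continuous[OF psi_C1])
  have [measurable]: "pd j w \<in> borel_measurable borel" "\<psi> \<in> borel_measurable borel" for j
    by (auto intro: borel_measurable_continuous_onI cpd cpsi)
  have [measurable]: "(\<lambda>y::real^'n. y $ j) \<in> borel_measurable borel" for j
    by (intro borel_measurable_continuous_onI continuous_intros)
  have cf: "continuous_on UNIV (f t)" for t
    unfolding f_def [abs_def]
    by (intro continuous_intros cpsi continuous_on_compose2[OF cpd]) auto
  have fb: "\<bar>f t y\<bar> \<le> (real CARD('n) * (R * B)) * indicator box y" for t y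
  proof (cases "y \<in> box")
    case True
    have "\<bar>\<Sum>j\<in>UNIV. y $ j * pd j w (x0 + (t * r) *\<^sub>R y)\<bar> \<le> (\<Sum>j\<in>(UNIV::'n set). R * B)"
      by (rule order_trans[OF sum_abs], intro sum_mono)
         (simp add: abs_mult, intro mult_mono in_box[OF True] wB, use R in auto)
    then have "\<psi> y * \<bar>\<Sum>j\<in>UNIV. y $ j * pd j w (x0 + (t * r) *\<^sub>R y)\<bar> \<le> 1 * (real CARD('n) * (R * B))"
      using psi_le_indicator[of y] True by (intro mult_mono) auto
    then show ?thesis using True psi_le_indicator[of y] by (simp add: f_def abs_mult)
  next
    case False
    then show ?thesis using outside_box[of y] by (simp add: f_def \<psi>_def)
  qed
  have if1: "integrable lborel (f t)" for t
    unfolding f_def by (rule integrable_psi_times)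
      (intro continuous_intros continuous_on_compose2[OF cpd], auto)
  interpret P: pair_sigma_finite unitM "lborel :: (real^'n) measure" ..
  have meas: "(\<lambda>(t, y). f t y) \<in> borel_measurable (unitM \<Otimes>\<^sub>M lborel)"
    unfolding f_def by measurable
  have "integrable (unitM \<Otimes>\<^sub>M lborel) (\<lambda>(t, y). f t y)"
  proof (rule P.Fubini_integrable[OF meas])
    have "(\<integral>y. norm (f t y) \<partial>lborel) \<le> (\<integral>y. (real CARD('n) * (R * B)) * indicator box y \<partial>lborel)" for t
      using fb if1 finite_box by (intro integral_mono) auto
    then have b: "norm (\<integral>y. norm (f t y) \<partial>lborel) \<le> (real CARD('n) * (R * B)) * measure lborel box" for t
      by simp
    have m2: "(\<lambda>t. \<integral>y. norm (f t y) \<partial>lborel) \<in> borel_measurable unitM"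
      using meas by (intro lborel.borel_measurable_lebesgue_integral) (auto simp: split_beta')
    show "integrable unitM (\<lambda>t. \<integral>y. norm (case (t, y) of (t, y) \<Rightarrow> f t y) \<partial>lborel)"
      using unitM.integrable_const_bound[OF _ m2] b by auto
    show "AE t in unitM. integrable lborel (\<lambda>y. case (t, y) of (t, y) \<Rightarrow> f t y)"
      using if1 by simp
  qed
  note Fub = this P.Fubini_integral[OF this]
  have FTC: "r * (\<integral>t. f t y \<partial>unitM) = \<psi> y * (w (x0 + r *\<^sub>R y) - w x0)" for y
  proof -
    have "\<psi> y * (w (x0 + r *\<^sub>R y) - w x0) = \<psi> y * (\<integral>t. (\<Sum>i\<in>UNIV. (r *\<^sub>R y) $ i * pd i w (x0 + t *\<^sub>R (r *\<^sub>R y))) \<partial>unitM)"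
      using line_FTC(2)[OF w1(1), of "r *\<^sub>R y" x0] by simp
    also have "\<dots> = (\<integral>t. r * f t y \<partial>unitM)"
      unfolding integral_mult_right_zero[symmetric]
      by (intro arg_cong[where f = "integral\<^sup>L unitM"] ext) (simp add: f_def sum_distrib_left mult_ac)
    finally show ?thesis by simp
  qed
  have "(\<integral>y. \<psi> y * (w (x0 + r *\<^sub>R y) - w x0) \<partial>lborel) = r * (\<integral>y. (\<integral>t. f t y \<partial>unitM) \<partial>lborel)"
    unfolding FTC[symmetric] by simp
  also have "\<dots> = r * (\<integral>t. (\<integral>y. f t y \<partial>lborel) \<partial>unitM)" using Fub(2) by simp
  finally have eq: "d0 * (\<integral>y. \<psi> y * (w (x0 + r *\<^sub>R y) - w x0) \<partial>lborel) = r * (\<integral>t. d0 * (\<integral>y. f t y \<partial>lborel) \<partial>unitM)"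
    by simp
  let ?c = "- (r * \<delta> + M * mvK (real CARD('n)) R \<Lambda> \<Lambda>1) * measure lborel box"
  have "AE t in unitM. t \<noteq> 0" using AE_lborel_singleton[of "0::real"] by (auto simp: AE_density)
  moreover have "AE t in unitM. 0 \<le> t \<and> t \<le> 1" by (auto simp: AE_density indicator_def)
  ultimately have "AE t in unitM. ?c \<le> d0 * (\<integral>y. f t y \<partial>lborel)"
  proof eventually_elim
    case (elim t)
    then have "- ((t * r) * \<delta> + M * mvK (real CARD('n)) R \<Lambda> \<Lambda>1) * measure lborel box \<le> d0 * (\<integral>y. f t y \<partial>lborel)"
      using radial_derivative_lower_bound[of "t * r"] r by (simp add: f_def)
    moreover have "(t * r) * \<delta> \<le> r * \<delta>" using elim r del by (intro mult_right_mono) (auto intro: mult_left_le_one_le)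
    then have "?c \<le> - ((t * r) * \<delta> + M * mvK (real CARD('n)) R \<Lambda> \<Lambda>1) * measure lborel box"
      using finite_box(2) by (intro mult_right_mono) auto
    ultimately show ?case by linarith
  qed
  then have "(\<integral>t. ?c \<partial>unitM) \<le> (\<integral>t. d0 * (\<integral>y. f t y \<partial>lborel) \<partial>unitM)"
    by (intro integral_mono_AE) (use P.integrable_fst[OF Fub(1)] in auto)
  then have "?c \<le> (\<integral>t. d0 * (\<integral>y. f t y \<partial>lborel) \<partial>unitM)"
    using emeasure_unitM by (simp add: measure_def)
  then have "r * ?c \<le> r * (\<integral>t. d0 * (\<integral>y. f t y \<partial>lborel) \<partial>unitM)" using r by (intro mult_left_mono) auto
  moreover have "r * ?c = - (r * ((r * \<delta> + M * mvK (real CARD('n)) R \<Lambda> \<Lambda>1) * measure lborel box))"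
    by (simp only: mult_minus_left mult_minus_right)
  ultimately show ?thesis unfolding eq by linarith
qed

lemma mass_psi:
  assumes \<rho>: "\<rho> > 0" "(real CARD('n))\<^sup>2 * (\<Lambda> * \<rho>\<^sup>2) \<le> 1/2"
  shows "measure lborel (cbox (\<chi> i. - \<rho>) ((\<chi> i. \<rho>) :: real^'n)) / 4 \<le> (\<integral>y. \<psi> y \<partial>lborel)"
proof -
  let ?b = "cbox (\<chi> i. - \<rho>) ((\<chi> i. \<rho>) :: real^'n)"
  have "indicator ?b y * (1/4) \<le> \<psi> y" for y
  proof (cases "y \<in> ?b")
    case True
    then have y: "\<bar>y $ i\<bar> \<le> \<rho>" for i unfolding mem_box_cart by (auto simp: abs_le_iff minus_le_iff)
    have "Q y \<le> (\<Sum>i\<in>(UNIV::'n set). \<Sum>j\<in>(UNIV::'n set). \<Lambda> * \<rho> * \<rho>)"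
    proof -
      have "G i j * y $ i * y $ j \<le> \<bar>G i j\<bar> * \<bar>y $ i\<bar> * \<bar>y $ j\<bar>" for i j
        by (metis abs_ge_self abs_mult)
      also have "\<dots> i j \<le> \<Lambda> * \<rho> * \<rho>" for i j
        using \<rho> Lam_nonneg by (intro mult_mono Gbd y) auto
      finally show ?thesis unfolding Q_def by (intro sum_mono)
    qed
    also have "\<dots> \<le> 1/2" using \<rho>(2) by (simp add: power2_eq_square mult_ac)
    finally have "1/2 \<le> m y" by (simp add: m_def)
    then have "(1/2)\<^sup>2 \<le> \<psi> y" unfolding \<psi>_def by (intro power_mono) auto
    then show ?thesis using True by (simp add: power2_eq_square)
  qed (use psi_le_indicator in auto)
  then have "(\<integral>y. indicator ?b y * (1/4) \<partial>lborel) \<le> (\<integral>y. \<psi> y \<partial>lborel)"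
    using integrable_psi_times[of "\<lambda>y. 1"]
    by (intro integral_mono integrable_mult_left)
       (auto simp: integrable_indicator_iff emeasure_lborel_cbox_finite[unfolded infinity_ennreal_def])
  then show ?thesis by simp
qed

text \<open>
  The value at \<open>x0\<close> exceeds the average at scale \<open>r\<close> by at most \<open>O(r)\<close>, and that average of \<open>w - k\<close> is
  bounded by the \<open>L\<^sup>1\<close> norm over a period.
\<close>

lemma mean_value_bound:
  assumes per: "periodic w" and r: "0 < r" "r * R < 1/2"
    and \<rho>: "\<rho> > 0" "(real CARD('n))\<^sup>2 * (\<Lambda> * \<rho>\<^sup>2) \<le> 1/2"
  shows "d0 * (measure lborel (cbox (\<chi> i. - \<rho>) ((\<chi> i. \<rho>) :: real^'n)) / 4) * (w x0 - k)
     \<le> d0 * ((1/r) ^ CARD('n) * (\<integral>x. \<bar>w x - k\<bar> \<partial>cubeM)) + r * ((r * \<delta> + M * mvK (real CARD('n)) R \<Lambda> \<Lambda>1) * measure lborel box)"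
    (is "_ * ?\<mu> * _ \<le> d0 * ?I + ?E")
proof -
  have cw: "continuous_on UNIV w" by (rule Ck_imp_continuous[OF w])
  have ca: "continuous_on UNIV (\<lambda>x. \<bar>w x - k\<bar>)" by (intro continuous_intros cw)
  have cs: "continuous_on UNIV (\<lambda>y. w (x0 + r *\<^sub>R y))"
    by (rule Ck_imp_continuous[OF Ck_scaled_shift[OF w]])
  define A where "A = (\<integral>y. \<psi> y * (w (x0 + r *\<^sub>R y) - k) \<partial>lborel)"
  have i: "integrable lborel (\<lambda>y. \<psi> y * (w (x0 + r *\<^sub>R y) - k))" "integrable lborel (\<lambda>y. \<psi> y * (w (x0 + r *\<^sub>R y) - w x0))"
      "integrable lborel (\<lambda>y. \<psi> y * (w x0 - k))" "integrable lborel (\<lambda>y. \<psi> y * \<bar>w (x0 + r *\<^sub>R y) - k\<bar>)" "integrable lborel \<psi>"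
    using integrable_psi_times[of "\<lambda>y. 1"] by (auto intro!: integrable_psi_times continuous_intros cs)
  have I0: "?I \<ge> 0" using r by (intro mult_nonneg_nonneg integral_nonneg_AE) auto
  have "A \<le> (\<integral>y. \<psi> y * \<bar>w (x0 + r *\<^sub>R y) - k\<bar> \<partial>lborel)"
    unfolding A_def using i psi_le_indicator by (intro integral_mono mult_left_mono) auto
  also have "\<dots> \<le> ?I"
  proof -
    have "ennreal (\<integral>y. \<psi> y * \<bar>w (x0 + r *\<^sub>R y) - k\<bar> \<partial>lborel) = (\<integral>\<^sup>+y. ennreal (\<psi> y * \<bar>w (x0 + r *\<^sub>R y) - k\<bar>) \<partial>lborel)"
      by (rule nn_integral_eq_integral[symmetric, OF i(4)]) (use psi_le_indicator in auto)
    also have "\<dots> \<le> (\<integral>\<^sup>+y. indicator (cbox (\<chi> i. - R) (\<chi> i. R)) y * ennreal \<bar>w (x0 + r *\<^sub>R y) - k\<bar> \<partial>lborel)"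
    proof (rule nn_integral_mono)
      fix y
      have "\<psi> y * \<bar>w (x0 + r *\<^sub>R y) - k\<bar> \<le> indicator box y * \<bar>w (x0 + r *\<^sub>R y) - k\<bar>"
        using psi_le_indicator by (intro mult_right_mono) auto
      then have "ennreal (\<psi> y * \<bar>w (x0 + r *\<^sub>R y) - k\<bar>) \<le> ennreal (indicator box y * \<bar>w (x0 + r *\<^sub>R y) - k\<bar>)"
        by (rule ennreal_leI)
      then show "ennreal (\<psi> y * \<bar>w (x0 + r *\<^sub>R y) - k\<bar>) \<le> indicator (cbox (\<chi> i. - R) (\<chi> i. R)) y * ennreal \<bar>w (x0 + r *\<^sub>R y) - k\<bar>"
        by (simp add: ennreal_mult ennreal_indicator box_def)
    qed
    also have "\<dots> \<le> ennreal ?I"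
      by (rule integral_periodic_small_box[OF periodic_comp[OF per] ca _ r]) simp
    finally show ?thesis using I0 by simp
  qed
  finally have AI: "A \<le> ?I" .
  have "A = (\<integral>y. \<psi> y * (w (x0 + r *\<^sub>R y) - w x0) + \<psi> y * (w x0 - k) \<partial>lborel)"
    unfolding A_def by (simp add: algebra_simps)
  also have "\<dots> = (\<integral>y. \<psi> y * (w (x0 + r *\<^sub>R y) - w x0) \<partial>lborel) + (\<integral>y. \<psi> y \<partial>lborel) * (w x0 - k)"
    using i by simp
  finally have "(\<integral>y. \<psi> y \<partial>lborel) * (w x0 - k) = A - (\<integral>y. \<psi> y * (w (x0 + r *\<^sub>R y) - w x0) \<partial>lborel)"
    by linarith
  then have "d0 * ((\<integral>y. \<psi> y \<partial>lborel) * (w x0 - k)) = d0 * A - d0 * (\<integral>y. \<psi> y * (w (x0 + r *\<^sub>R y) - w x0) \<partial>lborel)"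
    by (simp only: right_diff_distrib)
  also have "\<dots> \<le> d0 * ?I + ?E"
    using average_lower_bound[OF r(1)] mult_left_mono[OF AI, of d0] d0 by linarith
  finally have 1: "d0 * ((\<integral>y. \<psi> y \<partial>lborel) * (w x0 - k)) \<le> d0 * ?I + ?E" .
  show ?thesis
  proof (cases "w x0 - k \<ge> 0")
    case True
    then have "d0 * ?\<mu> * (w x0 - k) \<le> d0 * ((\<integral>y. \<psi> y \<partial>lborel) * (w x0 - k))"
      unfolding mult.assoc using mass_psi[OF \<rho>] d0 by (intro mult_left_mono mult_right_mono) auto
    then show ?thesis using 1 by linarith
  next
    case False
    then have "d0 * ?\<mu> * (w x0 - k) \<le> 0"
      using d0 by (intro mult_nonneg_nonpos mult_nonneg_nonneg) auto
    moreover have "0 \<le> d0 * ?I + ?E"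
    proof -
      have "mvK (real CARD('n)) R \<Lambda> \<Lambda>1 \<ge> 0"
        unfolding mvK_def using R Lam_nonneg by (intro mult_nonneg_nonneg add_nonneg_nonneg) auto
      then show ?thesis using r d0 del I0 Lam_nonneg finite_box
        by (intro add_nonneg_nonneg mult_nonneg_nonneg) auto
    qed
    ultimately show ?thesis by linarith
  qed
qed

end

section \<open>Lengths of curves and distances\<close>

definition cont_tensor :: "'n::finite tensor2 \<Rightarrow> bool" where
  "cont_tensor g \<longleftrightarrow> (\<forall>i j. continuous_on UNIV (\<lambda>x. g (torus_proj x) $ i $ j))"

definition speed :: "'n::finite tensor2 \<Rightarrow> real^'n \<Rightarrow> real^'n \<Rightarrow> real" where
  "speed g x v = sqrt (v \<bullet> (g (torus_proj x) *v v))"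

lemma speed_expand: "speed g x v = sqrt (\<Sum>i\<in>UNIV. \<Sum>j\<in>UNIV. g (torus_proj x) $ i $ j * v $ i * v $ j)"
  by (simp add: speed_def inner_mult_vec)

lemma measurable_speed:
  assumes "cont_tensor g" and [measurable]: "X \<in> borel_measurable M" "V \<in> borel_measurable M"
  shows "(\<lambda>t. speed g (X t) (V t)) \<in> borel_measurable M"
proof -
  have [measurable]: "(\<lambda>x. g (torus_proj x) $ i $ j) \<in> borel_measurable borel" for i j
    using assms(1) by (intro borel_measurable_continuous_onI) (simp add: cont_tensor_def)
  have [measurable]: "(\<lambda>x::real^'a. x $ i) \<in> borel_measurable borel" for i
    by (intro borel_measurable_continuous_onI continuous_intros)
  show ?thesis unfolding speed_expand by measurable
qed

lemma speed_scale: "speed g x (a *\<^sub>R v) = \<bar>a\<bar> * speed g x v"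
  by (simp add: speed_def matrix_vector_mult_scaleR real_sqrt_mult flip: mult.assoc)

lemma speed_conformal: "speed (\<lambda>p. a\<^sup>2 *\<^sub>R g p) x v = \<bar>a\<bar> * speed g x v"
  by (simp add: speed_def scaleR_matrix_vector_assoc[symmetric] real_sqrt_mult)

lemma curve_length_eq_speed:
  assumes "finite S" "\<And>t. t \<in> {0<..<1} - S \<Longrightarrow> (\<gamma> has_vector_derivative D t) (at t)"
  shows "curve_length g \<gamma> = (\<integral>\<^sup>+t. ennreal (speed g (\<gamma> t) (D t)) * indicator {0..1} t \<partial>lborel)"
  unfolding curve_length_def speed_def
proof (rule nn_integral_cong_AE)
  have "AE t in lborel. t \<notin> insert 0 (insert 1 S)"
    using assms(1) by (intro AE_not_in countable_imp_null_set_lborel) (simp add: countable_finite)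
  then show "AE t in lborel. ennreal (sqrt (vector_derivative \<gamma> (at t) \<bullet> (g (torus_proj (\<gamma> t)) *v vector_derivative \<gamma> (at t)))) *
        indicator {0..1} t = ennreal (sqrt (D t \<bullet> (g (torus_proj (\<gamma> t)) *v D t))) * indicator {0..1} t"
  proof eventually_elim
    case (elim t)
    then show ?case
      using vector_derivative_at[OF assms(2)[of t]] by (auto simp: indicator_def)
  qed
qed

text \<open>
  The velocity is made Borel measurable, and \<open>\<gamma>'\<close> extends the curve continuously to the line.  The lengths
  of all translates of the curve then have integrands that are jointly measurable in the time and the
  translation, as Fubini requires.
\<close>

lemma curve_velocity:
  fixes \<gamma> :: "real \<Rightarrow> real^'n::finite"
  assumes "valid_path \<gamma>"
  obtains \<gamma>' D S where "continuous_on UNIV \<gamma>'" "\<forall>t\<in>{0..1}. \<gamma>' t = \<gamma> t"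
    "D \<in> borel_measurable borel" "finite S"
    "\<forall>t\<in>{0<..<1} - S. (\<gamma> has_vector_derivative D t) (at t)" "\<forall>t. t \<notin> {0..1} \<longrightarrow> D t = 0"
    "\<forall>g z. curve_length g (\<lambda>t. \<gamma> t + z) = (\<integral>\<^sup>+t. ennreal (speed g (\<gamma>' t + z) (D t)) \<partial>lborel)"
proof -
  from assms obtain S where c: "continuous_on {0..1} \<gamma>" and S: "finite S" "\<gamma> C1_differentiable_on ({0..1} - S)"
    unfolding valid_path_def piecewise_C1_differentiable_on_def by blast
  then obtain D0 where D0: "\<And>t. t \<in> {0..1} - S \<Longrightarrow> (\<gamma> has_vector_derivative D0 t) (at t)"
      "continuous_on ({0..1} - S) D0"
    unfolding C1_differentiable_on_def by blast
  define D where "D t = indicator ({0..1} - S) t *\<^sub>R D0 t" for t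
  define \<gamma>' where "\<gamma>' t = \<gamma> (max 0 (min 1 t))" for t
  have meas: "D \<in> borel_measurable borel"
    unfolding D_def [abs_def] using S(1) D0(2)
    by (intro borel_measurable_continuous_on_indicator) (auto intro: sets.Diff simp: finite_imp_closed)
  have D: "(\<gamma> has_vector_derivative D t) (at t)" if "t \<in> {0<..<1} - S" for t
    using D0(1)[of t] that by (simp add: D_def)
  have cont: "continuous_on UNIV \<gamma>'"
    unfolding \<gamma>'_def by (rule continuous_on_compose2[OF c]) (auto intro!: continuous_intros)
  have eq: "\<gamma>' t = \<gamma> t" if "t \<in> {0..1}" for t using that by (simp add: \<gamma>'_def)
  have D_0: "D t = 0" if "t \<notin> {0..1}" for t using that by (auto simp: D_def indicator_def)
  have "curve_length g (\<lambda>t. \<gamma> t + z) = (\<integral>\<^sup>+t. ennreal (speed g (\<gamma>' t + z) (D t)) \<partial>lborel)" for g z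
  proof -
    have "curve_length g (\<lambda>t. \<gamma> t + z) = (\<integral>\<^sup>+t. ennreal (speed g (\<gamma> t + z) (D t)) * indicator {0..1} t \<partial>lborel)"
      by (rule curve_length_eq_speed[OF S(1)]) (auto intro!: derivative_eq_intros D)
    also have "\<dots> = (\<integral>\<^sup>+t. ennreal (speed g (\<gamma>' t + z) (D t)) \<partial>lborel)"
      by (rule nn_integral_cong) (auto simp: indicator_def eq D_0 speed_def)
    finally show ?thesis .
  qed
  then show thesis using that[OF cont _ meas S(1)] eq D D_0 by blast
qed

lemma curve_length_join:
  fixes \<gamma>1 \<gamma>2 :: "real \<Rightarrow> real^'n::finite"
  assumes g: "cont_tensor g" and "valid_path \<gamma>1" "valid_path \<gamma>2"
  shows "curve_length g (\<gamma>1 +++ \<gamma>2) \<le> curve_length g \<gamma>1 + curve_length g \<gamma>2"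
proof -
  obtain c1 D1 S1 where 1: "continuous_on UNIV c1" "\<forall>t\<in>{0..1}. c1 t = \<gamma>1 t"
    "D1 \<in> borel_measurable borel" "finite S1"
    "\<forall>t\<in>{0<..<1} - S1. (\<gamma>1 has_vector_derivative D1 t) (at t)"
    "\<forall>t. t \<notin> {0..1} \<longrightarrow> D1 t = 0"
    "\<forall>g z. curve_length g (\<lambda>t. \<gamma>1 t + z) = (\<integral>\<^sup>+t. ennreal (speed g (c1 t + z) (D1 t)) \<partial>lborel)"
    by (rule curve_velocity[OF assms(2)])
  obtain c2 D2 S2 where 2: "continuous_on UNIV c2" "\<forall>t\<in>{0..1}. c2 t = \<gamma>2 t"
    "D2 \<in> borel_measurable borel" "finite S2"
    "\<forall>t\<in>{0<..<1} - S2. (\<gamma>2 has_vector_derivative D2 t) (at t)"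
    "\<forall>t. t \<notin> {0..1} \<longrightarrow> D2 t = 0"
    "\<forall>g z. curve_length g (\<lambda>t. \<gamma>2 t + z) = (\<integral>\<^sup>+t. ennreal (speed g (c2 t + z) (D2 t)) \<partial>lborel)"
    by (rule curve_velocity[OF assms(3)])
  note [measurable] = 1(3) 2(3) borel_measurable_continuous_onI[OF 1(1)] borel_measurable_continuous_onI[OF 2(1)]
  have [measurable]: "(\<lambda>t. speed g (c1 t) (D1 t)) \<in> borel_measurable borel" "(\<lambda>t. speed g (c2 t) (D2 t)) \<in> borel_measurable borel"
    by (intro measurable_speed g; measurable)+
  define D where "D t = (if t < 1/2 then 2 *\<^sub>R D1 (2 * t) else 2 *\<^sub>R D2 (2 * t - 1))" for t
  define S where "S = insert (1/2) ((\<lambda>s. s / 2) ` S1 \<union> (\<lambda>s. (s + 1) / 2) ` S2)"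
  have "((\<gamma>1 +++ \<gamma>2) has_vector_derivative D t) (at t)" if "t \<in> {0<..<1} - S" for t
  proof (cases "t < 1/2")
    case True
    have "2 * t \<notin> S1"
    proof
      assume "2 * t \<in> S1"
      then have "(2 * t) / 2 \<in> S" unfolding S_def by blast
      then show False using that by simp
    qed
    then have "(\<gamma>1 has_vector_derivative D1 (2 * t)) (at (2 * t))" using that True by (intro 1(5)[rule_format]) auto
    then have "((\<lambda>t. \<gamma>1 (2 * t)) has_vector_derivative 2 *\<^sub>R D1 (2 * t)) (at t)"
      by (rule vector_diff_chain_at[of "\<lambda>t. 2 * t" 2 t, unfolded o_def, rotated]) (auto intro!: derivative_eq_intros)
    then have "((\<gamma>1 +++ \<gamma>2) has_vector_derivative 2 *\<^sub>R D1 (2 * t)) (at t)"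
      by (rule has_vector_derivative_transform_within_open[where S = "{..<1/2}"])
         (use True in \<open>auto simp: joinpaths_def\<close>)
    then show ?thesis using True by (simp add: D_def)
  next
    case False
    have t: "t > 1/2" using False that by (auto simp: S_def)
    have "2 * t - 1 \<notin> S2"
    proof
      assume "2 * t - 1 \<in> S2"
      then have "(2 * t - 1 + 1) / 2 \<in> S" unfolding S_def by blast
      then show False using that by simp
    qed
    then have "(\<gamma>2 has_vector_derivative D2 (2 * t - 1)) (at (2 * t - 1))" using that t by (intro 2(5)[rule_format]) auto
    then have "((\<lambda>t. \<gamma>2 (2 * t - 1)) has_vector_derivative 2 *\<^sub>R D2 (2 * t - 1)) (at t)"
      by (rule vector_diff_chain_at[of "\<lambda>t. 2 * t - 1" 2 t, unfolded o_def, rotated]) (auto intro!: derivative_eq_intros)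
    then have "((\<gamma>1 +++ \<gamma>2) has_vector_derivative 2 *\<^sub>R D2 (2 * t - 1)) (at t)"
      by (rule has_vector_derivative_transform_within_open[where S = "{1/2<..}"])
         (use t in \<open>auto simp: joinpaths_def\<close>)
    then show ?thesis using t by (simp add: D_def)
  qed
  moreover have "finite S" using 1(4) 2(4) by (simp add: S_def)
  ultimately have "curve_length g (\<gamma>1 +++ \<gamma>2) = (\<integral>\<^sup>+t. ennreal (speed g ((\<gamma>1 +++ \<gamma>2) t) (D t)) * indicator {0..1} t \<partial>lborel)"
    by (intro curve_length_eq_speed)
  also have "\<dots> \<le> (\<integral>\<^sup>+t. 2 * ennreal (speed g (c1 (2 * t)) (D1 (2 * t))) + 2 * ennreal (speed g (c2 (2 * t - 1)) (D2 (2 * t - 1))) \<partial>lborel)"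
  proof (rule nn_integral_mono_AE)
    have "AE t in lborel. t \<noteq> (1/2::real)" by (rule AE_lborel_singleton)
    then show "AE t in lborel. ennreal (speed g ((\<gamma>1 +++ \<gamma>2) t) (D t)) * indicator {0..1} t
       \<le> 2 * ennreal (speed g (c1 (2 * t)) (D1 (2 * t))) + 2 * ennreal (speed g (c2 (2 * t - 1)) (D2 (2 * t - 1)))"
    proof eventually_elim
      case (elim t)
      consider "t \<notin> {0..1}" | "0 \<le> t" "t < 1/2" | "1/2 < t" "t \<le> 1" using elim by (auto simp: not_le) linarith
      then show ?case
      proof cases
        case 2
        then have "speed g ((\<gamma>1 +++ \<gamma>2) t) (D t) = 2 * speed g (c1 (2 * t)) (D1 (2 * t))"
          by (simp add: joinpaths_def D_def speed_scale 1(2)[rule_format])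
        then show ?thesis using 2 by (simp add: ennreal_mult')
      next
        case 3
        then have "speed g ((\<gamma>1 +++ \<gamma>2) t) (D t) = 2 * speed g (c2 (2 * t - 1)) (D2 (2 * t - 1))"
          by (simp add: joinpaths_def D_def speed_scale 2(2)[rule_format])
        then show ?thesis using 3 by (simp add: ennreal_mult')
      qed simp
    qed
  qed
  also have "\<dots> = 2 * (\<integral>\<^sup>+t. ennreal (speed g (c1 (0 + 2 * t)) (D1 (0 + 2 * t))) \<partial>lborel)
        + 2 * (\<integral>\<^sup>+t. ennreal (speed g (c2 (- 1 + 2 * t)) (D2 (- 1 + 2 * t))) \<partial>lborel)"
    by (subst nn_integral_add) (auto simp: nn_integral_cmult intro!: borel_measurable_times_ennreal arg_cong2[where f = "(+)"]
        measurable_compose[OF measurable_speed[OF g] measurable_ennreal])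
  also have "2 * (\<integral>\<^sup>+t. ennreal (speed g (c1 (0 + 2 * t)) (D1 (0 + 2 * t))) \<partial>lborel) = (\<integral>\<^sup>+t. ennreal (speed g (c1 t) (D1 t)) \<partial>lborel)"
    by (subst nn_integral_real_affine[of "\<lambda>t. ennreal (speed g (c1 t) (D1 t))" 2 0]) auto
  also have "2 * (\<integral>\<^sup>+t. ennreal (speed g (c2 (- 1 + 2 * t)) (D2 (- 1 + 2 * t))) \<partial>lborel) = (\<integral>\<^sup>+t. ennreal (speed g (c2 t) (D2 t)) \<partial>lborel)"
    by (subst nn_integral_real_affine[of "\<lambda>t. ennreal (speed g (c2 t) (D2 t))" 2 "-1"]) auto
  finally show ?thesis using 1(7)[rule_format, of g 0] 2(7)[rule_format, of g 0] by simp
qed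

text \<open>The infimum before its conversion to a real number, which would send infinity to zero.\<close>

definition edist :: "'n::finite tensor2 \<Rightarrow> 'n torus \<Rightarrow> 'n torus \<Rightarrow> ennreal" where
  "edist g p q = (INF \<gamma>\<in>{\<gamma>. valid_path \<gamma> \<and> torus_proj (\<gamma> 0) = p \<and> torus_proj (\<gamma> 1) = q}. curve_length g \<gamma>)"

lemma riem_dist_edist: "riem_dist g p q = enn2real (edist g p q)"
  by (simp add: riem_dist_def edist_def)

lemma edist_le:
  "valid_path \<gamma> \<Longrightarrow> torus_proj (\<gamma> 0) = p \<Longrightarrow> torus_proj (\<gamma> 1) = q \<Longrightarrow> edist g p q \<le> curve_length g \<gamma>"
  unfolding edist_def by (rule INF_lower) simp

lemma curve_length_linepath:
  "curve_length g (linepath x y) = (\<integral>\<^sup>+t. ennreal (speed g (x + t *\<^sub>R (y - x)) (y - x)) * indicator {0..1} t \<partial>lborel)"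
proof -
  have "curve_length g (linepath x y) = (\<integral>\<^sup>+t. ennreal (speed g (linepath x y t) (y - x)) * indicator {0..1} t \<partial>lborel)"
    by (rule curve_length_eq_speed[of "{}"]) (auto intro: has_vector_derivative_linepath_within)
  then show ?thesis by (simp add: linepath_def algebra_simps)
qed

text \<open>Any two points of the torus have lifts in the unit cube, hence are joined by a segment of length at most \<open>n\<close>.\<close>

lemma edist_bounded:
  fixes g :: "'n::finite tensor2"
  assumes "\<And>x v. speed g x v \<le> L * norm v" "L \<ge> 0"
  shows "edist g p q \<le> ennreal (L * real CARD('n))"
proof -
  obtain x where x: "x \<in> fundamental_cube" "torus_proj x = p"
    by (metis exists_cube_representative torus_proj_rep)
  obtain y where y: "y \<in> fundamental_cube" "torus_proj y = q"
    by (metis exists_cube_representative torus_proj_rep)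
  have "norm (y - x) \<le> (\<Sum>i\<in>UNIV. \<bar>(y - x) $ i\<bar>)" by (rule norm_le_l1_cart)
  also have "\<dots> \<le> (\<Sum>i\<in>(UNIV::'n set). 1)"
  proof (rule sum_mono)
    fix i
    have "0 \<le> x $ i" "x $ i < 1" "0 \<le> y $ i" "y $ i < 1" using x y by (auto simp: fundamental_cube_def)
    then show "\<bar>(y - x) $ i\<bar> \<le> 1" by simp
  qed
  finally have n: "norm (y - x) \<le> real CARD('n)" by simp
  have "edist g p q \<le> curve_length g (linepath x y)"
    by (rule edist_le[OF valid_path_linepath]) (use x y in \<open>simp_all add: linepath_0' linepath_1'\<close>)
  also have "\<dots> \<le> (\<integral>\<^sup>+t. ennreal (L * real CARD('n)) * indicator {0..1::real} t \<partial>lborel)"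
    unfolding curve_length_linepath
    by (intro nn_integral_mono mult_right_mono ennreal_leI order_trans[OF assms(1)] mult_left_mono n assms(2)) auto
  also have "\<dots> = ennreal (L * real CARD('n))"
    by (subst nn_integral_cmult_indicator) auto
  finally show ?thesis .
qed

lemma curve_length_scale_le:
  fixes g1 g2 :: "'n::finite tensor2"
  assumes g: "cont_tensor g1" and le: "\<And>x v. a * speed g1 x v \<le> speed g2 x v" and a: "a \<ge> 0" and v: "valid_path \<gamma>"
  shows "ennreal a * curve_length g1 \<gamma> \<le> curve_length g2 \<gamma>"
proof -
  obtain c D S where c: "continuous_on UNIV c" "\<forall>t\<in>{0..1}. c t = \<gamma> t" "D \<in> borel_measurable borel" "finite S"
    "\<forall>t\<in>{0<..<1} - S. (\<gamma> has_vector_derivative D t) (at t)" "\<forall>t. t \<notin> {0..1} \<longrightarrow> D t = 0"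
    "\<forall>g z. curve_length g (\<lambda>t. \<gamma> t + z) = (\<integral>\<^sup>+t. ennreal (speed g (c t + z) (D t)) \<partial>lborel)"
    by (rule curve_velocity[OF v])
  have m: "(\<lambda>t. ennreal (speed g1 (c t) (D t))) \<in> borel_measurable lborel"
    using measurable_speed[OF g borel_measurable_continuous_onI[OF c(1)] c(3)] by measurable
  have "ennreal a * curve_length g1 \<gamma> = (\<integral>\<^sup>+t. ennreal a * ennreal (speed g1 (c t) (D t)) \<partial>lborel)"
    using c(7)[rule_format, of g1 0] m by (simp add: nn_integral_cmult)
  also have "\<dots> \<le> (\<integral>\<^sup>+t. ennreal (speed g2 (c t) (D t)) \<partial>lborel)"
    using le a by (intro nn_integral_mono) (simp add: ennreal_mult'[symmetric] ennreal_leI)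
  finally show ?thesis using c(7)[rule_format, of g2 0] by simp
qed

lemma riem_dist_lower:
  fixes g1 g2 :: "'n::finite tensor2"
  assumes g: "cont_tensor g1" and le: "\<And>x v. a * speed g1 x v \<le> speed g2 x v" and a: "a \<ge> 0"
    and fin: "edist g2 p q < \<infinity>"
  shows "a * riem_dist g1 p q \<le> riem_dist g2 p q"
proof -
  have "ennreal a * edist g1 p q \<le> edist g2 p q"
    unfolding edist_def[of g2]
  proof (rule INF_greatest, clarify)
    fix \<gamma> :: "real \<Rightarrow> real^'n" assume v: "valid_path \<gamma>" and pq: "p = torus_proj (\<gamma> 0)" "q = torus_proj (\<gamma> 1)"
    have "ennreal a * edist g1 (torus_proj (\<gamma> 0)) (torus_proj (\<gamma> 1)) \<le> ennreal a * curve_length g1 \<gamma>"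
      by (intro mult_left_mono edist_le v) auto
    also have "\<dots> \<le> curve_length g2 \<gamma>" by (rule curve_length_scale_le[OF g le a v])
    finally show "ennreal a * edist g1 (torus_proj (\<gamma> 0)) (torus_proj (\<gamma> 1)) \<le> curve_length g2 \<gamma>" .
  qed
  then have "enn2real (ennreal a * edist g1 p q) \<le> enn2real (edist g2 p q)"
    using fin by (intro enn2real_mono) auto
  then show ?thesis using a by (simp add: riem_dist_edist enn2real_mult)
qed

section \<open>An upper bound for distances by averaging\<close>

abbreviation hbox :: "real \<Rightarrow> (real^'n::finite) set" where
  "hbox \<rho> \<equiv> cbox (\<chi> i. - \<rho>) (\<chi> i. \<rho>)"

abbreviation hboxM :: "real \<Rightarrow> (real^'n::finite) measure" where
  "hboxM \<rho> \<equiv> density lborel (indicator (hbox \<rho>))"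

lemma mem_hbox: "y \<in> hbox \<rho> \<longleftrightarrow> (\<forall>i. \<bar>y $ i\<bar> \<le> \<rho>)"
  by (auto simp: mem_box_cart abs_le_iff minus_le_iff)

lemma norm_hbox:
  fixes y :: "real^'n::finite"
  assumes "y \<in> hbox \<rho>" shows "norm y \<le> real CARD('n) * \<rho>"
proof -
  have "norm y \<le> (\<Sum>i\<in>UNIV. \<bar>y $ i\<bar>)" by (rule norm_le_l1_cart)
  also have "\<dots> \<le> (\<Sum>i\<in>(UNIV::'n set). \<rho>)" by (rule sum_mono) (use assms in \<open>simp add: mem_hbox\<close>)
  finally show ?thesis by simp
qed

lemma emeasure_hbox: "emeasure lborel (hbox \<rho> :: (real^'n::finite) set) = ennreal (measure lborel (hbox \<rho> :: (real^'n) set))"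
  by (intro emeasure_eq_ennreal_measure)
     (use emeasure_lborel_cbox_finite[of "\<chi> i. - \<rho>" "(\<chi> i. \<rho>) :: real^'n"] in simp)

lemma emeasure_hboxM: "emeasure (hboxM \<rho> :: (real^'n::finite) measure) UNIV = emeasure lborel (hbox \<rho> :: (real^'n) set)"
  by (simp add: emeasure_density)

lemma finite_measure_hboxM: "finite_measure (hboxM \<rho>)"
  by standard (simp add: emeasure_hboxM emeasure_hbox)

lemma AE_hboxM: "(\<And>x. x \<in> hbox \<rho> \<Longrightarrow> P x) \<Longrightarrow> AE x in hboxM \<rho>. P x"
  by (auto simp: AE_density indicator_def)

text \<open>
  Both orientations occur because a curve leaves its first endpoint along a segment and arrives at
  the second one along another.
\<close>

definition segment_mean :: "(real^'n::finite \<Rightarrow> real) \<Rightarrow> real^'n \<Rightarrow> ennreal" where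
  "segment_mean h x = (\<integral>\<^sup>+y. \<integral>\<^sup>+t. ennreal (h (x + t *\<^sub>R y)) + ennreal (h (x + (1 - t) *\<^sub>R y)) \<partial>unitM \<partial>hboxM (1/4))"

lemma periodic_uniformly_continuous:
  fixes F :: "real^'n::finite \<Rightarrow> real"
  assumes per: "periodic F" and F: "continuous_on UNIV F" and e: "e > 0"
  obtains d where "d > 0" "\<And>x y. y \<in> hbox d \<Longrightarrow> \<bar>F (x + y) - F x\<bar> \<le> e"
proof -
  let ?K = "cbox (\<chi> i. - 1) ((\<chi> i. 2) :: real^'n)"
  have "uniformly_continuous_on ?K F"
    by (rule compact_uniformly_continuous) (auto intro: continuous_on_subset[OF F])
  then obtain d0 where d0: "d0 > 0" "\<And>x x'. x \<in> ?K \<Longrightarrow> x' \<in> ?K \<Longrightarrow> dist x' x < d0 \<Longrightarrow> dist (F x') (F x) < e"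
    unfolding uniformly_continuous_on_def using e by meson
  define n where "n = real CARD('n)"
  have n: "n \<ge> 1" by (simp add: n_def Suc_leI)
  define d where "d = min 1 (d0 / (2 * n))"
  have d: "d > 0" "d \<le> 1" "n * d < d0"
  proof -
    have "n * d \<le> n * (d0 / (2 * n))" unfolding d_def using n by (intro mult_left_mono) auto
    also have "\<dots> = d0 / 2" using n by simp
    finally show "n * d < d0" using d0 by simp
  qed (use n d0 in \<open>auto simp: d_def\<close>)
  have "\<bar>F (x + y) - F x\<bar> \<le> e" if y: "y \<in> hbox d" for x y
  proof -
    obtain x' where x': "x' \<in> fundamental_cube" "torus_proj x' = torus_proj x"
      by (rule exists_cube_representative)
    have eq: "F (x + y) = F (x' + y)" "F x = F x'"
      by (rule periodicD[OF per]; use x'(2) torus_proj_shift[OF x'(2)] in simp)+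
    have "dist (x' + y) x' < d0" using norm_hbox[OF y] d(3) by (simp add: n_def dist_norm)
    moreover have "- 1 \<le> x' $ i \<and> x' $ i \<le> 2 \<and> - 1 \<le> x' $ i + y $ i \<and> x' $ i + y $ i \<le> 2" for i
    proof -
      have "0 \<le> x' $ i" "x' $ i < 1" using x' by (auto simp: fundamental_cube_def)
      moreover have "\<bar>y $ i\<bar> \<le> 1" using y d(2) unfolding mem_hbox by (meson order_trans)
      ultimately show ?thesis by (auto simp: abs_le_iff)
    qed
    then have "x' \<in> ?K" "x' + y \<in> ?K" by (auto simp: mem_box_cart)
    ultimately have "dist (F (x' + y)) (F x') < e" by (intro d0)
    then show ?thesis unfolding eq by (simp add: dist_real_def)
  qed
  with d(1) that show thesis by blast
qed

locale segment_average =
  fixes h :: "real^'n::finite \<Rightarrow> real"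
  assumes per: "periodic h" and cont: "continuous_on UNIV h" and nonneg: "\<And>x. h x \<ge> 0"
begin

lemma h_meas [measurable]: "h \<in> borel_measurable borel"
  by (rule borel_measurable_continuous_onI[OF cont])

lemma periodic_segment_mean: "periodic (segment_mean h)"
  unfolding periodic_def segment_mean_def
proof (intro allI impI)
  fix x y :: "real^'n" assume xy: "torus_proj x = torus_proj y"
  have "h (x + z) = h (y + z)" for z by (rule periodicD[OF per torus_proj_shift[OF xy]])
  then show "(\<integral>\<^sup>+z. \<integral>\<^sup>+t. ennreal (h (x + t *\<^sub>R z)) + ennreal (h (x + (1 - t) *\<^sub>R z)) \<partial>unitM \<partial>hboxM (1/4))
    = (\<integral>\<^sup>+z. \<integral>\<^sup>+t. ennreal (h (y + t *\<^sub>R z)) + ennreal (h (y + (1 - t) *\<^sub>R z)) \<partial>unitM \<partial>hboxM (1/4))" by simp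
qed

lemma segment_mean_measurable [measurable]: "segment_mean h \<in> borel_measurable borel"
proof -
  interpret B: finite_measure "hboxM (1/4) :: (real^'n) measure" by (rule finite_measure_hboxM)
  show ?thesis unfolding segment_mean_def [abs_def] by measurable
qed

text \<open>By Fubini and translation invariance the segments contribute no more than the integral of \<open>h\<close>.\<close>

lemma integral_segment_mean:
  "(\<integral>\<^sup>+x. segment_mean h x \<partial>cubeM) = 2 * emeasure lborel (hbox (1/4) :: (real^'n) set) * ennreal (\<integral>x. h x \<partial>cubeM)"
proof -
  interpret B: finite_measure "hboxM (1/4) :: (real^'n) measure" by (rule finite_measure_hboxM)
  interpret P: pair_sigma_finite "hboxM (1/4) :: (real^'n) measure" "cubeM :: (real^'n) measure" ..
  interpret Q: pair_sigma_finite "unitM" "cubeM :: (real^'n) measure" ..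
  have pe: "periodic (\<lambda>x. ennreal (h x))" by (rule periodic_comp[OF per])
  have tr: "(\<integral>\<^sup>+x. ennreal (h (x + z)) \<partial>cubeM) = ennreal (\<integral>x. h x \<partial>cubeM)" for z
  proof -
    have "(\<integral>\<^sup>+x. ennreal (h (x + z)) \<partial>cubeM) = (\<integral>\<^sup>+x. ennreal (h x) \<partial>cubeM)"
      by (rule nn_integral_cube_translate[OF pe]) measurable
    also have "\<dots> = ennreal (\<integral>x. h x \<partial>cubeM)"
      by (intro nn_integral_eq_integral integrable_cube per cont AE_I2 nonneg)
    finally show ?thesis .
  qed
  have "(\<integral>\<^sup>+x. segment_mean h x \<partial>cubeM) =
     (\<integral>\<^sup>+y. \<integral>\<^sup>+x. \<integral>\<^sup>+t. ennreal (h (x + t *\<^sub>R y)) + ennreal (h (x + (1 - t) *\<^sub>R y)) \<partial>unitM \<partial>cubeM \<partial>hboxM (1/4))"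
    unfolding segment_mean_def by (rule P.Fubini') measurable
  also have "\<dots> = (\<integral>\<^sup>+y. \<integral>\<^sup>+t. \<integral>\<^sup>+x. ennreal (h (x + t *\<^sub>R y)) + ennreal (h (x + (1 - t) *\<^sub>R y)) \<partial>cubeM \<partial>unitM \<partial>hboxM (1/4))"
    by (intro nn_integral_cong Q.Fubini') measurable
  finally have 1: "(\<integral>\<^sup>+x. segment_mean h x \<partial>cubeM) = \<dots>" .
  have "(\<integral>\<^sup>+x. ennreal (h (x + t *\<^sub>R y)) + ennreal (h (x + (1 - t) *\<^sub>R y)) \<partial>cubeM) = 2 * ennreal (\<integral>x. h x \<partial>cubeM)" for t y
    by (subst nn_integral_add) (auto simp: tr mult_2)
  then show ?thesis unfolding 1 by (simp add: emeasure_unitM emeasure_hboxM mult_ac)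
qed

definition sm where "sm x = enn2real (segment_mean h x)"

lemma segment_mean_close:
  assumes e: "e \<ge> 0" and le: "\<And>z. h (x + z) \<le> h (x' + z) + e"
  shows "segment_mean h x \<le> segment_mean h x' + ennreal (2 * e * measure lborel (hbox (1/4) :: (real^'n) set))"
proof -
  have "segment_mean h x \<le> (\<integral>\<^sup>+y. \<integral>\<^sup>+t. (ennreal (h (x' + t *\<^sub>R y)) + ennreal (h (x' + (1 - t) *\<^sub>R y))) + ennreal (2 * e) \<partial>unitM \<partial>hboxM (1/4))"
    unfolding segment_mean_def
  proof (intro nn_integral_mono)
    fix y and t :: real
    have "ennreal (h (x + t *\<^sub>R y)) + ennreal (h (x + (1 - t) *\<^sub>R y)) = ennreal (h (x + t *\<^sub>R y) + h (x + (1 - t) *\<^sub>R y))"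
      using nonneg by simp
    also have "\<dots> \<le> ennreal ((h (x' + t *\<^sub>R y) + h (x' + (1 - t) *\<^sub>R y)) + 2 * e)"
      using le[of "t *\<^sub>R y"] le[of "(1 - t) *\<^sub>R y"] by (intro ennreal_leI) simp
    also have "\<dots> = ennreal (h (x' + t *\<^sub>R y)) + ennreal (h (x' + (1 - t) *\<^sub>R y)) + ennreal (2 * e)"
      using nonneg e by (simp add: add_nonneg_nonneg)
    finally show "ennreal (h (x + t *\<^sub>R y)) + ennreal (h (x + (1 - t) *\<^sub>R y))
        \<le> ennreal (h (x' + t *\<^sub>R y)) + ennreal (h (x' + (1 - t) *\<^sub>R y)) + ennreal (2 * e)" .
  qed
  also have "\<dots> = segment_mean h x' + ennreal (2 * e) * emeasure lborel (hbox (1/4) :: (real^'n) set)"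
    unfolding segment_mean_def
    by (subst nn_integral_add, simp_all add: emeasure_unitM, subst nn_integral_add)
       (simp_all add: emeasure_hboxM)
  also have "ennreal (2 * e) * emeasure lborel (hbox (1/4) :: (real^'n) set) = ennreal (2 * e * measure lborel (hbox (1/4) :: (real^'n) set))"
    using e by (simp add: emeasure_hbox ennreal_mult)
  finally show ?thesis .
qed

lemma segment_mean_sm: "segment_mean h x = ennreal (sm x)"
proof -
  obtain M where M: "M > 0" "\<And>x. \<bar>h x\<bar> \<le> M" using periodic_bounded[OF per cont] by blast
  have "segment_mean h x \<le> (\<integral>\<^sup>+y. \<integral>\<^sup>+t. ennreal (2 * M) \<partial>unitM \<partial>(hboxM (1/4) :: (real^'n) measure))"
    unfolding segment_mean_def
  proof (intro nn_integral_mono)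
    fix y and t :: real
    have "ennreal (h (x + t *\<^sub>R y)) + ennreal (h (x + (1 - t) *\<^sub>R y)) = ennreal (h (x + t *\<^sub>R y) + h (x + (1 - t) *\<^sub>R y))"
      using nonneg by simp
    also have "\<dots> \<le> ennreal (2 * M)"
      using M(2)[of "x + t *\<^sub>R y"] M(2)[of "x + (1 - t) *\<^sub>R y"] by (intro ennreal_leI) (auto simp: abs_le_iff)
    finally show "ennreal (h (x + t *\<^sub>R y)) + ennreal (h (x + (1 - t) *\<^sub>R y)) \<le> ennreal (2 * M)" .
  qed
  also have "\<dots> = ennreal (2 * M) * emeasure lborel (hbox (1/4) :: (real^'n) set)"
    by (simp add: emeasure_unitM emeasure_hboxM)
  also have "\<dots> < top" by (simp add: emeasure_hbox ennreal_mult_less_top)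
  finally show ?thesis by (simp add: sm_def)
qed

lemma sm_nonneg: "sm x \<ge> 0"
  by (simp add: sm_def)

lemma continuous_sm: "continuous_on UNIV sm"
proof -
  define v where "v = measure lborel (hbox (1/4) :: (real^'n) set)"
  have v: "v \<ge> 0" by (simp add: v_def)
  have "\<exists>d>0. \<forall>x'. dist x' x < d \<longrightarrow> dist (sm x') (sm x) \<le> e" if e: "e > 0" for x e
  proof -
    define e' where "e' = e / (2 * (v + 1))"
    have e': "e' > 0" "2 * e' * v \<le> e" using e v by (simp_all add: e'_def field_simps)
    obtain d where d: "d > 0" "\<And>x y. y \<in> hbox d \<Longrightarrow> \<bar>h (x + y) - h x\<bar> \<le> e'"
      by (rule periodic_uniformly_continuous[OF per cont e'(1)]) blast
    have "dist (sm x') (sm x) \<le> e" if "dist x' x < d" for x'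
    proof -
      have "\<bar>(x' - x) $ i\<bar> \<le> d" for i
        using component_le_norm_cart[of "x' - x" i] that by (simp add: dist_norm)
      then have a: "\<bar>h (x' + z) - h (x + z)\<bar> \<le> e'" for z
        using d(2)[of "x' - x" "x + z"] by (simp add: mem_hbox algebra_simps)
      have "h (x' + z) \<le> h (x + z) + e'" "h (x + z) \<le> h (x' + z) + e'" for z
        using a[of z] by linarith+
      then have "ennreal (sm x') \<le> ennreal (sm x) + ennreal (2 * e' * v)" "ennreal (sm x) \<le> ennreal (sm x') + ennreal (2 * e' * v)"
        unfolding segment_mean_sm[symmetric] v_def using e'(1) by (intro segment_mean_close; simp)+
      then have "sm x' \<le> sm x + 2 * e' * v" "sm x \<le> sm x' + 2 * e' * v"
        using e'(1) v sm_nonneg by (simp_all flip: ennreal_plus)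
      then show ?thesis using e'(2) by (simp add: dist_real_def abs_le_iff)
    qed
    then show ?thesis using d(1) by blast
  qed
  then show ?thesis
    unfolding continuous_on_iff by (metis (no_types, opaque_lifting) field_lbound_gt_zero half_gt_zero le_less_trans less_numeral_extra(1) UNIV_I field_sum_of_halves less_add_same_cancel1)
qed

end

text \<open>
  For every \<open>y\<close> in the box, the endpoints of \<open>\<gamma>\<close> are joined by the segment from \<open>\<gamma> 0\<close> to \<open>\<gamma> 0 + y\<close>, the
  translate \<open>\<gamma> + y\<close>, and the segment from \<open>\<gamma> 1 + y\<close> to \<open>\<gamma> 1\<close>.  The resulting bound on the distance is
  integrated over \<open>y\<close>.  The excess \<open>h\<close> along the translated curve contributes at most the length of \<open>\<gamma>\<close>
  times the integral of \<open>h\<close> over a period, and the segments contribute the two segment means.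
\<close>

lemma distance_average_bound:
  fixes g0 gt gh :: "'n::finite tensor2" and \<phi> h :: "real^'n \<Rightarrow> real"
  assumes g0: "cont_tensor g0" and gh: "cont_tensor gh"
    and \<phi>: "\<And>x. \<phi> x \<ge> 0" "\<And>x. \<phi> x \<le> c + h x" and c: "c \<ge> 0"
    and h: "segment_average h"
    and conf: "\<And>x v. speed gh x v = \<phi> x * speed gt x v"
    and near: "\<And>x y v. y \<in> hbox \<rho> \<Longrightarrow> speed gt (x + y) v \<le> (1 + \<eta>) * speed g0 x v" and \<eta>: "\<eta> \<ge> 0"
    and L: "\<And>x v. speed gt x v \<le> L * norm v" "L \<ge> 0"
    and g0_nonneg: "\<And>x v. speed g0 x v \<ge> 0"
    and \<rho>: "0 < \<rho>" "\<rho> \<le> 1/4" and \<gamma>: "valid_path \<gamma>"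
  shows "ennreal (measure lborel (hbox \<rho> :: (real^'n) set)) * edist gh (torus_proj (\<gamma> 0)) (torus_proj (\<gamma> 1))
    \<le> ennreal (measure lborel (hbox \<rho> :: (real^'n) set)) * (ennreal (2 * (L * (real CARD('n) * \<rho>)) * c) + ennreal ((1 + \<eta>) * c) * curve_length g0 \<gamma>)
      + ennreal (L * (real CARD('n) * \<rho>)) * (segment_mean h (\<gamma> 0) + segment_mean h (\<gamma> 1))
      + ennreal (1 + \<eta>) * (curve_length g0 \<gamma> * ennreal (\<integral>x. h x \<partial>cubeM))"
proof -
  interpret h: segment_average h by (rule h)
  define \<mu> where "\<mu> = L * (real CARD('n) * \<rho>)"
  have mu: "\<mu> \<ge> 0" using L \<rho> by (simp add: \<mu>_def)
  interpret B: finite_measure "hboxM \<rho> :: (real^'n) measure" by (rule finite_measure_hboxM)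
  interpret P: pair_sigma_finite "hboxM \<rho> :: (real^'n) measure" "lborel :: real measure" ..
  let ?E = "edist gh (torus_proj (\<gamma> 0)) (torus_proj (\<gamma> 1))"
  obtain \<gamma>' D S where v: "continuous_on UNIV \<gamma>'" "\<forall>t\<in>{0..1}. \<gamma>' t = \<gamma> t" "D \<in> borel_measurable borel" "finite S"
    "\<forall>t\<in>{0<..<1} - S. (\<gamma> has_vector_derivative D t) (at t)" "\<forall>t. t \<notin> {0..1} \<longrightarrow> D t = 0"
    "\<forall>g z. curve_length g (\<lambda>t. \<gamma> t + z) = (\<integral>\<^sup>+t. ennreal (speed g (\<gamma>' t + z) (D t)) \<partial>lborel)"
    by (rule curve_velocity[OF \<gamma>])
  have [measurable]: "\<gamma>' \<in> borel_measurable borel" "D \<in> borel_measurable borel"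
    by (simp_all add: v borel_measurable_continuous_onI)
  define s where "s t = speed g0 (\<gamma>' t) (D t)" for t
  have [measurable]: "s \<in> borel_measurable borel" unfolding s_def [abs_def] by (rule measurable_speed[OF g0]) measurable
  have s0: "s t \<ge> 0" for t unfolding s_def by (rule g0_nonneg)
  have len: "curve_length g0 \<gamma> = (\<integral>\<^sup>+t. ennreal (s t) \<partial>lborel)"
    using v(7)[rule_format, of g0 0] by (simp add: s_def)
  define X where "X x y = (\<integral>\<^sup>+t. ennreal (h (x + t *\<^sub>R y)) + ennreal (h (x + (1 - t) *\<^sub>R y)) \<partial>unitM)" for x y
  define Y where "Y y = (\<integral>\<^sup>+t. ennreal (s t) * ennreal (h (\<gamma>' t + y)) \<partial>lborel)" for y
  have [measurable]: "X x \<in> borel_measurable borel" for x unfolding X_def [abs_def] by measurable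
  have [measurable]: "Y \<in> borel_measurable borel" unfolding Y_def [abs_def] by measurable
  \<comment> \<open>The map \<open>\<tau>\<close> covers both orientations of the segment.\<close>
  have seg: "(\<integral>\<^sup>+t. ennreal (speed gh (x + \<tau> t *\<^sub>R y) z) * indicator {0..1} t \<partial>lborel) \<le> ennreal (\<mu> * c) + ennreal \<mu> * X x y"
    if y: "y \<in> hbox \<rho>" and z: "norm z = norm y" and \<tau>: "\<tau> = (\<lambda>t. t) \<or> \<tau> = (\<lambda>t. 1 - t)" for x y z \<tau>
  proof -
    have [measurable]: "\<tau> \<in> borel_measurable borel" using \<tau> by auto
    have "speed gh (x + \<tau> t *\<^sub>R y) z \<le> \<mu> * (c + h (x + \<tau> t *\<^sub>R y))" for t
    proof -
      have "speed gt (x + \<tau> t *\<^sub>R y) z \<le> L * norm z" by (rule L)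
      also have "\<dots> \<le> \<mu>" unfolding \<mu>_def z by (intro mult_left_mono norm_hbox[OF y] L(2))
      finally have 1: "speed gt (x + \<tau> t *\<^sub>R y) z \<le> \<mu>" .
      have "speed gh (x + \<tau> t *\<^sub>R y) z \<le> \<phi> (x + \<tau> t *\<^sub>R y) * \<mu>"
        unfolding conf by (intro mult_left_mono 1 \<phi>(1))
      also have "\<dots> \<le> (c + h (x + \<tau> t *\<^sub>R y)) * \<mu>" by (intro mult_right_mono \<phi>(2) mu)
      finally show ?thesis by (simp add: mult.commute)
    qed
    then have "ennreal (speed gh (x + \<tau> t *\<^sub>R y) z) \<le> ennreal (\<mu> * c) + ennreal \<mu> * ennreal (h (x + \<tau> t *\<^sub>R y))" for t
    proof -
      assume *: "\<And>t. speed gh (x + \<tau> t *\<^sub>R y) z \<le> \<mu> * (c + h (x + \<tau> t *\<^sub>R y))"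
      have "ennreal (speed gh (x + \<tau> t *\<^sub>R y) z) \<le> ennreal (\<mu> * c + \<mu> * h (x + \<tau> t *\<^sub>R y))"
        using *[of t] by (intro ennreal_leI) (simp add: distrib_left)
      then show ?thesis using mu c h.nonneg by (simp add: ennreal_mult)
    qed
    then have "(\<integral>\<^sup>+t. ennreal (speed gh (x + \<tau> t *\<^sub>R y) z) * indicator {0..1} t \<partial>lborel)
       \<le> (\<integral>\<^sup>+t. (ennreal (\<mu> * c) + ennreal \<mu> * ennreal (h (x + \<tau> t *\<^sub>R y))) * indicator {0..1} t \<partial>lborel)"
      by (intro nn_integral_mono mult_right_mono) auto
    also have "\<dots> = (\<integral>\<^sup>+t. ennreal (\<mu> * c) + ennreal \<mu> * ennreal (h (x + \<tau> t *\<^sub>R y)) \<partial>unitM)"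
      by (subst nn_integral_density) (auto simp: mult.commute)
    also have "\<dots> = ennreal (\<mu> * c) + ennreal \<mu> * (\<integral>\<^sup>+t. ennreal (h (x + \<tau> t *\<^sub>R y)) \<partial>unitM)"
      by (subst nn_integral_add) (auto simp: nn_integral_cmult emeasure_unitM)
    also have "(\<integral>\<^sup>+t. ennreal (h (x + \<tau> t *\<^sub>R y)) \<partial>unitM) \<le> X x y"
      unfolding X_def by (rule nn_integral_mono) (use \<tau> in \<open>auto simp: add_increasing add_increasing2\<close>)
    finally show ?thesis by (simp add: add_left_mono mult_left_mono)
  qed
  have mid: "curve_length gh (\<lambda>t. \<gamma> t + y) \<le> ennreal ((1 + \<eta>) * c) * curve_length g0 \<gamma> + ennreal (1 + \<eta>) * Y y"
    if y: "y \<in> hbox \<rho>" for y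
  proof -
    have "curve_length gh (\<lambda>t. \<gamma> t + y) = (\<integral>\<^sup>+t. ennreal (speed gh (\<gamma>' t + y) (D t)) \<partial>lborel)"
      using v(7) by blast
    also have "\<dots> \<le> (\<integral>\<^sup>+t. ennreal ((1 + \<eta>) * c) * ennreal (s t) + ennreal (1 + \<eta>) * (ennreal (s t) * ennreal (h (\<gamma>' t + y))) \<partial>lborel)"
    proof (rule nn_integral_mono)
      fix t :: real
      have "speed gh (\<gamma>' t + y) (D t) \<le> \<phi> (\<gamma>' t + y) * ((1 + \<eta>) * s t)"
        unfolding conf s_def by (intro mult_left_mono near y \<phi>(1))
      also have "\<dots> \<le> (c + h (\<gamma>' t + y)) * ((1 + \<eta>) * s t)"
        using \<eta> s0 by (intro mult_right_mono \<phi>(2)) auto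
      finally have "ennreal (speed gh (\<gamma>' t + y) (D t)) \<le> ennreal (((1 + \<eta>) * c) * s t + (1 + \<eta>) * (s t * h (\<gamma>' t + y)))"
        by (intro ennreal_leI) (simp add: algebra_simps)
      also have "\<dots> = ennreal ((1 + \<eta>) * c) * ennreal (s t) + ennreal (1 + \<eta>) * (ennreal (s t) * ennreal (h (\<gamma>' t + y)))"
        using \<eta> c s0 h.nonneg by (simp add: ennreal_mult)
      finally show "ennreal (speed gh (\<gamma>' t + y) (D t)) \<le> ennreal ((1 + \<eta>) * c) * ennreal (s t) + ennreal (1 + \<eta>) * (ennreal (s t) * ennreal (h (\<gamma>' t + y)))" .
    qed
    also have "\<dots> = ennreal ((1 + \<eta>) * c) * curve_length g0 \<gamma> + ennreal (1 + \<eta>) * Y y"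
      unfolding len Y_def by (subst nn_integral_add) (auto simp: nn_integral_cmult)
    finally show ?thesis .
  qed
  define A where "A = ennreal (2 * \<mu> * c) + ennreal ((1 + \<eta>) * c) * curve_length g0 \<gamma>"
  have "?E \<le> A + ennreal \<mu> * (X (\<gamma> 0) y + X (\<gamma> 1) y) + ennreal (1 + \<eta>) * Y y" if y: "y \<in> hbox \<rho>" for y
  proof -
    let ?g1 = "linepath (\<gamma> 0) (\<gamma> 0 + y)" and ?g2 = "\<lambda>t. \<gamma> t + y" and ?g3 = "linepath (\<gamma> 1 + y) (\<gamma> 1)"
    have v2: "valid_path ?g2"
    proof -
      have "valid_path ((\<lambda>x. x + y) \<circ> \<gamma>)"
      proof -
        obtain S' where "continuous_on {0..1} \<gamma>" "finite S'" "\<gamma> C1_differentiable_on ({0..1} - S')"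
          using \<gamma> unfolding valid_path_def piecewise_C1_differentiable_on_def by blast
        then have "continuous_on {0..1} ?g2" "?g2 C1_differentiable_on ({0..1} - S')"
          by (auto intro!: continuous_intros derivative_intros)
        then show ?thesis using \<open>finite S'\<close> unfolding valid_path_def piecewise_C1_differentiable_on_def o_def by blast
      qed
      then show ?thesis by (simp add: o_def)
    qed
    have v23: "valid_path (?g2 +++ ?g3)"
      by (rule valid_path_join[OF v2 valid_path_linepath]) (simp add: pathfinish_def pathstart_def linepath_0')
    have v123: "valid_path (?g1 +++ (?g2 +++ ?g3))"
      by (rule valid_path_join[OF valid_path_linepath v23]) (simp add: pathfinish_def pathstart_def joinpaths_def linepath_1')
    have "?E \<le> curve_length gh (?g1 +++ (?g2 +++ ?g3))"
      by (rule edist_le[OF v123]) (simp_all add: joinpaths_def linepath_0' linepath_1')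
    also have "\<dots> \<le> curve_length gh ?g1 + (curve_length gh ?g2 + curve_length gh ?g3)"
      by (intro order_trans[OF curve_length_join[OF gh]] add_left_mono curve_length_join gh valid_path_linepath v2 v23)
    also have "\<dots> \<le> (ennreal (\<mu> * c) + ennreal \<mu> * X (\<gamma> 0) y) + ((ennreal ((1 + \<eta>) * c) * curve_length g0 \<gamma> + ennreal (1 + \<eta>) * Y y)
        + (ennreal (\<mu> * c) + ennreal \<mu> * X (\<gamma> 1) y))"
    proof (intro add_mono mid y)
      show "curve_length gh ?g1 \<le> ennreal (\<mu> * c) + ennreal \<mu> * X (\<gamma> 0) y"
        using seg[OF y, of y "\<lambda>t. t" "\<gamma> 0"] by (simp add: curve_length_linepath)
      have e: "\<gamma> 1 + y + t *\<^sub>R (\<gamma> 1 - (\<gamma> 1 + y)) = \<gamma> 1 + (1 - t) *\<^sub>R y" "\<gamma> 1 - (\<gamma> 1 + y) = - y" for t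
        by (simp_all add: algebra_simps)
      show "curve_length gh ?g3 \<le> ennreal (\<mu> * c) + ennreal \<mu> * X (\<gamma> 1) y"
        using seg[OF y, of "- y" "\<lambda>t. 1 - t" "\<gamma> 1"] unfolding curve_length_linepath e(1) unfolding e(2) by simp
    qed
    also have "\<dots> = A + ennreal \<mu> * (X (\<gamma> 0) y + X (\<gamma> 1) y) + ennreal (1 + \<eta>) * Y y"
    proof -
      have "ennreal (2 * \<mu> * c) = ennreal (\<mu> * c) + ennreal (\<mu> * c)"
        using mu c by (subst ennreal_plus[symmetric]) auto
      then show ?thesis by (simp add: A_def distrib_left add_ac)
    qed
    finally show ?thesis .
  qed
  then have "(\<integral>\<^sup>+y. ?E \<partial>(hboxM \<rho> :: (real^'n) measure)) \<le> (\<integral>\<^sup>+y. A + ennreal \<mu> * (X (\<gamma> 0) y + X (\<gamma> 1) y) + ennreal (1 + \<eta>) * Y y \<partial>hboxM \<rho>)"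
    by (intro nn_integral_mono_AE AE_hboxM)
  also have "\<dots> = A * emeasure lborel (hbox \<rho> :: (real^'n) set) + ennreal \<mu> * ((\<integral>\<^sup>+y. X (\<gamma> 0) y \<partial>hboxM \<rho>) + (\<integral>\<^sup>+y. X (\<gamma> 1) y \<partial>hboxM \<rho>))
      + ennreal (1 + \<eta>) * (\<integral>\<^sup>+y. Y y \<partial>hboxM \<rho>)"
    by (simp add: nn_integral_add nn_integral_cmult emeasure_hboxM)
  also have "\<dots> \<le> A * emeasure lborel (hbox \<rho> :: (real^'n) set) + ennreal \<mu> * (segment_mean h (\<gamma> 0) + segment_mean h (\<gamma> 1))
      + ennreal (1 + \<eta>) * (curve_length g0 \<gamma> * ennreal (\<integral>x. h x \<partial>cubeM))"
  proof (intro add_mono mult_left_mono order_refl)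
    have X: "(\<integral>\<^sup>+y. X x y \<partial>hboxM \<rho>) \<le> segment_mean h x" for x
    proof -
      have "(\<integral>\<^sup>+y. X x y \<partial>hboxM \<rho>) = (\<integral>\<^sup>+y. indicator (hbox \<rho>) y * X x y \<partial>lborel)" by (simp add: nn_integral_density)
      also have "\<dots> \<le> (\<integral>\<^sup>+y. indicator (hbox (1/4)) y * X x y \<partial>lborel)"
      proof (intro nn_integral_mono mult_right_mono)
        fix y :: "real^'n"
        have "y \<in> hbox (1/4)" if "y \<in> hbox \<rho>" using that \<rho>(2) unfolding mem_hbox by (meson order_trans)
        then show "(indicator (hbox \<rho>) y :: ennreal) \<le> indicator (hbox (1/4)) y" by (auto simp: indicator_def)
      qed simp
      also have "\<dots> = segment_mean h x" by (simp add: nn_integral_density segment_mean_def X_def[symmetric])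
      finally show ?thesis .
    qed
    show "(\<integral>\<^sup>+y. X (\<gamma> 0) y \<partial>hboxM \<rho>) \<le> segment_mean h (\<gamma> 0)" "(\<integral>\<^sup>+y. X (\<gamma> 1) y \<partial>hboxM \<rho>) \<le> segment_mean h (\<gamma> 1)"
      by (rule X)+
    have "(\<integral>\<^sup>+y. Y y \<partial>hboxM \<rho>) = (\<integral>\<^sup>+t. \<integral>\<^sup>+y. ennreal (s t) * ennreal (h (\<gamma>' t + y)) \<partial>hboxM \<rho> \<partial>lborel)"
      unfolding Y_def by (rule P.Fubini'[symmetric]) measurable
    also have "\<dots> = (\<integral>\<^sup>+t. ennreal (s t) * (\<integral>\<^sup>+y. ennreal (h (\<gamma>' t + y)) \<partial>hboxM \<rho>) \<partial>lborel)"
      by (simp add: nn_integral_cmult)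
    also have "\<dots> \<le> (\<integral>\<^sup>+t. ennreal (s t) * ennreal (\<integral>x. h x \<partial>cubeM) \<partial>lborel)"
    proof (intro nn_integral_mono mult_left_mono)
      fix t :: real
      have "(\<integral>\<^sup>+y. ennreal (h (\<gamma>' t + y)) \<partial>hboxM \<rho>) = (\<integral>\<^sup>+y. indicator (hbox \<rho>) y * ennreal (h (\<gamma>' t + 1 *\<^sub>R y)) \<partial>lborel)"
        by (simp add: nn_integral_density)
      also have "\<dots> \<le> ennreal ((1/1) ^ CARD('n) * (\<integral>x. h x \<partial>cubeM))"
        by (rule integral_periodic_small_box[OF h.per h.cont h.nonneg]) (use \<rho> in auto)
      finally show "(\<integral>\<^sup>+y. ennreal (h (\<gamma>' t + y)) \<partial>hboxM \<rho>) \<le> ennreal (\<integral>x. h x \<partial>cubeM)" by simp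
    qed auto
    also have "\<dots> = curve_length g0 \<gamma> * ennreal (\<integral>x. h x \<partial>cubeM)"
      unfolding len by (simp add: nn_integral_multc)
    finally show "(\<integral>\<^sup>+y. Y y \<partial>hboxM \<rho>) \<le> curve_length g0 \<gamma> * ennreal (\<integral>x. h x \<partial>cubeM)" .
  qed auto
  finally show ?thesis
    by (simp add: emeasure_hboxM emeasure_hbox A_def \<mu>_def mult_ac)
qed

section \<open>Riemannian metrics on the torus and their volume\<close>

lemma posdef_riemannian: "riemannian_metric g \<Longrightarrow> posdef (g p)"
  by (simp add: riemannian_metric_def posdef_def)

lemma Ck_riemannian: "riemannian_metric g \<Longrightarrow> Ck k (\<lambda>x. g (torus_proj x) $ i $ j)"
  unfolding riemannian_metric_def smooth_def C_k_iff_Ck by (simp add: o_def)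

lemma cont_tensor_riemannian: "riemannian_metric g \<Longrightarrow> cont_tensor g"
  unfolding cont_tensor_def using Ck_riemannian[of g 0] by simp

lemma periodic_tensor: "periodic (\<lambda>x. g (torus_proj x) $ i $ j)" for g :: "'n::finite tensor2"
  by (simp add: periodic_def)

lemma measurable_torus_proj [measurable]: "torus_proj \<in> (borel :: (real^'n::finite) measure) \<rightarrow>\<^sub>M borel"
  by (rule borel_measurable_continuous_onI[OF continuous_torus_proj])

definition dens :: "'n::finite tensor2 \<Rightarrow> real^'n \<Rightarrow> real" where
  "dens g x = sqrt (det (g (torus_proj x)))"

lemma dens_pos: "riemannian_metric g \<Longrightarrow> dens g x > 0"
  by (simp add: dens_def posdef_det_pos posdef_riemannian)

lemma dens_C1: "riemannian_metric g \<Longrightarrow> Ck 1 (dens g)"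
  unfolding dens_def by (rule volume_density(1)[OF Ck_riemannian posdef_riemannian])

lemma continuous_dens: "riemannian_metric g \<Longrightarrow> continuous_on UNIV (dens g)"
  by (rule Ck_imp_continuous[OF dens_C1])

lemma measurable_dens: "riemannian_metric g \<Longrightarrow> dens g \<in> borel_measurable borel"
  by (rule borel_measurable_continuous_onI[OF continuous_dens])

lemma periodic_dens: "periodic (dens g)"
  by (simp add: periodic_def dens_def)

lemma volume_measure_eq:
  fixes g :: "'n::finite tensor2"
  assumes g: "riemannian_metric g"
  shows "volume_measure g = distr (density cubeM (\<lambda>x. ennreal (dens g x))) borel torus_proj"
proof (rule measure_eqI)
  fix A :: "'n torus set" assume "A \<in> sets (volume_measure g)"
  then have [measurable]: "A \<in> sets borel" by (simp add: volume_measure_def)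
  note [measurable] = measurable_dens[OF g]
  have m: "torus_proj \<in> density (restrict_space lborel fundamental_cube) (\<lambda>x. ennreal (dens g x)) \<rightarrow>\<^sub>M borel"
    by (simp add: measurable_restrict_space1)
  let ?B = "torus_proj -` A \<inter> fundamental_cube :: (real^'n) set"
  have B: "?B \<in> sets borel"
    using measurable_sets[OF measurable_torus_proj, of A] by (intro sets.Int) auto
  have "emeasure (volume_measure g) A = emeasure (density (restrict_space lborel fundamental_cube) (\<lambda>x. ennreal (dens g x))) ?B"
    unfolding volume_measure_def dens_def[symmetric] by (subst emeasure_distr[OF m]) (auto simp: space_restrict_space)
  also have "\<dots> = (\<integral>\<^sup>+x. ennreal (dens g x) * indicator ?B x \<partial>restrict_space lborel fundamental_cube)"
    using B by (intro emeasure_density) (auto simp: measurable_restrict_space1 sets_restrict_space_iff)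
  also have "\<dots> = (\<integral>\<^sup>+x. ennreal (dens g x) * indicator ?B x * indicator fundamental_cube x \<partial>lborel)"
    by (subst nn_integral_restrict_space) auto
  also have "\<dots> = (\<integral>\<^sup>+x. indicator fundamental_cube x * (ennreal (dens g x) * indicator (torus_proj -` A) x) \<partial>lborel)"
    by (intro nn_integral_cong) (auto simp: indicator_def)
  also have "\<dots> = (\<integral>\<^sup>+x. ennreal (dens g x) * indicator (torus_proj -` A) x \<partial>cubeM)"
    using measurable_sets[OF measurable_torus_proj, of A] by (subst nn_integral_density) auto
  also have "\<dots> = emeasure (distr (density cubeM (\<lambda>x. ennreal (dens g x))) borel torus_proj) A"
    using measurable_sets[OF measurable_torus_proj, of A] by (subst emeasure_distr) (auto simp: emeasure_density)
  finally show "emeasure (volume_measure g) A = emeasure (distr (density cubeM (\<lambda>x. ennreal (dens g x))) borel torus_proj) A" .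
qed (simp add: volume_measure_def)

lemma emeasure_volume:
  fixes g :: "'n::finite tensor2"
  assumes g: "riemannian_metric g" and [measurable]: "A \<in> sets borel"
  shows "emeasure (volume_measure g) A = (\<integral>\<^sup>+x. ennreal (dens g x) * indicator A (torus_proj x) \<partial>cubeM)"
proof -
  note [measurable] = measurable_dens[OF g]
  have "emeasure (volume_measure g) A = emeasure (density cubeM (\<lambda>x. ennreal (dens g x))) (torus_proj -` A)"
    unfolding volume_measure_eq[OF g] by (subst emeasure_distr) auto
  also have "\<dots> = (\<integral>\<^sup>+x. ennreal (dens g x) * indicator (torus_proj -` A) x \<partial>cubeM)"
    using measurable_sets[OF measurable_torus_proj, of A] by (intro emeasure_density) auto
  finally show ?thesis by (simp add: indicator_def vimage_def)
qed

lemma integral_volume: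
  fixes g :: "'n::finite tensor2" and h :: "'n torus \<Rightarrow> real"
  assumes g: "riemannian_metric g" and h: "continuous_on UNIV h"
  shows "(\<integral>p. h p \<partial>volume_measure g) = (\<integral>x. dens g x * h (torus_proj x) \<partial>cubeM)"
proof -
  note [measurable] = measurable_dens[OF g] borel_measurable_continuous_onI[OF h]
  have "(\<integral>p. h p \<partial>volume_measure g) = (\<integral>x. h (torus_proj x) \<partial>density cubeM (\<lambda>x. ennreal (dens g x)))"
    unfolding volume_measure_eq[OF g] by (subst integral_distr) auto
  also have "\<dots> = (\<integral>x. dens g x * h (torus_proj x) \<partial>cubeM)"
    using dens_pos[OF g] by (subst integral_density) (auto intro: less_imp_le)
  finally show ?thesis .
qed

lemma riem_volume_eq: "riemannian_metric g \<Longrightarrow> riem_volume g = (\<integral>x. dens g x \<partial>cubeM)"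
  using integral_volume[of g "\<lambda>p. 1"]
  by (simp add: riem_volume_def volume_measure_def)

text \<open>Cutting a set by the coordinate slabs \<open>x\<^sub>i \<le> s\<close> realises every smaller volume.\<close>

lemma exists_subset_of_volume:
  fixes g :: "'n::finite tensor2"
  assumes g: "riemannian_metric g" and A: "A \<in> sets borel"
    and v: "0 < v" "v \<le> measure (volume_measure g) A"
  obtains U where "U \<subseteq> A" "U \<in> sets borel" "measure (volume_measure g) U = v"
proof -
  note [measurable] = measurable_dens[OF g] A
  obtain i :: 'n where True by blast
  obtain M where M: "M > 0" "\<And>x. \<bar>dens g x\<bar> \<le> M"
    using periodic_bounded[OF periodic_dens continuous_dens[OF g]] by blast
  define S where "S s = {p :: 'n torus. frac (rep_torus p $ i) \<le> s}" for s
  have S: "torus_proj x \<in> S s \<longleftrightarrow> frac (x $ i) \<le> s" for x s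
  proof -
    have "torus_proj (rep_torus (torus_proj x)) = torus_proj x" by simp
    then have "rep_torus (torus_proj x) $ i - x $ i \<in> \<int>" unfolding torus_proj_eq_iff by blast
    then obtain k where "rep_torus (torus_proj x) $ i = x $ i + of_int k"
      by (metis Ints_cases add_diff_cancel_left' diff_add_cancel add.commute)
    then have "frac (rep_torus (torus_proj x) $ i) = frac (x $ i)"
      by (simp add: frac_def)
    then show ?thesis by (simp add: S_def)
  qed
  have S_borel [measurable]: "S s \<in> sets borel" if "0 \<le> s" for s
  proof (cases "s < 1")
    case True
    have "torus_proj -` (- S s) = (\<Union>z::int. {x::real^'n. of_int z + s < x $ i} \<inter> {x. x $ i < of_int z + 1})"
    proof (intro set_eqI iffI)
      fix x :: "real^'n" assume "x \<in> torus_proj -` (- S s)"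
      then have "s < frac (x $ i)" using S by auto
      then have "of_int \<lfloor>x $ i\<rfloor> + s < x $ i" "x $ i < of_int \<lfloor>x $ i\<rfloor> + 1" by (auto simp: frac_def)
      then show "x \<in> (\<Union>z::int. {x::real^'n. of_int z + s < x $ i} \<inter> {x. x $ i < of_int z + 1})" by blast
    next
      fix x :: "real^'n" assume "x \<in> (\<Union>z::int. {x::real^'n. of_int z + s < x $ i} \<inter> {x. x $ i < of_int z + 1})"
      then obtain z :: int where z: "of_int z + s < x $ i" "x $ i < of_int z + 1" by blast
      then have "\<lfloor>x $ i\<rfloor> = z" using \<open>0 \<le> s\<close> by (intro floor_unique) auto
      then show "x \<in> torus_proj -` (- S s)" using z S by (auto simp: frac_def)
    qed
    moreover have "open (\<Union>z::int. {x::real^'n. of_int z + s < x $ i} \<inter> {x. x $ i < of_int z + 1})"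
      by (intro open_UN ballI open_Int open_Collect_less continuous_intros)
    ultimately have "open (- S s)" by (simp add: open_torus_def)
    then show ?thesis by (metis borel_closed closed_def)
  next
    case False
    then have "S s = UNIV" by (auto simp: S_def intro: order_trans[OF less_imp_le[OF frac_lt_1]])
    then show ?thesis by simp
  qed
  define m where "m s = measure (volume_measure g) (A \<inter> S s)" for s
  have fin: "emeasure (volume_measure g) B < top" if [measurable]: "B \<in> sets borel" for B
  proof -
    have "emeasure (volume_measure g) B \<le> (\<integral>\<^sup>+x. ennreal M \<partial>(cubeM :: (real^'n) measure))"
      unfolding emeasure_volume[OF g that]
      by (intro nn_integral_mono) (use M in \<open>auto simp: indicator_def abs_le_iff intro!: ennreal_leI\<close>)
    also have "\<dots> < top" by (simp add: emeasure_cubeM)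
    finally show ?thesis .
  qed
  have em: "emeasure (volume_measure g) (A \<inter> S s) = ennreal (m s)" if "0 \<le> s" for s
    unfolding m_def using fin[of "A \<inter> S s"] S_borel[OF that] A by (intro emeasure_eq_ennreal_measure) auto
  have slab: "m t \<le> m s + M * (t - s)" "m s \<le> m t" if st: "0 \<le> s" "s \<le> t" "t \<le> 1" for s t
  proof -
    note Sst [measurable] = S_borel[OF st(1)] S_borel[OF order_trans[OF st(1,2)]]
    define a b :: "real^'n" where "a = (\<chi> j. if j = i then s else 0)" and "b = (\<chi> j. if j = i then t else 1)"
    have ab: "measure lborel (cbox a b) = t - s"
    proof -
      have "cbox a b \<noteq> {}" using st by (auto simp: interval_ne_empty_cart a_def b_def)
      then have "measure lborel (cbox a b) = (\<Prod>j\<in>UNIV. b $ j - a $ j)" by (rule content_cbox_cart)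
      also have "\<dots> = (\<Prod>j\<in>UNIV. if j = i then t - s else 1)"
        by (intro prod.cong) (auto simp: a_def b_def)
      finally show ?thesis by simp
    qed
    have "emeasure (volume_measure g) (A \<inter> S t) \<le>
       (\<integral>\<^sup>+x. ennreal (dens g x) * indicator (A \<inter> S s) (torus_proj x) + ennreal M * indicator (cbox a b) x \<partial>cubeM)"
      unfolding emeasure_volume[OF g sets.Int[OF A Sst(2)]]
    proof (intro nn_integral_mono_AE AE_cubeM)
      fix x :: "real^'n" assume x: "x \<in> fundamental_cube"
      then have x01: "0 \<le> x $ j" "x $ j < 1" for j by (auto simp: fundamental_cube_def)
      then have fr: "frac (x $ i) = x $ i" by (simp add: frac_eq)
      consider "torus_proj x \<notin> A \<inter> S t" | "torus_proj x \<in> A \<inter> S s" | "torus_proj x \<in> A" "s < x $ i" "x $ i \<le> t"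
        using S fr by force
      then show "ennreal (dens g x) * indicator (A \<inter> S t) (torus_proj x) \<le>
          ennreal (dens g x) * indicator (A \<inter> S s) (torus_proj x) + ennreal M * indicator (cbox a b) x"
      proof cases
        case 2
        then have "torus_proj x \<in> A \<inter> S t" using S st(2) by auto
        then show ?thesis using 2 by (simp add: add_increasing2)
      next
        case 3
        then have "x \<in> cbox a b" using x01 by (auto simp: mem_box_cart a_def b_def less_imp_le)
        moreover have "ennreal (dens g x) \<le> ennreal M" using M(2)[of x] by (intro ennreal_leI) (simp add: abs_le_iff)
        ultimately show ?thesis using 3 by (auto simp: indicator_def intro: add_increasing)
      qed simp
    qed
    also have "\<dots> = emeasure (volume_measure g) (A \<inter> S s) + ennreal M * emeasure cubeM (cbox a b)"
      unfolding emeasure_volume[OF g sets.Int[OF A Sst(1)]]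
      by (subst nn_integral_add) (auto simp: nn_integral_cmult measurable_If_set)
    also have "emeasure cubeM (cbox a b) \<le> emeasure lborel (cbox a b)"
      by (simp add: emeasure_density) (auto intro!: nn_integral_mono simp: indicator_def simp flip: nn_integral_indicator)
    also have "emeasure lborel (cbox a b) = ennreal (t - s)"
      using ab emeasure_eq_ennreal_measure[of lborel "cbox a b"] emeasure_lborel_cbox_finite[of a b] by simp
    finally have "ennreal (m t) \<le> ennreal (m s) + ennreal M * ennreal (t - s)"
      using st em[of s] em[of t] by (simp add: add_left_mono mult_left_mono)
    also have "\<dots> = ennreal (m s + M * (t - s))"
      using M st by (simp add: ennreal_mult m_def)
    finally show "m t \<le> m s + M * (t - s)"
      using M st by (subst (asm) ennreal_le_iff) (auto simp: m_def)
    have "emeasure (volume_measure g) (A \<inter> S s) \<le> emeasure (volume_measure g) (A \<inter> S t)"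
    proof (rule emeasure_mono)
      show "A \<inter> S s \<subseteq> A \<inter> S t" using st by (auto simp: S_def)
      show "A \<inter> S t \<in> sets (volume_measure g)" using A Sst(2) by (simp add: volume_measure_def)
    qed
    then have "ennreal (m s) \<le> ennreal (m t)"
      using em[of s] em[of t] st by simp
    then show "m s \<le> m t" by (simp add: m_def)
  qed
  have cont: "continuous_on {0..1} m"
  proof (rule lipschitz_on_continuous_on[OF lipschitz_onI])
    fix x y :: real assume xy: "x \<in> {0..1}" "y \<in> {0..1}"
    show "dist (m x) (m y) \<le> M * dist x y"
    proof (cases "x \<le> y")
      case True
      then show ?thesis using slab[of x y] xy by (simp add: dist_real_def abs_le_iff)
    next
      case False
      then show ?thesis using slab[of y x] xy by (simp add: dist_real_def abs_le_iff)
    qed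
  qed (use M in simp)
  have m1: "m 1 = measure (volume_measure g) A"
  proof -
    have "S 1 = UNIV" by (auto simp: S_def intro: less_imp_le frac_lt_1)
    then show ?thesis by (simp add: m_def)
  qed
  have m0: "m 0 \<le> 0"
  proof -
    have "emeasure (volume_measure g) (A \<inter> S 0) = 0"
    proof -
      have null: "{x :: real^'n. x $ i = 0} \<in> null_sets lborel"
      proof -
        have "{x :: real^'n. x $ i = 0} = {x. axis i 1 \<bullet> x = 0}" by (simp add: inner_axis' )
        then have "negligible {x :: real^'n. x $ i = 0}" using negligible_hyperplane[of "axis i 1 :: real^'n" 0] by (simp add: axis_eq_0_iff)
        moreover have "closed {x :: real^'n. x $ i = 0}" by (intro closed_Collect_eq continuous_intros)
        ultimately show ?thesis by (simp add: negligible_iff_null_sets null_sets_completion_iff borel_closed)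
      qed
      have "AE x in lborel. x \<notin> {x :: real^'n. x $ i = 0}" by (rule AE_not_in[OF null])
      then have "AE x in cubeM. ennreal (dens g x) * indicator (A \<inter> S 0) (torus_proj x) = 0"
      proof (subst AE_density, simp, eventually_elim)
        case (elim x)
        then show ?case
          using S[of x 0] by (auto simp: indicator_def fundamental_cube_def frac_eq) (metis order_antisym)
      qed
      then show ?thesis unfolding emeasure_volume[OF g sets.Int[OF A S_borel[OF order_refl]]]
        by (subst nn_integral_0_iff_AE) auto
    qed
    then show ?thesis by (simp add: m_def measure_def)
  qed
  obtain s where s: "0 \<le> s" "s \<le> 1" "m s = v"
    using IVT'[of m 0 v 1] cont m0 m1 v by auto
  show thesis
    by (rule that[of "A \<inter> S s"]) (use s S_borel A in \<open>auto simp: m_def\<close>)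
qed

section \<open>Uniformly elliptic metrics\<close>

lemma sum_abs_squared_le: "(\<Sum>i\<in>UNIV. \<bar>v $ i\<bar>)\<^sup>2 \<le> real CARD('n) * (v \<bullet> v)" for v :: "real^'n::finite"
  using Cauchy_Schwarz_ineq_sum[of "\<lambda>i. 1" "\<lambda>i. \<bar>v $ i\<bar>" UNIV]
  by (simp add: inner_vec_def power2_eq_square)

lemma quadratic_form_close:
  fixes A B :: "real^'n::finite^'n"
  assumes "\<And>i j. \<bar>A $ i $ j - B $ i $ j\<bar> \<le> \<tau>"
  shows "\<bar>v \<bullet> (A *v v) - v \<bullet> (B *v v)\<bar> \<le> \<tau> * real CARD('n) * (v \<bullet> v)"
proof -
  have t: "\<tau> \<ge> 0" using order_trans[OF abs_ge_zero assms] .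
  have "v \<bullet> (A *v v) - v \<bullet> (B *v v) = (\<Sum>i\<in>UNIV. \<Sum>j\<in>UNIV. (A $ i $ j - B $ i $ j) * v $ i * v $ j)"
    unfolding inner_mult_vec by (simp add: sum_subtractf algebra_simps)
  also have "\<bar>\<dots>\<bar> \<le> (\<Sum>i\<in>UNIV. \<Sum>j\<in>UNIV. \<tau> * (\<bar>v $ i\<bar> * \<bar>v $ j\<bar>))"
    by (intro order_trans[OF sum_abs] sum_mono)
       (simp add: abs_mult mult.assoc, intro mult_right_mono assms mult_nonneg_nonneg abs_ge_zero)
  also have "\<dots> = \<tau> * (\<Sum>i\<in>UNIV. \<bar>v $ i\<bar>)\<^sup>2"
    unfolding power2_eq_square sum_product unfolding sum_distrib_left ..
  also have "\<dots> \<le> \<tau> * (real CARD('n) * (v \<bullet> v))" by (intro mult_left_mono sum_abs_squared_le t)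
  finally show ?thesis by (simp add: mult.assoc)
qed

lemma riemannian_uniformly_positive:
  fixes g :: "'n::finite tensor2"
  assumes g: "riemannian_metric g"
  obtains \<nu> where "\<nu> > 0" "\<And>x v. \<nu> * (v \<bullet> v) \<le> v \<bullet> (g (torus_proj x) *v v)"
proof -
  define q where "q = (\<lambda>(x, v). v \<bullet> (g (torus_proj x) *v v))"
  let ?K = "cbox 0 (One :: real^'n) \<times> sphere (0 :: real^'n) 1"
  have c: "continuous_on UNIV (\<lambda>x. g (torus_proj x) $ i $ j)" for i j
    using cont_tensor_riemannian[OF g] by (simp add: cont_tensor_def)
  have "continuous_on ?K q"
    unfolding q_def split_beta' inner_mult_vec
    by (intro continuous_intros continuous_on_compose2[OF c]) auto
  moreover have "compact ?K" by (intro compact_Times compact_cbox compact_sphere)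
  moreover have "?K \<noteq> {}"
  proof -
    have "(0, axis undefined 1) \<in> ?K" by (simp add: mem_box)
    then show ?thesis by blast
  qed
  ultimately obtain z where z: "z \<in> ?K" "\<And>y. y \<in> ?K \<Longrightarrow> q z \<le> q y"
    using continuous_attains_inf[of ?K q] by blast
  have pos: "q z > 0"
  proof -
    have "snd z \<noteq> 0" using z(1) by (auto simp: mem_Times_iff)
    then show ?thesis using posdef_riemannian[OF g] by (simp add: q_def split_beta' posdef_def)
  qed
  have "q z * (v \<bullet> v) \<le> v \<bullet> (g (torus_proj x) *v v)" for x v
  proof (cases "v = 0")
    case False
    obtain x' where x': "x' \<in> fundamental_cube" "torus_proj x' = torus_proj x"
      by (rule exists_cube_representative)
    define u where "u = (1 / norm v) *\<^sub>R v"
    have u: "norm u = 1" "v = norm v *\<^sub>R u" using False by (simp_all add: u_def)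
    have "(x', u) \<in> ?K" using x'(1) cube_subset_cbox u by auto
    then have "q z \<le> q (x', u)" by (rule z(2))
    then have "(norm v)\<^sup>2 * q z \<le> (norm v)\<^sup>2 * (u \<bullet> (g (torus_proj x) *v u))"
      by (intro mult_left_mono) (auto simp: q_def x')
    also have "\<dots> = (norm v *\<^sub>R u) \<bullet> (g (torus_proj x) *v (norm v *\<^sub>R u))"
      by (simp add: matrix_vector_mult_scaleR power2_eq_square)
    finally show ?thesis unfolding u(2)[symmetric] by (simp add: power2_norm_eq_inner mult.commute)
  qed simp
  with pos that show thesis by blast
qed

locale elliptic_matrix =
  fixes A :: "real^'n::finite^'n" and \<nu> \<Lambda> :: real
  assumes posdef: "posdef A" and nu: "\<nu> > 0" and lower: "\<And>v. \<nu> * (v \<bullet> v) \<le> v \<bullet> (A *v v)"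
    and upper: "\<And>i j. \<bar>A $ i $ j\<bar> \<le> \<Lambda>"
begin

lemma Lam_nonneg: "\<Lambda> \<ge> 0"
  by (rule order_trans[OF abs_ge_zero upper])

lemma inverse_upper: "\<bar>matrix_inv A $ i $ j\<bar> \<le> 1 / \<nu>"
proof -
  define v where "v = matrix_inv A *v axis j 1"
  have Av: "A *v v = axis j 1"
    by (simp add: v_def matrix_vector_mul_assoc matrix_inv_right posdef_invertible posdef)
  have v: "v $ i = matrix_inv A $ i $ j" for i
    by (simp add: v_def matrix_vector_mult_basis column_def)
  have "\<nu> * (norm v)\<^sup>2 \<le> v $ j"
    using lower[of v] Av by (simp add: power2_norm_eq_inner inner_axis)
  also have "\<dots> \<le> norm v" using component_le_norm_cart[of v j] by simp
  finally have "norm v \<le> 1 / \<nu>"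
    using nu by (cases "norm v = 0") (auto simp: power2_eq_square field_simps)
  then show ?thesis using component_le_norm_cart[of v i] v by simp
qed

lemma inverse_lower: "\<nu> / ((real CARD('n))\<^sup>2 * \<Lambda>\<^sup>2) * (p \<bullet> p) \<le> (\<Sum>i\<in>UNIV. \<Sum>j\<in>UNIV. matrix_inv A $ i $ j * p $ i * p $ j)"
proof -
  define v where "v = matrix_inv A *v p"
  have Av: "A *v v = p"
    by (simp add: v_def matrix_vector_mul_assoc matrix_inv_right posdef_invertible posdef)
  have "p \<bullet> p = (\<Sum>i\<in>UNIV. (\<Sum>j\<in>UNIV. A $ i $ j * v $ j)\<^sup>2)"
    by (simp add: Av[symmetric] inner_vec_def matrix_vector_mult_def power2_eq_square)
  also have "\<dots> \<le> (\<Sum>i\<in>(UNIV::'n set). real CARD('n) * \<Lambda>\<^sup>2 * (v \<bullet> v))"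
  proof (rule sum_mono)
    fix i
    have "(\<Sum>j\<in>UNIV. A $ i $ j * v $ j)\<^sup>2 \<le> (\<Sum>j\<in>UNIV. (A $ i $ j)\<^sup>2) * (\<Sum>j\<in>UNIV. (v $ j)\<^sup>2)"
      by (rule Cauchy_Schwarz_ineq_sum)
    also have "\<dots> \<le> (\<Sum>j\<in>(UNIV::'n set). \<Lambda>\<^sup>2) * (v \<bullet> v)"
      using upper Lam_nonneg by (intro mult_mono sum_mono) (auto simp: inner_vec_def power2_eq_square abs_le_square_iff[symmetric] sum_nonneg simp flip: power2_eq_square)
    finally show "(\<Sum>j\<in>UNIV. A $ i $ j * v $ j)\<^sup>2 \<le> real CARD('n) * \<Lambda>\<^sup>2 * (v \<bullet> v)" by simp
  qed
  finally have "p \<bullet> p \<le> ((real CARD('n))\<^sup>2 * \<Lambda>\<^sup>2) * (v \<bullet> v)" by (simp add: power2_eq_square mult_ac)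
  moreover have "\<Lambda> > 0"
  proof -
    obtain i :: 'n where True by blast
    have "A $ i $ i = axis i 1 \<bullet> (A *v axis i 1)" by (simp add: matrix_vector_mult_basis column_def inner_axis')
    also have "\<dots> > 0" using posdef by (auto simp: posdef_def axis_eq_0_iff)
    finally show ?thesis using upper[of i i] by simp
  qed
  ultimately have "\<nu> / ((real CARD('n))\<^sup>2 * \<Lambda>\<^sup>2) * (p \<bullet> p) \<le> \<nu> * (v \<bullet> v)"
    using nu by (simp add: field_simps)
  also have "\<dots> \<le> v \<bullet> p" using lower[of v] Av by simp
  also have "\<dots> = p \<bullet> (matrix_inv A *v p)" by (simp add: v_def inner_commute)
  finally show ?thesis by (simp add: inner_mult_vec)
qed

lemma abs_det_le: "\<bar>det B\<bar> \<le> fact CARD('n) * b ^ CARD('n)"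
  if "\<And>i j. \<bar>B $ i $ j\<bar> \<le> b" for B :: "real^'n^'n"
proof -
  have "\<bar>det B\<bar> \<le> (\<Sum>p | p permutes (UNIV :: 'n set). \<bar>of_int (sign p) * (\<Prod>i\<in>UNIV. B $ i $ p i)\<bar>)"
    unfolding det_def by (rule sum_abs)
  also have "\<dots> \<le> (\<Sum>p | p permutes (UNIV :: 'n set). b ^ CARD('n))"
  proof (rule sum_mono)
    fix p :: "'n \<Rightarrow> 'n"
    have "\<bar>\<Prod>i\<in>UNIV. B $ i $ p i\<bar> \<le> (\<Prod>i\<in>(UNIV::'n set). b)"
      unfolding abs_prod by (rule prod_mono) (use that in auto)
    then show "\<bar>of_int (sign p) * (\<Prod>i\<in>UNIV. B $ i $ p i)\<bar> \<le> b ^ CARD('n)"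
      by (simp add: abs_mult sign_def)
  qed
  also have "\<dots> = fact CARD('n) * b ^ CARD('n)"
    by (simp add: card_permutations)
  finally show ?thesis .
qed

lemma det_bounds: "det A \<le> fact CARD('n) * \<Lambda> ^ CARD('n)" "1 / (fact CARD('n) * (1 / \<nu>) ^ CARD('n)) \<le> det A"
proof -
  show "det A \<le> fact CARD('n) * \<Lambda> ^ CARD('n)" using abs_det_le[of A \<Lambda>] upper by simp
  have pos: "det A > 0" by (rule posdef_det_pos[OF posdef])
  have "det A * det (matrix_inv A) = 1"
    by (simp add: det_mul[symmetric] matrix_inv_right posdef_invertible posdef)
  moreover have "det (matrix_inv A) \<le> fact CARD('n) * (1 / \<nu>) ^ CARD('n)"
    using abs_det_le[of "matrix_inv A" "1 / \<nu>"] inverse_upper by simp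
  ultimately have "1 \<le> det A * (fact CARD('n) * (1 / \<nu>) ^ CARD('n))"
    using pos by (metis mult_left_mono less_imp_le)
  then show "1 / (fact CARD('n) * (1 / \<nu>) ^ CARD('n)) \<le> det A"
    using nu by (subst pos_divide_le_eq) auto
qed

end

text \<open>Bounds that hold with the same constants along the whole sequence of background metrics.\<close>

definition uniformly_elliptic :: "'n::finite tensor2 \<Rightarrow> real \<Rightarrow> real \<Rightarrow> real \<Rightarrow> bool" where
  "uniformly_elliptic g \<nu> \<Lambda> \<Lambda>1 \<longleftrightarrow> riemannian_metric g \<and> \<nu> > 0 \<and>
     (\<forall>x v. \<nu> * (v \<bullet> v) \<le> v \<bullet> (g (torus_proj x) *v v)) \<and>
     (\<forall>x i j. \<bar>g (torus_proj x) $ i $ j\<bar> \<le> \<Lambda>) \<and>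
     (\<forall>x i j l. \<bar>pd l (\<lambda>x. g (torus_proj x) $ i $ j) x\<bar> \<le> \<Lambda>1)"

lemma elliptic_matrix_uniformly_elliptic:
  "uniformly_elliptic g \<nu> \<Lambda> \<Lambda>1 \<Longrightarrow> elliptic_matrix (g (torus_proj x)) \<nu> \<Lambda>"
  unfolding uniformly_elliptic_def by unfold_locales (auto intro: posdef_riemannian)

lemma C1_converges_close:
  fixes gt :: "nat \<Rightarrow> 'n::finite tensor2"
  assumes "C1_converges gt g0" and "\<tau> > 0"
  shows "\<forall>\<^sub>F j in sequentially. \<forall>i k l x. \<bar>gt j (torus_proj x) $ i $ k - g0 (torus_proj x) $ i $ k\<bar> \<le> \<tau> \<and>
      \<bar>pd l (\<lambda>x. gt j (torus_proj x) $ i $ k) x - pd l (\<lambda>x. g0 (torus_proj x) $ i $ k) x\<bar> \<le> \<tau>"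
proof (intro eventually_all_finite)
  fix i k l :: 'n
  have "\<forall>\<^sub>F j in sequentially. \<forall>p\<in>UNIV. dist (gt j p $ i $ k) (g0 p $ i $ k) < \<tau>"
    "\<forall>\<^sub>F j in sequentially. \<forall>p\<in>UNIV. dist (partial l (\<lambda>p. gt j p $ i $ k) p) (partial l (\<lambda>p. g0 p $ i $ k) p) < \<tau>"
    using assms unfolding C1_converges_def uniform_limit_iff by blast+
  then show "\<forall>\<^sub>F j in sequentially. \<forall>x. \<bar>gt j (torus_proj x) $ i $ k - g0 (torus_proj x) $ i $ k\<bar> \<le> \<tau> \<and>
      \<bar>pd l (\<lambda>x. gt j (torus_proj x) $ i $ k) x - pd l (\<lambda>x. g0 (torus_proj x) $ i $ k) x\<bar> \<le> \<tau>"
  proof eventually_elim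
    case (elim j)
    have "dist (partial l (\<lambda>p. gt j p $ i $ k) (torus_proj x)) (partial l (\<lambda>p. g0 p $ i $ k) (torus_proj x)) < \<tau>" for x
      using elim(2) by blast
    then show ?case using elim(1)
      by (auto simp: partial_torus_proj o_def dist_real_def less_imp_le)
  qed
qed

lemma C1_converges_uniformly_elliptic:
  fixes gt :: "nat \<Rightarrow> 'n::finite tensor2"
  assumes conv: "C1_converges gt g0" and g0: "riemannian_metric g0"
    and gt: "\<And>j. j \<ge> 1 \<Longrightarrow> riemannian_metric (gt j)"
  obtains \<nu> \<Lambda> \<Lambda>1 where "uniformly_elliptic g0 \<nu> \<Lambda> \<Lambda>1"
    "\<forall>\<^sub>F j in sequentially. uniformly_elliptic (gt j) \<nu> \<Lambda> \<Lambda>1"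
proof -
  obtain \<nu>0 where nu0: "\<nu>0 > 0" "\<And>x v. \<nu>0 * (v \<bullet> v) \<le> v \<bullet> (g0 (torus_proj x) *v v)"
    using riemannian_uniformly_positive[OF g0] by blast
  have "\<exists>M>0. \<forall>x. \<bar>g0 (torus_proj x) $ i $ k\<bar> \<le> M \<and> (\<forall>l. \<bar>pd l (\<lambda>x. g0 (torus_proj x) $ i $ k) x\<bar> \<le> M)" for i k
  proof -
    have C: "Ck 1 (\<lambda>x. g0 (torus_proj x) $ i $ k)" by (rule Ck_riemannian[OF g0])
    obtain M0 where M0: "M0 > 0" "\<And>x. \<bar>g0 (torus_proj x) $ i $ k\<bar> \<le> M0"
      using periodic_bounded[OF periodic_tensor Ck_imp_continuous[OF C]] by blast
    have "\<exists>M. \<forall>x. \<bar>pd l (\<lambda>x. g0 (torus_proj x) $ i $ k) x\<bar> \<le> M" for l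
    proof -
      have "continuous_on UNIV (pd l (\<lambda>x. g0 (torus_proj x) $ i $ k))" using C by simp
      from periodic_bounded[OF periodic_pd[OF periodic_tensor] this] show ?thesis by meson
    qed
    then obtain M1 where M1: "\<And>l x. \<bar>pd l (\<lambda>x. g0 (torus_proj x) $ i $ k) x\<bar> \<le> M1 l" by metis
    define M where "M = Max (insert M0 (range M1))"
    have "M0 \<le> M" "M1 l \<le> M" for l unfolding M_def by (rule Max_ge; simp)+
    then show ?thesis using M0 M1 by (intro exI[of _ M]) (meson less_le_trans order_trans)
  qed
  then obtain M where M: "\<And>i k. M i k > 0" "\<And>i k x. \<bar>g0 (torus_proj x) $ i $ k\<bar> \<le> M i k"
    "\<And>i k l x. \<bar>pd l (\<lambda>x. g0 (torus_proj x) $ i $ k) x\<bar> \<le> M i k" by metis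
  define M' where "M' = Max (range (\<lambda>(i, k). M i k))"
  have M': "M i k \<le> M'" for i k
    unfolding M'_def by (rule Max_ge) (auto intro: rev_image_eqI[of "(i, k)"])
  define \<tau> where "\<tau> = min 1 (\<nu>0 / (2 * real CARD('n)))"
  have tau: "\<tau> > 0" "\<tau> \<le> 1" "\<tau> * real CARD('n) \<le> \<nu>0 / 2"
  proof -
    have "\<tau> * real CARD('n) \<le> (\<nu>0 / (2 * real CARD('n))) * real CARD('n)"
      unfolding \<tau>_def by (intro mult_right_mono) auto
    then show "\<tau> * real CARD('n) \<le> \<nu>0 / 2" by simp
  qed (use nu0 in \<open>auto simp: \<tau>_def\<close>)
  have "uniformly_elliptic g0 (\<nu>0 / 2) (M' + 1) (M' + 1)"
    unfolding uniformly_elliptic_def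
  proof (intro conjI allI g0)
    fix x and v :: "real^'n"
    have "0 \<le> \<nu>0 * (v \<bullet> v)" using nu0 by simp
    then show "\<nu>0 / 2 * (v \<bullet> v) \<le> v \<bullet> (g0 (torus_proj x) *v v)" using nu0(2)[of v x] by simp
  next
    fix x i k
    show "\<bar>g0 (torus_proj x) $ i $ k\<bar> \<le> M' + 1" using M(2)[of x i k] M'[of i k] by linarith
    fix l
    show "\<bar>pd l (\<lambda>x. g0 (torus_proj x) $ i $ k) x\<bar> \<le> M' + 1" using M(3)[of l i k x] M'[of i k] by linarith
  qed (use nu0 in simp)
  moreover have "\<forall>\<^sub>F j in sequentially. uniformly_elliptic (gt j) (\<nu>0 / 2) (M' + 1) (M' + 1)"
    using C1_converges_close[OF conv tau(1)] eventually_ge_at_top[of 1]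
  proof eventually_elim
    case (elim j)
    note cl = elim(1)[rule_format]
    show ?case
      unfolding uniformly_elliptic_def
    proof (intro conjI allI gt elim(2))
      fix x and v :: "real^'n"
      have "\<tau> * real CARD('n) * (v \<bullet> v) \<le> \<nu>0 / 2 * (v \<bullet> v)" using tau by (intro mult_right_mono) auto
      moreover have "\<bar>v \<bullet> (gt j (torus_proj x) *v v) - v \<bullet> (g0 (torus_proj x) *v v)\<bar> \<le> \<tau> * real CARD('n) * (v \<bullet> v)"
        by (rule quadratic_form_close) (use cl in blast)
      ultimately show "\<nu>0 / 2 * (v \<bullet> v) \<le> v \<bullet> (gt j (torus_proj x) *v v)" using nu0(2)[of v x] by (simp add: abs_le_iff)
    next
      fix x i k
      show "\<bar>gt j (torus_proj x) $ i $ k\<bar> \<le> M' + 1"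
        using cl[of x i k i, THEN conjunct1] M(2)[of x i k] M'[of i k] tau(2) by linarith
      fix l
      show "\<bar>pd l (\<lambda>x. gt j (torus_proj x) $ i $ k) x\<bar> \<le> M' + 1"
        using cl[of x i k l, THEN conjunct2] M(3)[of l i k x] M'[of i k] tau(2) by linarith
    qed (use nu0 in simp)
  qed
  ultimately show thesis by (rule that)
qed

section \<open>Estimates for one conformal metric\<close>

text \<open>
  The constants are explicit, so that the estimates are visibly uniform: they depend only on the
  dimension and the ellipticity bounds of the background.
\<close>

definition dens_lower :: "nat \<Rightarrow> real \<Rightarrow> real" where
  "dens_lower n \<nu> = sqrt (1 / (fact n * (1 / \<nu>) ^ n))"

definition dens_upper :: "nat \<Rightarrow> real \<Rightarrow> real" where
  "dens_upper n \<Lambda> = sqrt (fact n * \<Lambda> ^ n)"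

definition inverse_lower_const :: "nat \<Rightarrow> real \<Rightarrow> real \<Rightarrow> real" where
  "inverse_lower_const n \<nu> \<Lambda> = \<nu> / ((real n)\<^sup>2 * \<Lambda>\<^sup>2)"

definition energy_const :: "nat \<Rightarrow> real \<Rightarrow> real \<Rightarrow> real" where
  "energy_const n \<nu> \<Lambda> = 1 / (dens_lower n \<nu> * inverse_lower_const n \<nu> \<Lambda>)"

definition variance_const :: "nat \<Rightarrow> real \<Rightarrow> real \<Rightarrow> real" where
  "variance_const n \<nu> \<Lambda> = dens_upper n \<Lambda> * (real n * energy_const n \<nu> \<Lambda>)"

definition Lip_const :: "nat \<Rightarrow> real \<Rightarrow> real \<Rightarrow> real \<Rightarrow> real" where
  "Lip_const n \<nu> \<Lambda> \<Lambda>1 = 3 / 2 * dens_upper n \<Lambda> * (real n)\<^sup>2 * \<Lambda>1 / \<nu>\<^sup>2"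

definition box_radius :: "real \<Rightarrow> real" where
  "box_radius \<nu> = 1 / sqrt \<nu>"

definition core_radius :: "nat \<Rightarrow> real \<Rightarrow> real" where
  "core_radius n \<Lambda> = 1 / (2 * real n * sqrt (\<Lambda> + 1))"

definition core_mass :: "nat \<Rightarrow> real \<Rightarrow> real" where
  "core_mass n \<Lambda> = (2 * core_radius n \<Lambda>) ^ n / 4"

definition sup_const :: "nat \<Rightarrow> real \<Rightarrow> real \<Rightarrow> real \<Rightarrow> real" where
  "sup_const n \<nu> \<Lambda> \<Lambda>1 = (dens_upper n \<Lambda> + mvK (real n) (box_radius \<nu>) \<Lambda> (Lip_const n \<nu> \<Lambda> \<Lambda>1))
     * (2 * box_radius \<nu>) ^ n / (dens_lower n \<nu> * core_mass n \<Lambda>)"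

lemma measure_hbox:
  assumes "\<rho> \<ge> 0"
  shows "measure lborel (hbox \<rho> :: (real^'n::finite) set) = (2 * \<rho>) ^ CARD('n)"
  using assms by (subst content_cbox_cart) (auto simp: interval_ne_empty_cart)

locale conformal_torus =
  fixes g gt :: "'n::finite tensor2" and f :: "'n torus \<Rightarrow> real" and \<nu> \<Lambda> \<Lambda>1 \<delta> :: real
  assumes ell: "uniformly_elliptic gt \<nu> \<Lambda> \<Lambda>1" and g: "riemannian_metric g"
    and conf: "\<And>p. g p = exp (2 * f p) *\<^sub>R gt p"
    and scal_g: "\<And>p. scalar_curvature g p \<ge> - \<delta>" and scal_gt: "\<And>p. scalar_curvature gt p \<le> 0"
    and vol: "riem_volume gt = 1" and dim: "CARD('n) \<ge> 2" and delta: "\<delta> \<ge> 0"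
begin

definition w where "w x = exp (- 2 * f (torus_proj x))"
definition u where "u x = exp (- f (torus_proj x))"
definition a where "a = (\<integral>p. exp (- f p) \<partial>volume_measure gt)"

lemma gt: "riemannian_metric gt" and nu: "\<nu> > 0"
  using ell by (simp_all add: uniformly_elliptic_def)

lemma em: "elliptic_matrix (gt (torus_proj x)) \<nu> \<Lambda>"
  by (rule elliptic_matrix_uniformly_elliptic[OF ell])

lemma w_u: "w x = (u x)\<^sup>2" and u_pos: "u x > 0" and w_pos: "w x > 0" and u_sqrt: "u x = sqrt (w x)"
proof -
  show *: "w x = (u x)\<^sup>2" by (simp add: w_def u_def power2_eq_square flip: exp_add)
  show p: "u x > 0" "w x > 0" by (simp_all add: w_def u_def)
  show "u x = sqrt (w x)" unfolding * using p by simp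
qed

lemma per: "periodic w" "periodic u"
  by (simp_all add: periodic_def w_def u_def)

text \<open>The conformal factor inherits its regularity from a quotient of diagonal entries.\<close>

lemma w_C2: "Ck 2 w"
proof -
  obtain i :: 'n where True by blast
  have pos: "h p $ i $ i > 0" if "riemannian_metric h" for h :: "'n tensor2" and p
  proof -
    have "h p $ i $ i = axis i 1 \<bullet> (h p *v axis i 1)" by (simp add: matrix_vector_mult_basis column_def inner_axis')
    also have "\<dots> > 0" using posdef_riemannian[OF that] by (auto simp: posdef_def axis_eq_0_iff)
    finally show ?thesis .
  qed
  have "w = (\<lambda>x. gt (torus_proj x) $ i $ i / g (torus_proj x) $ i $ i)"
    using pos[OF gt] by (simp add: w_def conf fun_eq_iff exp_minus field_simps less_imp_neq[THEN not_sym] mult_exp_exp)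
  then show ?thesis
    using pos[OF g] by (auto intro!: Ck_divide Ck_riemannian g gt simp: less_imp_neq[THEN not_sym])
qed

sublocale cc: conformal_change "\<lambda>x. gt (torus_proj x)" w
  by unfold_locales (auto intro: Ck_riemannian gt posdef_riemannian w_C2 w_pos)

lemma cc_Dv: "cc.Dv = dens gt"
  by (simp add: cc.Dv_def dens_def fun_eq_iff)

lemma cc_Gh: "cc.Gh = g \<circ> torus_proj"
  by (simp add: cc.Gh_def fun_eq_iff w_def conf exp_minus)

lemma u_C1: "Ck 1 u" and pd_u: "pd i u x = pd i w x / (2 * u x)"
proof -
  have e: "u = (\<lambda>x. sqrt (w x))" by (simp add: u_sqrt fun_eq_iff)
  show "Ck 1 u" unfolding e by (rule C1_sqrt(1)[OF cc.C1(3) w_pos])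
  show "pd i u x = pd i w x / (2 * u x)" unfolding e by (rule C1_sqrt(2)[OF cc.C1(3) w_pos])
qed

lemma cont: "continuous_on UNIV w" "continuous_on UNIV u" "continuous_on UNIV (dens gt)"
  by (rule Ck_imp_continuous[OF w_C2] Ck_imp_continuous[OF u_C1] continuous_dens[OF gt])+

lemma cont_f: "continuous_on UNIV (\<lambda>p. exp (- f p))" "continuous_on UNIV (\<lambda>p. exp (- 2 * f p))"
  unfolding continuous_on_torus_iff using cont by (simp_all add: o_def u_def [abs_def] w_def [abs_def])

lemma dens_bounds: "dens_lower CARD('n) \<nu> \<le> dens gt x" "dens gt x \<le> dens_upper CARD('n) \<Lambda>"
  using elliptic_matrix.det_bounds[OF em[of x]]
  by (simp_all add: dens_def dens_lower_def dens_upper_def real_sqrt_le_mono del: real_sqrt_le_iff)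

lemma dens_lower_pos: "dens_lower CARD('n) \<nu> > 0" and dens_upper_pos: "dens_upper CARD('n) \<Lambda> > 0"
proof -
  show "dens_lower CARD('n) \<nu> > 0" using nu by (simp add: dens_lower_def)
  then show "dens_upper CARD('n) \<Lambda> > 0" using dens_bounds[of 0] by linarith
qed

lemma Lam_pos: "\<Lambda> > 0"
proof (rule ccontr)
  assume "\<not> \<Lambda> > 0"
  then have "\<Lambda> = 0" using elliptic_matrix.Lam_nonneg[OF em] by (simp add: not_less order_antisym)
  then show False using dens_upper_pos by (simp add: dens_upper_def power_0_left)
qed

lemma differential_inequality:
  "(\<Sum>i\<in>UNIV. pd i (cc.flux i) x) \<ge> dens gt x * ((real CARD('n) + 2) * inverse_lower_const CARD('n) \<nu> \<Lambda> * (\<Sum>i\<in>UNIV. (pd i u x)\<^sup>2) - \<delta>)"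
proof -
  have 1: "scal (\<lambda>x. gt (torus_proj x)) x \<le> 0"
    using scal_gt[of "torus_proj x"] by (simp add: scalar_curvature_torus_proj o_def)
  have 2: "scal cc.Gh x \<ge> - \<delta>"
    using scal_g[of "torus_proj x"] by (simp add: scalar_curvature_torus_proj cc_Gh)
  define X where "X = (\<Sum>i\<in>UNIV. \<Sum>k\<in>UNIV. cc.H x $ i $ k * pd i w x * pd k w x)"
  have "(\<Sum>i\<in>UNIV. (pd i u x)\<^sup>2) = (\<Sum>i\<in>UNIV. (pd i w x)\<^sup>2) / (4 * w x)"
    by (simp add: pd_u power_divide power_mult_distrib w_u[symmetric] sum_divide_distrib)
  moreover have "inverse_lower_const CARD('n) \<nu> \<Lambda> * (\<Sum>i\<in>UNIV. (pd i w x)\<^sup>2) \<le> X"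
    using elliptic_matrix.inverse_lower[OF em[of x], of "\<chi> i. pd i w x"]
    by (simp add: X_def cc.H_def inverse_lower_const_def inner_vec_def power2_eq_square)
  ultimately have "inverse_lower_const CARD('n) \<nu> \<Lambda> * (\<Sum>i\<in>UNIV. (pd i u x)\<^sup>2) \<le> X / (4 * w x)"
    using w_pos[of x] by (simp add: divide_right_mono)
  then have "(real CARD('n) + 2) * (inverse_lower_const CARD('n) \<nu> \<Lambda> * (\<Sum>i\<in>UNIV. (pd i u x)\<^sup>2)) \<le> (real CARD('n) + 2) * (X / (4 * w x))"
    by (intro mult_left_mono) auto
  moreover have "\<delta> / (real CARD('n) - 1) \<le> \<delta>"
    using dim delta by (simp add: divide_le_eq mult_left_mono[of 1 _ \<delta>, simplified])
  ultimately have "(real CARD('n) + 2) * inverse_lower_const CARD('n) \<nu> \<Lambda> * (\<Sum>i\<in>UNIV. (pd i u x)\<^sup>2) - \<delta>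
     \<le> (real CARD('n) + 2) / (4 * w x) * X - \<delta> / (real CARD('n) - 1)"
    by (simp add: mult.assoc)
  then have "dens gt x * ((real CARD('n) + 2) * inverse_lower_const CARD('n) \<nu> \<Lambda> * (\<Sum>i\<in>UNIV. (pd i u x)\<^sup>2) - \<delta>)
      \<le> dens gt x * ((real CARD('n) + 2) / (4 * w x) * X - \<delta> / (real CARD('n) - 1))"
    by (rule mult_left_mono) (use dens_pos[OF gt, of x] in simp)
  also have "\<dots> \<le> (\<Sum>i\<in>UNIV. pd i (cc.flux i) x)"
    using cc.almost_subharmonic[OF dim 1 2] by (simp add: X_def cc_Dv)
  finally show ?thesis .
qed

lemma periodic_flux: "periodic (cc.flux i)"
proof -
  have "cc.flux i x = cc.flux i y" if "torus_proj x = torus_proj y" for x y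
  proof -
    have "pd k w x = pd k w y" for k by (rule periodicD[OF periodic_pd[OF per(1)] that])
    then show ?thesis using that by (simp add: cc.flux_def cc_Dv dens_def cc.H_def)
  qed
  then show ?thesis unfolding periodic_def by blast
qed


lemma dens_integral: "(\<integral>x. dens gt x \<partial>cubeM) = 1"
  using vol riem_volume_eq[OF gt] by simp

lemma energy_integrable: "integrable cubeM (\<lambda>x. \<Sum>i\<in>UNIV. (pd i u x)\<^sup>2)"
proof (rule integrable_cube)
  show "periodic (\<lambda>x. \<Sum>i\<in>UNIV. (pd i u x)\<^sup>2)"
    unfolding periodic_def by (intro allI impI sum.cong refl arg_cong2[where f = power] periodicD[OF periodic_pd[OF per(2)]])
  show "continuous_on UNIV (\<lambda>x. \<Sum>i\<in>UNIV. (pd i u x)\<^sup>2)"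
    using u_C1 by (intro continuous_intros) auto
qed

lemma ilc_pos: "inverse_lower_const CARD('n) \<nu> \<Lambda> > 0"
  using nu Lam_pos by (simp add: inverse_lower_const_def)

lemma energy_const_nonneg: "(energy_const CARD('n) \<nu> \<Lambda>) \<ge> 0"
  using ilc_pos dens_lower_pos by (simp add: energy_const_def)

text \<open>The flux is periodic, hence its divergence integrates to zero, and the error must outweigh the gradient term.\<close>

lemma energy_bound: "(\<integral>x. (\<Sum>i\<in>UNIV. (pd i u x)\<^sup>2) \<partial>cubeM) \<le> (energy_const CARD('n) \<nu> \<Lambda>) * \<delta>"
proof -
  define e where "e x = (\<Sum>i\<in>UNIV. (pd i u x)\<^sup>2)" for x
  define c where "c = inverse_lower_const CARD('n) \<nu> \<Lambda>"
  have e0: "e x \<ge> 0" for x by (simp add: e_def sum_nonneg)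
  have ie: "integrable cubeM e" unfolding e_def [abs_def] by (rule energy_integrable)
  have ifl: "integrable cubeM (pd i (cc.flux i))" "(\<integral>x. pd i (cc.flux i) x \<partial>cubeM) = 0" for i
    using cc.flux_C1[of i] periodic_flux[of i]
    by (auto intro!: integrable_cube periodic_pd integral_cube_pd_eq_0)
  have "dens_lower CARD('n) \<nu> * c * e x - dens gt x * \<delta> \<le> (\<Sum>i\<in>UNIV. pd i (cc.flux i) x)" for x
  proof -
    have "dens_lower CARD('n) \<nu> * (c * e x) \<le> dens gt x * ((real CARD('n) + 2) * (c * e x))"
    proof (rule mult_mono)
      have "0 \<le> c * e x" using e0 ilc_pos by (simp add: c_def)
      then show "c * e x \<le> (real CARD('n) + 2) * (c * e x)" "0 \<le> c * e x"
        using mult_right_mono[of 1 "real CARD('n) + 2" "c * e x"] by auto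
    qed (use dens_bounds dens_pos[OF gt] in \<open>auto intro: less_imp_le\<close>)
    then show ?thesis using differential_inequality[of x] by (simp add: e_def c_def algebra_simps)
  qed
  moreover have id: "integrable cubeM (dens gt)"
    by (intro integrable_cube periodic_dens cont)
  ultimately have "(\<integral>x. dens_lower CARD('n) \<nu> * c * e x - dens gt x * \<delta> \<partial>cubeM) \<le> (\<integral>x. (\<Sum>i\<in>UNIV. pd i (cc.flux i) x) \<partial>cubeM)"
    using ie ifl by (intro integral_mono) auto
  also have "\<dots> = 0" using ifl by (simp add: Bochner_Integration.integral_sum)
  also have "(\<integral>x. dens_lower CARD('n) \<nu> * c * e x - dens gt x * \<delta> \<partial>cubeM) = dens_lower CARD('n) \<nu> * c * (\<integral>x. e x \<partial>cubeM) - \<delta>"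
    using ie id dens_integral by simp
  finally have "dens_lower CARD('n) \<nu> * c * (\<integral>x. e x \<partial>cubeM) \<le> \<delta>" by simp
  moreover have "dens_lower CARD('n) \<nu> * c > 0" using dens_lower_pos ilc_pos by (simp add: c_def)
  ultimately show ?thesis by (simp add: e_def energy_const_def c_def field_simps)
qed

lemma a_eq: "a = (\<integral>x. dens gt x * u x \<partial>cubeM)"
  unfolding a_def by (simp add: integral_volume[OF gt cont_f(1)] u_def)

lemma u2_integral: "(\<integral>p. exp (- 2 * f p) \<partial>volume_measure gt) = (\<integral>x. dens gt x * (u x)\<^sup>2 \<partial>cubeM)"
  using integral_volume[OF gt cont_f(2)] by (simp add: w_u[symmetric] w_def)

lemma integrable_weighted:
  assumes "periodic F" "continuous_on UNIV F"
  shows "integrable cubeM (\<lambda>x. dens gt x * F x)"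
proof (rule integrable_cube)
  show "periodic (\<lambda>x. dens gt x * F x)"
    unfolding periodic_def by (intro allI impI arg_cong2[where f = "(*)"] periodicD[OF assms(1)] periodicD[OF periodic_dens])
qed (intro continuous_intros cont assms)


lemma variance_const_nonneg: "(variance_const CARD('n) \<nu> \<Lambda>) \<ge> 0"
  using energy_const_nonneg dens_upper_pos by (simp add: variance_const_def)

text \<open>
  The background has unit volume, so \<open>a\<close> is an average of \<open>u\<close> against a probability density, and Jensen's
  inequality reduces the claim to the Poincare inequality.
\<close>

lemma variance_bound: "(\<integral>x. (u x - a)\<^sup>2 \<partial>cubeM) \<le> (variance_const CARD('n) \<nu> \<Lambda>) * \<delta>"
proof -
  have jensen: "(u x - a)\<^sup>2 \<le> (\<integral>y. dens_upper CARD('n) \<Lambda> * (u x - u y)\<^sup>2 \<partial>cubeM)" for x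
  proof -
    define c where "c = u x - a"
    have i1: "integrable cubeM (\<lambda>y. dens gt y * (2 * c * (u x - u y) - c\<^sup>2))"
      by (intro integrable_weighted periodic_comp[OF per(2)] continuous_intros cont)
    have i0: "integrable cubeM (dens gt)" "integrable cubeM (\<lambda>y. dens gt y * u y)"
      using integrable_weighted[of "\<lambda>x. 1"] integrable_weighted[OF per(2) cont(2)] by (auto simp: periodic_def)
    have i2: "integrable cubeM (\<lambda>y. dens_upper CARD('n) \<Lambda> * (u x - u y)\<^sup>2)"
      by (intro integrable_cube periodic_comp[OF per(2)] continuous_intros cont)
    have "dens gt y * (2 * c * (u x - u y) - c\<^sup>2) \<le> dens_upper CARD('n) \<Lambda> * (u x - u y)\<^sup>2" for y
    proof -
      have "2 * c * (u x - u y) - c\<^sup>2 \<le> (u x - u y)\<^sup>2"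
        using zero_le_power2[of "(u x - u y) - c"] by (simp add: power2_diff[of "u x - u y"] mult_ac)
      then have "dens gt y * (2 * c * (u x - u y) - c\<^sup>2) \<le> dens gt y * (u x - u y)\<^sup>2"
        using dens_pos[OF gt, of y] by (intro mult_left_mono) auto
      also have "\<dots> \<le> dens_upper CARD('n) \<Lambda> * (u x - u y)\<^sup>2" by (intro mult_right_mono dens_bounds) auto
      finally show ?thesis .
    qed
    then have "(\<integral>y. dens gt y * (2 * c * (u x - u y) - c\<^sup>2) \<partial>cubeM) \<le> (\<integral>y. dens_upper CARD('n) \<Lambda> * (u x - u y)\<^sup>2 \<partial>cubeM)"
      by (intro integral_mono i1 i2)
    moreover have "(\<integral>y. dens gt y * (2 * c * (u x - u y) - c\<^sup>2) \<partial>cubeM) = c\<^sup>2"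
    proof -
      have "(\<integral>y. dens gt y * (2 * c * (u x - u y) - c\<^sup>2) \<partial>cubeM)
          = (\<integral>y. (2 * c * u x - c\<^sup>2) * dens gt y - 2 * c * (dens gt y * u y) \<partial>cubeM)"
        by (intro Bochner_Integration.integral_cong) (auto simp: algebra_simps)
      also have "\<dots> = (2 * c * u x - c\<^sup>2) - 2 * c * a"
        using i0 by (simp add: dens_integral a_eq)
      finally show ?thesis by (simp add: c_def power2_eq_square algebra_simps)
    qed
    ultimately show ?thesis by (simp add: c_def)
  qed
  have i: "integrable cubeM (\<lambda>x. (u x - a)\<^sup>2)" 
    by (intro integrable_cube periodic_comp[OF per(2)] continuous_intros cont)
  have mu: "u \<in> borel_measurable borel" by (rule borel_measurable_continuous_onI[OF cont(2)])
  note [measurable] = mu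
  have "ennreal (\<integral>x. (u x - a)\<^sup>2 \<partial>cubeM) = (\<integral>\<^sup>+x. ennreal ((u x - a)\<^sup>2) \<partial>cubeM)"
    by (rule nn_integral_eq_integral[symmetric, OF i]) simp
  also have "\<dots> \<le> (\<integral>\<^sup>+x. \<integral>\<^sup>+y. ennreal (dens_upper CARD('n) \<Lambda>) * ennreal ((u x - u y)\<^sup>2) \<partial>cubeM \<partial>cubeM)"
  proof (rule nn_integral_mono)
    fix x
    have i2: "integrable cubeM (\<lambda>y. dens_upper CARD('n) \<Lambda> * (u x - u y)\<^sup>2)"
      by (intro integrable_cube periodic_comp[OF per(2)] continuous_intros cont)
    have "ennreal ((u x - a)\<^sup>2) \<le> ennreal (\<integral>y. dens_upper CARD('n) \<Lambda> * (u x - u y)\<^sup>2 \<partial>cubeM)"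
      by (rule ennreal_leI[OF jensen])
    also have "\<dots> = (\<integral>\<^sup>+y. ennreal (dens_upper CARD('n) \<Lambda> * (u x - u y)\<^sup>2) \<partial>cubeM)"
      by (rule nn_integral_eq_integral[symmetric, OF i2]) (use dens_upper_pos in simp)
    finally show "ennreal ((u x - a)\<^sup>2) \<le> (\<integral>\<^sup>+y. ennreal (dens_upper CARD('n) \<Lambda>) * ennreal ((u x - u y)\<^sup>2) \<partial>cubeM)"
      using dens_upper_pos by (simp add: ennreal_mult)
  qed
  also have "\<dots> = ennreal (dens_upper CARD('n) \<Lambda>) * (\<integral>\<^sup>+x. \<integral>\<^sup>+y. ennreal ((u x - u y)\<^sup>2) \<partial>cubeM \<partial>cubeM)"
    by (simp add: nn_integral_cmult)
  also have "\<dots> \<le> ennreal (dens_upper CARD('n) \<Lambda>) * (\<integral>\<^sup>+x. ennreal (real CARD('n) * (\<Sum>i\<in>UNIV. (pd i u x)\<^sup>2)) \<partial>cubeM)"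
    by (intro mult_left_mono Poincare_torus per u_C1) auto
  also have "(\<integral>\<^sup>+x. ennreal (real CARD('n) * (\<Sum>i\<in>UNIV. (pd i u x)\<^sup>2)) \<partial>cubeM) = ennreal (\<integral>x. real CARD('n) * (\<Sum>i\<in>UNIV. (pd i u x)\<^sup>2) \<partial>cubeM)"
    by (rule nn_integral_eq_integral) (auto intro: energy_integrable simp: sum_nonneg)
  also have "\<dots> \<le> ennreal (real CARD('n) * ((energy_const CARD('n) \<nu> \<Lambda>) * \<delta>))"
    using energy_bound by (intro ennreal_leI) (simp add: mult_left_mono)
  finally have "ennreal (\<integral>x. (u x - a)\<^sup>2 \<partial>cubeM) \<le> ennreal (dens_upper CARD('n) \<Lambda>) * ennreal (real CARD('n) * ((energy_const CARD('n) \<nu> \<Lambda>) * \<delta>))"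
    by (simp add: mult_left_mono)
  also have "\<dots> = ennreal ((variance_const CARD('n) \<nu> \<Lambda>) * \<delta>)"
    using dens_upper_pos energy_const_nonneg delta by (simp add: variance_const_def ennreal_mult'[symmetric] mult_ac)
  finally show ?thesis using variance_const_nonneg delta by (subst (asm) ennreal_le_iff) auto
qed


lemma Lam1: "\<bar>pd l (\<lambda>x. gt (torus_proj x) $ i $ j) x\<bar> \<le> \<Lambda>1"
  using ell by (simp add: uniformly_elliptic_def)

text \<open>The Lipschitz bound that the mean value inequality asks for; here the \<open>C\<^sup>1\<close> bound on the background is used.\<close>

lemma coefficient_bound: "\<bar>pd l (\<lambda>x. dens gt x * cc.H x $ i $ j) x\<bar> \<le> (Lip_const CARD('n) \<nu> \<Lambda> \<Lambda>1)"
proof -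
  have H: "\<bar>cc.H x $ i $ j\<bar> \<le> 1 / \<nu>" for x i j unfolding cc.H_def by (rule elliptic_matrix.inverse_upper[OF em])
  have L1: "\<Lambda>1 \<ge> 0" by (rule order_trans[OF abs_ge_zero Lam1])
  have D: "\<bar>dens gt x\<bar> \<le> dens_upper CARD('n) \<Lambda>" using dens_bounds(2)[of x] dens_pos[OF gt, of x] by simp
  have "pd l (dens gt) x = 1/2 * dens gt x * (\<Sum>i\<in>UNIV. \<Sum>j\<in>UNIV. cc.H x $ i $ j * pd l (\<lambda>x. gt (torus_proj x) $ i $ j) x)"
    unfolding dens_def [abs_def] cc.H_def by (rule volume_density(2)) (auto intro: Ck_riemannian gt posdef_riemannian simp del: Ck.simps)
  also have "\<bar>\<dots>\<bar> \<le> 1/2 * dens_upper CARD('n) \<Lambda> * (\<Sum>i\<in>(UNIV::'n set). \<Sum>j\<in>(UNIV::'n set). 1 / \<nu> * \<Lambda>1)"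
    unfolding abs_mult using nu L1 dens_upper_pos
    by (intro mult_mono D order_trans[OF sum_abs] sum_mono) (auto simp: abs_mult intro!: mult_mono[OF H[simplified] Lam1, simplified])
  finally have pD: "\<bar>pd l (dens gt) x\<bar> \<le> 1/2 * dens_upper CARD('n) \<Lambda> * ((real CARD('n))\<^sup>2 * (1 / \<nu> * \<Lambda>1))"
    by (simp add: power2_eq_square)
  have "pd l (\<lambda>x. cc.H x $ i $ j) x = - (\<Sum>c\<in>UNIV. \<Sum>d\<in>UNIV. cc.H x $ i $ c * pd l (\<lambda>x. gt (torus_proj x) $ c $ d) x * cc.H x $ d $ j)"
    unfolding cc.H_def by (rule pd_matrix_inv) (auto intro: Ck_riemannian gt posdef_riemannian simp del: Ck.simps)
  also have "\<bar>\<dots>\<bar> \<le> (\<Sum>c\<in>(UNIV::'n set). \<Sum>d\<in>(UNIV::'n set). 1 / \<nu> * \<Lambda>1 * (1 / \<nu>))"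
    unfolding abs_minus_cancel
  proof (intro order_trans[OF sum_abs] sum_mono)
    fix c d
    show "\<bar>cc.H x $ i $ c * pd l (\<lambda>x. gt (torus_proj x) $ c $ d) x * cc.H x $ d $ j\<bar> \<le> 1 / \<nu> * \<Lambda>1 * (1 / \<nu>)"
      unfolding abs_mult using nu L1 by (intro mult_mono H Lam1) auto
  qed
  finally have pH: "\<bar>pd l (\<lambda>x. cc.H x $ i $ j) x\<bar> \<le> (real CARD('n))\<^sup>2 * (1 / \<nu> * \<Lambda>1 * (1 / \<nu>))"
    by (simp add: power2_eq_square)
  have "pd l (\<lambda>x. dens gt x * cc.H x $ i $ j) x = pd l (dens gt) x * cc.H x $ i $ j + dens gt x * pd l (\<lambda>x. cc.H x $ i $ j) x"
    by (rule pd_mult) (use dens_C1[OF gt] cc.C1(2) in auto)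
  also have "\<bar>\<dots>\<bar> \<le> \<bar>pd l (dens gt) x\<bar> * \<bar>cc.H x $ i $ j\<bar> + \<bar>dens gt x\<bar> * \<bar>pd l (\<lambda>x. cc.H x $ i $ j) x\<bar>"
    unfolding abs_mult[symmetric] by (rule abs_triangle_ineq)
  also have "\<dots> \<le> 1/2 * dens_upper CARD('n) \<Lambda> * ((real CARD('n))\<^sup>2 * (1 / \<nu> * \<Lambda>1)) * (1 / \<nu>) + dens_upper CARD('n) \<Lambda> * ((real CARD('n))\<^sup>2 * (1 / \<nu> * \<Lambda>1 * (1 / \<nu>)))"
    using nu L1 dens_upper_pos by (intro add_mono mult_mono pD H D pH) auto
  also have "\<dots> = (Lip_const CARD('n) \<nu> \<Lambda> \<Lambda>1)" by (simp add: Lip_const_def power2_eq_square field_simps)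
  finally show ?thesis .
qed


lemma sup_estimate:
  assumes M: "\<And>x. \<bar>w x - k\<bar> \<le> M" and r: "0 < r" "r \<le> 1" "r * (box_radius \<nu>) < 1/2"
  shows "w x0 - k \<le> 1 / (core_mass CARD('n) \<Lambda>) * ((1 / r) ^ CARD('n) * (\<integral>x. \<bar>w x - k\<bar> \<partial>cubeM)) + (sup_const CARD('n) \<nu> \<Lambda> \<Lambda>1) * r * (\<delta> + M)"
proof -
  have "\<exists>B. \<forall>i x. \<bar>pd i w x\<bar> \<le> B"
  proof -
    have "\<exists>M. \<forall>x. \<bar>pd i w x\<bar> \<le> M" for i
    proof -
      have "continuous_on UNIV (pd i w)" using cc.C1(3) by simp
      from periodic_bounded[OF periodic_pd[OF per(1)] this] show ?thesis by meson
    qed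
    then obtain B where "\<And>i x. \<bar>pd i w x\<bar> \<le> B i" by metis
    moreover have "B i \<le> Max (range B)" for i by (rule Max_ge) auto
    ultimately show ?thesis by (meson order_trans)
  qed
  then obtain B where B: "\<And>i x. \<bar>pd i w x\<bar> \<le> B" by blast
  let ?d = "dens_upper CARD('n) \<Lambda> * \<delta>"
  interpret mv: mean_value "\<lambda>i j x. dens gt x * cc.H x $ i $ j" "\<lambda>i j. gt (torus_proj x0) $ i $ j" w x0 "dens gt x0"
    \<nu> \<Lambda> "Lip_const CARD('n) \<nu> \<Lambda> \<Lambda>1" ?d M k B "box_radius \<nu>"
  proof
    show "Ck 1 (\<lambda>x. dens gt x * cc.H x $ i $ j)" for i j by (intro Ck_mult dens_C1 gt cc.C1)
    show "(\<Sum>i\<in>UNIV. dens gt x0 * cc.H x0 $ i $ j * gt (torus_proj x0) $ i $ k) = (if j = k then dens gt x0 else 0)" for j k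
      using cc.HG[of x0 j k] by (simp add: mult.assoc cc.H_sym[of x0 _ j] flip: sum_distrib_left)
    show "dens gt x0 > 0" by (rule dens_pos[OF gt])
    show "gt (torus_proj x0) $ i $ j = gt (torus_proj x0) $ j $ i" for i j by (rule cc.G_sym)
    show "\<bar>gt (torus_proj x0) $ i $ j\<bar> \<le> \<Lambda>" for i j by (rule elliptic_matrix.upper[OF em])
    show "\<nu> * (y \<bullet> y) \<le> (\<Sum>i\<in>UNIV. \<Sum>j\<in>UNIV. gt (torus_proj x0) $ i $ j * y $ i * y $ j)" for y :: "real^'n"
      using elliptic_matrix.lower[OF em[of x0], of y] by (simp add: inner_mult_vec)
    show "- ?d \<le> (\<Sum>i\<in>UNIV. pd i (\<lambda>x. \<Sum>j\<in>UNIV. dens gt x * cc.H x $ i $ j * pd j w x) x)" for x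
    proof -
      have "0 \<le> (real CARD('n) + 2) * inverse_lower_const CARD('n) \<nu> \<Lambda> * (\<Sum>i\<in>UNIV. (pd i u x)\<^sup>2)"
        using ilc_pos by (intro mult_nonneg_nonneg sum_nonneg) auto
      then have "dens gt x * (- \<delta>) \<le> dens gt x * ((real CARD('n) + 2) * inverse_lower_const CARD('n) \<nu> \<Lambda> * (\<Sum>i\<in>UNIV. (pd i u x)\<^sup>2) - \<delta>)"
        using dens_pos[OF gt, of x] by (intro mult_left_mono) auto
      moreover have "- ?d \<le> dens gt x * (- \<delta>)" using mult_right_mono[OF dens_bounds(2) delta] by simp
      ultimately show ?thesis
        using differential_inequality[of x] by (simp add: cc.flux_def [abs_def] cc_Dv)
    qed
    show "?d \<ge> 0" using delta dens_upper_pos by simp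
    show "(box_radius \<nu>) > 0" "\<nu> * (box_radius \<nu>)\<^sup>2 = 1" using nu by (simp_all add: box_radius_def power_divide)
  qed (use w_C2 nu coefficient_bound M B in auto)
  have L1: "sqrt (\<Lambda> + 1) > 0" using Lam_pos by simp
  have core: "(core_radius CARD('n) \<Lambda>) > 0" "(real CARD('n))\<^sup>2 * (\<Lambda> * (core_radius CARD('n) \<Lambda>)\<^sup>2) \<le> 1/2"
  proof -
    show "(core_radius CARD('n) \<Lambda>) > 0" using L1 by (simp add: core_radius_def)
    have "(real CARD('n))\<^sup>2 * (\<Lambda> * (core_radius CARD('n) \<Lambda>)\<^sup>2) = \<Lambda> / (4 * (\<Lambda> + 1))"
      using Lam_pos by (simp add: core_radius_def power_divide power_mult_distrib)
    also have "\<dots> \<le> 1/2" using Lam_pos by (simp add: field_simps)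
    finally show "(real CARD('n))\<^sup>2 * (\<Lambda> * (core_radius CARD('n) \<Lambda>)\<^sup>2) \<le> 1/2" .
  qed
  have cm: "(core_mass CARD('n) \<Lambda>) > 0"
    using core(1) by (simp add: core_mass_def)
  define I where "I = (1 / r) ^ CARD('n) * (\<integral>x. \<bar>w x - k\<bar> \<partial>cubeM)"
  define K where "K = mvK (real CARD('n)) (box_radius \<nu>) \<Lambda> (Lip_const CARD('n) \<nu> \<Lambda> \<Lambda>1)"
  define V where "V = (2 * box_radius \<nu>) ^ CARD('n)"
  have K: "K \<ge> 0" unfolding K_def mvK_def using mv.R mv.Lam_nonneg
    by (intro mult_nonneg_nonneg add_nonneg_nonneg) auto
  have V: "V \<ge> 0" using mv.R by (simp add: V_def)
  have V': "measure lborel (hbox (box_radius \<nu>) :: (real^'n) set) = V"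
    unfolding V_def by (rule measure_hbox) (use mv.R in simp)
  have core': "measure lborel (hbox (core_radius CARD('n) \<Lambda>) :: (real^'n) set) / 4 = core_mass CARD('n) \<Lambda>"
    unfolding core_mass_def by (subst measure_hbox) (use core in simp_all)
  have M0: "M \<ge> 0" by (rule mv.Lam_nonneg)
  let ?D = "dens gt x0"
  have D: "?D > 0" "dens_lower CARD('n) \<nu> \<le> ?D" using dens_pos[OF gt] dens_bounds by auto
  have "?D * (core_mass CARD('n) \<Lambda>) * (w x0 - k) \<le> ?D * I + r * ((r * ?d + M * K) * V)"
    using mv.mean_value_bound[OF per(1) r(1,3) core]
    unfolding core' mv.box_def V' by (simp add: I_def K_def)
  also have "\<dots> \<le> ?D * I + r * (((dens_upper CARD('n) \<Lambda> + K) * (\<delta> + M)) * V)"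
  proof (intro add_left_mono mult_left_mono mult_right_mono V)
    have "r * ?d \<le> 1 * ?d" using r delta dens_upper_pos by (intro mult_right_mono) auto
    moreover have "0 \<le> dens_upper CARD('n) \<Lambda> * M" "0 \<le> K * \<delta>" using M0 K delta dens_upper_pos by auto
    ultimately show "r * ?d + M * K \<le> (dens_upper CARD('n) \<Lambda> + K) * (\<delta> + M)" by (simp add: algebra_simps)
  qed (use r in auto)
  finally have "w x0 - k \<le> (?D * I + r * (((dens_upper CARD('n) \<Lambda> + K) * (\<delta> + M)) * V)) / (?D * (core_mass CARD('n) \<Lambda>))"
    using D cm by (simp add: pos_le_divide_eq mult_ac)
  also have "\<dots> = 1 / (core_mass CARD('n) \<Lambda>) * I + r * (((dens_upper CARD('n) \<Lambda> + K) * (\<delta> + M)) * V) / (?D * (core_mass CARD('n) \<Lambda>))"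
    using D by (simp add: add_divide_distrib)
  also have "r * (((dens_upper CARD('n) \<Lambda> + K) * (\<delta> + M)) * V) / (?D * (core_mass CARD('n) \<Lambda>))
      \<le> r * (((dens_upper CARD('n) \<Lambda> + K) * (\<delta> + M)) * V) / (dens_lower CARD('n) \<nu> * (core_mass CARD('n) \<Lambda>))"
    using r K V M0 delta dens_upper_pos D cm dens_lower_pos
    by (intro divide_left_mono mult_right_mono mult_nonneg_nonneg add_nonneg_nonneg mult_pos_pos) auto
  also have "\<dots> = (sup_const CARD('n) \<nu> \<Lambda> \<Lambda>1) * r * (\<delta> + M)"
    by (simp add: sup_const_def K_def V_def mult_ac)
  finally show ?thesis by (simp add: I_def)
qed

end

lemma L1_le_L2_cube:
  fixes F :: "real^'n::finite \<Rightarrow> real"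
  assumes "periodic F" "continuous_on UNIV F"
  shows "(\<integral>x. \<bar>F x\<bar> \<partial>cubeM) \<le> sqrt (\<integral>x. (F x)\<^sup>2 \<partial>cubeM)"
proof -
  define c where "c = (\<integral>x. \<bar>F x\<bar> \<partial>cubeM)"
  have i: "integrable cubeM (\<lambda>x. \<bar>F x\<bar>)" "integrable cubeM (\<lambda>x. (F x)\<^sup>2)"
    by (intro integrable_cube periodic_comp[OF assms(1)] continuous_intros assms)+
  have "2 * c * \<bar>F x\<bar> - c\<^sup>2 \<le> (F x)\<^sup>2" for x
    using zero_le_power2[of "\<bar>F x\<bar> - c"] by (simp add: power2_diff mult_ac)
  then have "(\<integral>x. 2 * c * \<bar>F x\<bar> - c\<^sup>2 \<partial>cubeM) \<le> (\<integral>x. (F x)\<^sup>2 \<partial>cubeM)"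
    using i by (intro integral_mono) auto
  moreover have "(\<integral>x. 2 * c * \<bar>F x\<bar> - c\<^sup>2 \<partial>cubeM) = c\<^sup>2"
    using i by (simp add: c_def[symmetric] measure_def emeasure_cubeM power2_eq_square)
  ultimately show ?thesis unfolding c_def[symmetric] by (simp add: real_le_rsqrt)
qed

context conformal_torus
begin

lemma speed_conf: "speed g x v = 1 / u x * speed gt x v"
proof -
  have "exp (2 * f (torus_proj x)) = (1 / u x)\<^sup>2"
    by (simp add: u_def power2_eq_square exp_minus inverse_eq_divide flip: exp_add)
  then show ?thesis using u_pos[of x]
    by (simp add: speed_def conf scaleR_matrix_vector_assoc[symmetric] real_sqrt_mult)
qed

lemma dens_conf: "dens g x = (1 / u x) ^ CARD('n) * dens gt x"
proof -
  have "exp (2 * f (torus_proj x)) ^ CARD('n) = ((1 / u x) ^ CARD('n))\<^sup>2"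
    by (simp add: u_def exp_minus inverse_eq_divide power2_eq_square flip: exp_add power_mult_distrib)
  then show ?thesis using u_pos[of x]
    by (simp add: dens_def conf det_scaleR real_sqrt_mult)
qed

text \<open>The supremum appears on both sides of the mean value estimate, with a small factor on the right.\<close>

lemma sup_bound:
  assumes r: "0 < r" "r \<le> 1" "r * box_radius \<nu> < 1/2" "sup_const CARD('n) \<nu> \<Lambda> \<Lambda>1 * r \<le> 1/2" and b: "b \<ge> 0"
    and sc: "sup_const CARD('n) \<nu> \<Lambda> \<Lambda>1 \<ge> 0" and cm: "core_mass CARD('n) \<Lambda> \<ge> 0"
  shows "w x - b \<le> 2 * (1 / core_mass CARD('n) \<Lambda> * ((1 / r) ^ CARD('n) * (\<integral>x. \<bar>w x - b\<bar> \<partial>cubeM)) + sup_const CARD('n) \<nu> \<Lambda> \<Lambda>1 * r * (\<delta> + b))"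
    (is "_ \<le> 2 * (?A + ?B * (\<delta> + b))")
proof -
  have A0: "?A \<ge> 0" using cm r by (intro mult_nonneg_nonneg integral_nonneg_AE) auto
  have B0: "?B \<ge> 0" "?B \<le> 1/2" using sc r by auto
  have "\<exists>x0\<in>cbox 0 (One :: real^'n). \<forall>y\<in>cbox 0 One. w y \<le> w x0"
    by (rule continuous_attains_sup) (auto intro: continuous_on_subset[OF cont(1)] simp: box_ne_empty)
  then obtain x0 where x0: "\<And>y. y \<in> cbox 0 One \<Longrightarrow> w y \<le> w x0" by blast
  have max: "w y \<le> w x0" for y
    by (rule periodic_forall_cube[OF per(1), of "\<lambda>t. t \<le> w x0"]) (use x0 cube_subset_cbox in auto)
  define m where "m = w x0 - b"
  have "\<bar>w y - b\<bar> \<le> b + max m 0" for y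
    using max[of y] w_pos[of y] b by (auto simp: m_def abs_le_iff)
  from sup_estimate[OF this r(1,2,3), of x0]
  have "m \<le> ?A + ?B * (\<delta> + (b + max m 0))" by (simp add: m_def)
  then have "m \<le> (?A + ?B * (\<delta> + b)) + ?B * max m 0" by (simp add: distrib_left)
  also have "?B * max m 0 \<le> 1/2 * max m 0" using B0 by (intro mult_right_mono) auto
  finally have 1: "m \<le> (?A + ?B * (\<delta> + b)) + 1/2 * max m 0" by simp
  have "?A + ?B * (\<delta> + b) \<ge> 0"
    using A0 mult_nonneg_nonneg[OF B0(1), of "\<delta> + b"] b delta by linarith
  with 1 have "m \<le> 2 * (?A + ?B * (\<delta> + b))" by (cases "m \<ge> 0") auto
  then show ?thesis using max[of x] by (simp add: m_def)
qed

lemma per_cont_inverse: "periodic (\<lambda>x. 1 / u x)" "continuous_on UNIV (\<lambda>x. 1 / u x)"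
  using u_pos by (auto intro!: periodic_comp[OF per(2)] continuous_intros cont simp: less_imp_neq[THEN not_sym])

lemma inverse_power_integrals:
  assumes V: "riem_volume g \<le> V"
  shows "(\<integral>x. dens gt x * (1 / u x) ^ CARD('n) \<partial>cubeM) \<le> V" 
    and "(\<integral>x. (1 / u x)\<^sup>2 \<partial>cubeM) \<le> 1 + V / dens_lower CARD('n) \<nu>"
proof -
  have p: "periodic (\<lambda>x. (1 / u x) ^ k)" "continuous_on UNIV (\<lambda>x. (1 / u x) ^ k)" for k
    by (rule periodic_comp[OF per_cont_inverse(1)], intro continuous_on_power per_cont_inverse)
  show 1: "(\<integral>x. dens gt x * (1 / u x) ^ CARD('n) \<partial>cubeM) \<le> V"
    using V riem_volume_eq[OF g] by (simp add: dens_conf mult.commute)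
  have i: "integrable cubeM (\<lambda>x. (1 / u x) ^ k)" "integrable cubeM (\<lambda>x. dens gt x * (1 / u x) ^ k)" for k
    by (rule integrable_cube[OF p] integrable_weighted[OF p])+
  have "dens_lower CARD('n) \<nu> * (\<integral>x. (1 / u x) ^ CARD('n) \<partial>cubeM) = (\<integral>x. dens_lower CARD('n) \<nu> * (1 / u x) ^ CARD('n) \<partial>cubeM)"
    by simp
  also have "\<dots> \<le> (\<integral>x. dens gt x * (1 / u x) ^ CARD('n) \<partial>cubeM)"
    by (intro integral_mono i integrable_mult_right mult_right_mono dens_bounds) (use u_pos in \<open>auto intro: less_imp_le\<close>)
  also note 1
  finally have 2: "(\<integral>x. (1 / u x) ^ CARD('n) \<partial>cubeM) \<le> V / dens_lower CARD('n) \<nu>"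
    using dens_lower_pos by (simp add: pos_le_divide_eq mult.commute)
  have "(1 / u x)\<^sup>2 \<le> 1 + (1 / u x) ^ CARD('n)" for x
  proof (cases "1 / u x \<ge> 1")
    case True
    then have "(1 / u x)\<^sup>2 \<le> (1 / u x) ^ CARD('n)" by (intro power_increasing dim)
    then show ?thesis by simp
  next
    case False
    then have "(1 / u x)\<^sup>2 \<le> 1" using u_pos[of x] by (intro power_le_one) auto
    then show ?thesis using u_pos[of x] by (simp add: add_increasing2)
  qed
  then have "(\<integral>x. (1 / u x)\<^sup>2 \<partial>cubeM) \<le> (\<integral>x. 1 + (1 / u x) ^ CARD('n) \<partial>cubeM)"
    using i by (intro integral_mono) auto
  also have "\<dots> = 1 + (\<integral>x. (1 / u x) ^ CARD('n) \<partial>cubeM)"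
    using i(1)[of "CARD('n)"] by (subst Bochner_Integration.integral_add) (auto simp: measure_def emeasure_cubeM)
  finally show "(\<integral>x. (1 / u x)\<^sup>2 \<partial>cubeM) \<le> 1 + V / dens_lower CARD('n) \<nu>" using 2 by simp
qed

text \<open>
  Since \<open>1/u - 1/b = (b - u) / (u b)\<close>, this is the weighted inequality between the arithmetic and the
  geometric mean; the volume bound keeps \<open>1/u\<close> in \<open>L\<^sup>2\<close>.
\<close>

lemma inverse_L1_bound:
  assumes V: "riem_volume g \<le> V" and b: "b > 0" and \<eta>: "\<eta> > 0"
  shows "(\<integral>x. \<bar>1 / u x - 1 / b\<bar> \<partial>cubeM) \<le> 1 / b * (\<eta> / 2 * (1 + V / dens_lower CARD('n) \<nu>) + (\<integral>x. (u x - b)\<^sup>2 \<partial>cubeM) / (2 * \<eta>))"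
proof -
  have i: "integrable cubeM (\<lambda>x. \<bar>1 / u x - 1 / b\<bar>)" "integrable cubeM (\<lambda>x. (1 / u x)\<^sup>2)" "integrable cubeM (\<lambda>x. (u x - b)\<^sup>2)"
    by (intro integrable_cube periodic_comp[OF per(2)] continuous_intros cont per_cont_inverse;
        use u_pos in \<open>simp add: less_imp_neq[THEN not_sym]\<close>)+
  have "\<bar>1 / u x - 1 / b\<bar> \<le> 1 / b * (\<eta> / 2 * (1 / u x)\<^sup>2 + (u x - b)\<^sup>2 / (2 * \<eta>))" for x
  proof -
    define p q where "p = 1 / u x" and "q = \<bar>u x - b\<bar>"
    have "1 / u x - 1 / b = (b - u x) * p / b" using u_pos[of x] b by (simp add: p_def field_simps)
    then have e: "\<bar>1 / u x - 1 / b\<bar> = 1 / b * (p * q)"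
      using u_pos[of x] b by (simp add: p_def q_def abs_mult abs_minus_commute)
    have "2 * (\<eta> * p) * q \<le> (\<eta> * p)\<^sup>2 + q\<^sup>2" by (rule sum_squares_bound)
    then have "p * q \<le> \<eta> / 2 * p\<^sup>2 + q\<^sup>2 / (2 * \<eta>)" using \<eta> by (simp add: field_simps power2_eq_square)
    then have "1 / b * (p * q) \<le> 1 / b * (\<eta> / 2 * p\<^sup>2 + q\<^sup>2 / (2 * \<eta>))" using b by (intro mult_left_mono) auto
    then show ?thesis unfolding e by (simp add: p_def q_def)
  qed
  then have "(\<integral>x. \<bar>1 / u x - 1 / b\<bar> \<partial>cubeM) \<le> (\<integral>x. 1 / b * (\<eta> / 2 * (1 / u x)\<^sup>2 + (u x - b)\<^sup>2 / (2 * \<eta>)) \<partial>cubeM)"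
    using i by (intro integral_mono) auto
  also have "\<dots> = 1 / b * (\<eta> / 2 * (\<integral>x. (1 / u x)\<^sup>2 \<partial>cubeM) + (\<integral>x. (u x - b)\<^sup>2 \<partial>cubeM) / (2 * \<eta>))"
    using i(2,3) by simp
  also have "\<dots> \<le> 1 / b * (\<eta> / 2 * (1 + V / dens_lower CARD('n) \<nu>) + (\<integral>x. (u x - b)\<^sup>2 \<partial>cubeM) / (2 * \<eta>))"
    using inverse_power_integrals(2)[OF V] b \<eta> by (intro mult_left_mono add_right_mono) auto
  finally show ?thesis .
qed

lemma a_upper:
  assumes "(\<integral>p. exp (- 2 * f p) \<partial>volume_measure gt) \<le> C" shows "a \<le> (1 + C) / 2"
proof -
  have i: "integrable cubeM (\<lambda>x. dens gt x * u x)" "integrable cubeM (\<lambda>x. dens gt x * (u x)\<^sup>2)" "integrable cubeM (dens gt)"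
    using integrable_weighted[OF per(2) cont(2)] integrable_weighted[OF periodic_comp[OF per(2)] continuous_on_power[OF cont(2)]]
      integrable_cube[OF periodic_dens cont(3)] by auto
  have "dens gt x * u x \<le> (dens gt x + dens gt x * (u x)\<^sup>2) / 2" for x
  proof -
    have "u x \<le> (1 + (u x)\<^sup>2) / 2" using sum_squares_bound[of 1 "u x"] by simp
    then have "dens gt x * u x \<le> dens gt x * ((1 + (u x)\<^sup>2) / 2)"
      using dens_pos[OF gt, of x] by (intro mult_left_mono) auto
    then show ?thesis by (simp add: field_simps)
  qed
  then have "a \<le> (\<integral>x. (dens gt x + dens gt x * (u x)\<^sup>2) / 2 \<partial>cubeM)"
    unfolding a_eq using i by (intro integral_mono) auto
  also have "\<dots> = (1 + (\<integral>x. dens gt x * (u x)\<^sup>2 \<partial>cubeM)) / 2"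
    using i by (simp add: dens_integral)
  finally show ?thesis using assms unfolding u2_integral by simp
qed

text \<open>
  A small mean would force \<open>u\<close> to be small on a large set and the volume, the integral of the \<open>n\<close>-th
  power of \<open>1/u\<close>, to be large; quantitatively \<open>1 \<le> u/t + (t/u)^n\<close>.
\<close>

lemma a_lower:
  assumes V: "riem_volume g \<le> V" and t: "t > 0" "t ^ CARD('n) * V \<le> 1/2"
  shows "t / 2 \<le> a"
proof -
  have i: "integrable cubeM (\<lambda>x. dens gt x * u x)" "integrable cubeM (\<lambda>x. dens gt x * (1 / u x) ^ CARD('n))" "integrable cubeM (dens gt)"
    using integrable_weighted[OF per(2) cont(2)] integrable_cube[OF periodic_dens cont(3)]
      integrable_weighted[OF periodic_comp[OF per_cont_inverse(1)] continuous_on_power[OF per_cont_inverse(2)]] by auto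
  have "dens gt x \<le> 1 / t * (dens gt x * u x) + t ^ CARD('n) * (dens gt x * (1 / u x) ^ CARD('n))" for x
  proof -
    have "1 \<le> u x / t + (t / u x) ^ CARD('n)"
    proof (cases "u x \<ge> t")
      case True
      then have "1 \<le> u x / t" using t by simp
      moreover have "0 \<le> (t / u x) ^ CARD('n)" using t u_pos[of x] by simp
      ultimately show ?thesis by linarith
    next
      case False
      then have "1 \<le> (t / u x) ^ CARD('n)" using u_pos[of x] by (intro one_le_power) simp
      moreover have "0 \<le> u x / t" using t u_pos[of x] by simp
      ultimately show ?thesis by linarith
    qed
    then have "dens gt x * 1 \<le> dens gt x * (u x / t + (t / u x) ^ CARD('n))"
      using dens_pos[OF gt, of x] by (intro mult_left_mono) auto
    then show ?thesis by (simp add: power_divide field_simps)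
  qed
  then have "(\<integral>x. dens gt x \<partial>cubeM) \<le> (\<integral>x. 1 / t * (dens gt x * u x) + t ^ CARD('n) * (dens gt x * (1 / u x) ^ CARD('n)) \<partial>cubeM)"
    using i by (intro integral_mono Bochner_Integration.integrable_add integrable_mult_right)
  also have "\<dots> = 1 / t * a + t ^ CARD('n) * (\<integral>x. dens gt x * (1 / u x) ^ CARD('n) \<partial>cubeM)"
    unfolding a_eq by (subst Bochner_Integration.integral_add) (use i in \<open>simp_all only: integrable_mult_right integral_mult_right_zero\<close>)
  also have "\<dots> \<le> 1 / t * a + t ^ CARD('n) * V"
    using inverse_power_integrals(1)[OF V] t by (intro add_left_mono mult_left_mono) auto
  finally have "1 \<le> 1 / t * a + t ^ CARD('n) * V" by (simp only: dens_integral)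
  moreover have "1 / t * a = a / t" by simp
  ultimately have "1/2 \<le> a / t" using t(2) by linarith
  then show ?thesis using t(1) by (simp add: pos_le_divide_eq)
qed

end

section \<open>Distances outside a small set\<close>

text \<open>The averaged bound is applied to an almost minimising curve of the limit metric.\<close>

lemma riem_dist_upper:
  fixes g0 gt gh :: "'n::finite tensor2" and \<phi> h :: "real^'n \<Rightarrow> real"
  assumes g0: "cont_tensor g0" and gh: "cont_tensor gh"
    and \<phi>: "\<And>x. \<phi> x \<ge> 0" "\<And>x. \<phi> x \<le> c + h x" and c: "c > 0"
    and h: "segment_average h"
    and conf: "\<And>x v. speed gh x v = \<phi> x * speed gt x v"
    and near: "\<And>x y v. y \<in> hbox \<rho> \<Longrightarrow> speed gt (x + y) v \<le> (1 + \<eta>) * speed g0 x v" and \<eta>: "0 < \<eta>" "\<eta> \<le> 1"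
    and L: "\<And>x v. speed gt x v \<le> L * norm v" "L \<ge> 0"
    and g0_nonneg: "\<And>x v. speed g0 x v \<ge> 0"
    and \<rho>: "0 < \<rho>" "\<rho> \<le> 1/4"
    and fin: "edist (\<lambda>p. c\<^sup>2 *\<^sub>R g0 p) p q < \<infinity>" and D: "riem_dist (\<lambda>p. c\<^sup>2 *\<^sub>R g0 p) p q \<le> D"
    and \<kappa>: "\<And>x. torus_proj x = p \<or> torus_proj x = q \<Longrightarrow> segment_mean h x \<le> ennreal \<kappa>"
      "(\<integral>x. h x \<partial>cubeM) \<le> \<kappa>" "\<kappa> \<ge> 0"
  shows "riem_dist gh p q \<le> riem_dist (\<lambda>p. c\<^sup>2 *\<^sub>R g0 p) p q + \<eta> * (D + 2) + 2 * (L * (real CARD('n) * \<rho>)) * c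
     + (2 * (L * (real CARD('n) * \<rho>)) + 2 * (D + 1) / c) * \<kappa> / (2 * \<rho>) ^ CARD('n)"
proof -
  define \<mu> where "\<mu> = L * (real CARD('n) * \<rho>)"
  define V where "V = (2 * \<rho>) ^ CARD('n)"
  define d where "d = riem_dist (\<lambda>p. c\<^sup>2 *\<^sub>R g0 p) p q"
  have V: "V > 0" "measure lborel (hbox \<rho> :: (real^'n) set) = V" using \<rho> by (simp_all add: V_def measure_hbox)
  have mu: "\<mu> \<ge> 0" using L \<rho> by (simp add: \<mu>_def)
  have d: "0 \<le> d" "d \<le> D" "edist (\<lambda>p. c\<^sup>2 *\<^sub>R g0 p) p q = ennreal d"
    using D fin by (auto simp: d_def riem_dist_edist)
  have "edist (\<lambda>p. c\<^sup>2 *\<^sub>R g0 p) p q < ennreal (d + \<eta>)" unfolding d(3) using \<eta> d by (simp add: ennreal_less_iff)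
  then obtain \<gamma> where \<gamma>: "valid_path \<gamma>" "torus_proj (\<gamma> 0) = p" "torus_proj (\<gamma> 1) = q"
    "curve_length (\<lambda>p. c\<^sup>2 *\<^sub>R g0 p) \<gamma> < ennreal (d + \<eta>)"
    unfolding edist_def INF_less_iff by blast
  have "ennreal c * curve_length g0 \<gamma> \<le> curve_length (\<lambda>p. c\<^sup>2 *\<^sub>R g0 p) \<gamma>"
    by (rule curve_length_scale_le[OF g0 _ _ \<gamma>(1)]) (use c in \<open>auto simp: speed_conformal\<close>)
  also have "\<dots> \<le> ennreal (d + \<eta>)" using \<gamma>(4) by simp
  finally have cl: "ennreal c * curve_length g0 \<gamma> \<le> ennreal (d + \<eta>)" .
  have "curve_length g0 \<gamma> = ennreal (1 / c) * (ennreal c * curve_length g0 \<gamma>)"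
    using c by (simp add: mult.assoc[symmetric] ennreal_mult[symmetric])
  also have "\<dots> \<le> ennreal (1 / c) * ennreal (d + \<eta>)" by (intro mult_left_mono cl) auto
  also have "\<dots> = ennreal ((d + \<eta>) / c)" using c d \<eta> by (subst ennreal_mult[symmetric]) auto
  finally have len: "curve_length g0 \<gamma> \<le> ennreal ((d + \<eta>) / c)" .
  let ?l = "(d + \<eta>) / c"
  have l0: "?l \<ge> 0" using d \<eta> c by simp
  have "ennreal V * edist gh p q \<le> ennreal V * (ennreal (2 * \<mu> * c) + ennreal ((1 + \<eta>) * c) * curve_length g0 \<gamma>)
      + ennreal \<mu> * (segment_mean h (\<gamma> 0) + segment_mean h (\<gamma> 1))
      + ennreal (1 + \<eta>) * (curve_length g0 \<gamma> * ennreal (\<integral>x. h x \<partial>cubeM))"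
    using distance_average_bound[OF g0 gh \<phi> less_imp_le[OF c] h conf near less_imp_le[OF \<eta>(1)] L g0_nonneg \<rho> \<gamma>(1)]
    unfolding V(2) \<gamma>(2,3) \<mu>_def .
  also have "\<dots> \<le> ennreal V * (ennreal (2 * \<mu> * c) + ennreal ((1 + \<eta>) * c) * ennreal ?l)
      + ennreal \<mu> * (ennreal \<kappa> + ennreal \<kappa>) + ennreal (1 + \<eta>) * (ennreal ?l * ennreal \<kappa>)"
    by (intro add_mono mult_left_mono mult_mono len \<kappa>(1) ennreal_leI \<kappa>(2)) (use \<gamma> mu in auto)
  also have "\<dots> = ennreal (V * (2 * \<mu> * c + (1 + \<eta>) * c * ?l) + \<mu> * (\<kappa> + \<kappa>) + (1 + \<eta>) * (?l * \<kappa>))"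
  proof -
    have "ennreal X1 * (ennreal X2 + ennreal X3 * ennreal X4) + ennreal X5 * (ennreal X6 + ennreal X7) + ennreal X8 * (ennreal X4 * ennreal X7)
      = ennreal (X1 * (X2 + X3 * X4) + X5 * (X6 + X7) + X8 * (X4 * X7))"
      if "X1 \<ge> 0" "X2 \<ge> 0" "X3 \<ge> 0" "X4 \<ge> 0" "X5 \<ge> 0" "X6 \<ge> 0" "X7 \<ge> 0" "X8 \<ge> 0" for X1 X2 X3 X4 X5 X6 X7 X8
      using that by (simp add: ennreal_mult)
    then show ?thesis by this (use V mu c \<eta> l0 \<kappa>(3) in auto)
  qed
  finally have 1: "ennreal V * edist gh p q \<le> ennreal (V * (2 * \<mu> * c + (1 + \<eta>) * c * ?l) + \<mu> * (\<kappa> + \<kappa>) + (1 + \<eta>) * (?l * \<kappa>))" (is "_ \<le> ennreal ?R") .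
  have R0: "?R \<ge> 0" using V mu c \<eta> l0 \<kappa>(3) by (intro add_nonneg_nonneg mult_nonneg_nonneg) auto
  have "V * riem_dist gh p q = enn2real (ennreal V * edist gh p q)"
    using V by (simp add: riem_dist_edist enn2real_mult)
  also have "\<dots> \<le> enn2real (ennreal ?R)" using 1 by (intro enn2real_mono) auto
  also have "\<dots> = ?R" using R0 by simp
  finally have "riem_dist gh p q \<le> ?R / V" using V by (simp add: pos_le_divide_eq mult.commute)
  also have "\<dots> = 2 * \<mu> * c + (1 + \<eta>) * (d + \<eta>) + (2 * \<mu> + (1 + \<eta>) * ?l) * \<kappa> / V"
    using V c by (simp add: field_simps)
  also have "\<dots> \<le> 2 * \<mu> * c + (d + \<eta> * (D + 2)) + (2 * \<mu> + 2 * (D + 1) / c) * \<kappa> / V"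
  proof (intro add_mono divide_right_mono mult_right_mono order_refl)
    have "\<eta> * d \<le> \<eta> * D" "\<eta> * \<eta> \<le> \<eta> * 1" using \<eta> d by (auto intro: mult_left_mono)
    then show "(1 + \<eta>) * (d + \<eta>) \<le> d + \<eta> * (D + 2)" by (simp add: algebra_simps)
    have "(1 + \<eta>) * ?l \<le> 2 * ((D + 1) / c)"
      using \<eta> d c l0 by (intro mult_mono divide_right_mono) auto
    then show "(1 + \<eta>) * ?l \<le> 2 * (D + 1) / c" by simp
  qed (use V \<kappa> mu c in auto)
  finally show ?thesis by (simp add: d_def \<mu>_def V_def)
qed

lemma subsequence_with_rate:
  fixes X :: "nat \<Rightarrow> real"
  assumes "X \<longlonglongrightarrow> 0" "\<And>k. e k > 0"
  obtains r :: "nat \<Rightarrow> nat" where "strict_mono r" "\<And>k. X (r k) \<le> e k"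
proof -
  have "\<exists>N. \<forall>j\<ge>N. X j \<le> e k" for k
    using order_tendstoD(2)[OF assms(1) assms(2)[of k]] by (auto simp: eventually_sequentially intro: less_imp_le)
  then obtain N where N: "\<And>k j. j \<ge> N k \<Longrightarrow> X j \<le> e k" by metis
  define r where "r k = (\<Sum>i\<le>k. Suc (N i))" for k
  have "strict_mono r" by (rule strict_mono_Suc_iff[THEN iffD2]) (simp add: r_def)
  moreover have "N k \<le> r k" for k
  proof -
    have "Suc (N k) \<le> r k" unfolding r_def by (rule member_le_sum) auto
    then show ?thesis by simp
  qed
  then have "X (r k) \<le> e k" for k by (rule N)
  ultimately show thesis by (rule that)
qed

text \<open>A Borel-Cantelli argument: summable means of \<open>h\<close> make its segment means small off a small set.\<close>

lemma small_segment_means: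
  fixes g :: "'n::finite tensor2"
  assumes g: "riemannian_metric g" and eps: "\<epsilon> > 0"
  obtains \<tau> where "\<tau> > 0" "\<tau> \<le> 1"
    "\<And>h :: nat \<Rightarrow> real^'n \<Rightarrow> real. (\<And>k. segment_average (h k)) \<Longrightarrow>
      (\<And>k. (\<integral>x. h k x \<partial>cubeM) \<le> \<tau> * (1/4) ^ k) \<Longrightarrow>
      \<exists>A\<in>sets borel. riem_volume g - \<epsilon> \<le> measure (volume_measure g) A \<and>
        (\<forall>k x. torus_proj x \<in> A \<longrightarrow> segment_mean (h k) x \<le> ennreal ((1/2) ^ k))"
proof -
  note [measurable] = measurable_dens[OF g]
  obtain M where M: "M > 0" "\<And>x. \<bar>dens g x\<bar> \<le> M"
    using periodic_bounded[OF periodic_dens continuous_dens[OF g]] by blast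
  define v where "v = measure lborel (hbox (1/4) :: (real^'n) set)"
  have v: "v \<ge> 0" by (simp add: v_def)
  define \<tau> where "\<tau> = min 1 (\<epsilon> / (4 * M * (v + 1)))"
  have tau: "\<tau> > 0" "\<tau> \<le> 1" using eps M v by (auto simp: \<tau>_def)
  have tau': "4 * M * v * \<tau> \<le> \<epsilon>"
  proof -
    have "4 * M * v * \<tau> \<le> 4 * M * (v + 1) * (\<epsilon> / (4 * M * (v + 1)))"
      using M v tau by (intro mult_mono) (auto simp: \<tau>_def)
    also have "\<dots> = \<epsilon>" using M v by simp
    finally show ?thesis .
  qed
  have "\<exists>A\<in>sets borel. riem_volume g - \<epsilon> \<le> measure (volume_measure g) A \<and>
        (\<forall>k x. torus_proj x \<in> A \<longrightarrow> segment_mean (h k) x \<le> ennreal ((1/2) ^ k))"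
    if h: "\<And>k. segment_average (h k)" and small: "\<And>k. (\<integral>x. h k x \<partial>cubeM) \<le> \<tau> * (1/4) ^ k"
    for h :: "nat \<Rightarrow> real^'n \<Rightarrow> real"
  proof -
    define s where "s k x = enn2real (segment_mean (h k) x)" for k x
    have s: "segment_mean (h k) x = ennreal (s k x)" "s k x \<ge> 0" for k x
      using segment_average.segment_mean_sm[OF h, of k x] segment_average.sm_def[OF h] by (auto simp: s_def)
    have sc: "continuous_on UNIV (s k)" for k
      using segment_average.continuous_sm[OF h, of k] segment_average.sm_def[OF h] by (simp add: s_def [abs_def])
    have sp: "periodic (s k)" for k
      using segment_average.periodic_segment_mean[OF h, of k] by (simp add: s_def [abs_def] periodic_comp)
    define B where "B k = {p. s k (rep_torus p) > (1/2) ^ k}" for k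
    have proj: "torus_proj x \<in> B k \<longleftrightarrow> s k x > (1/2) ^ k" for x k
      using periodicD[OF sp, of "rep_torus (torus_proj x)" x] by (simp add: B_def)
    have Bm [measurable]: "B k \<in> sets borel" for k
    proof -
      have "torus_proj -` B k = {x. (1/2) ^ k < s k x}" using proj by auto
      moreover have "open {x. (1/2) ^ k < s k x}" by (intro open_Collect_less continuous_intros sc)
      ultimately have "open (B k)" by (simp add: open_torus_def)
      then show ?thesis by simp
    qed
    have Bk: "emeasure (volume_measure g) (B k) \<le> ennreal (2 * M * v * \<tau> * (1/2) ^ k)" for k
    proof -
      have [measurable]: "segment_mean (h k) \<in> borel_measurable borel"
        by (rule segment_average.segment_mean_measurable[OF h])
      have "emeasure (volume_measure g) (B k) = (\<integral>\<^sup>+x. ennreal (dens g x) * indicator (B k) (torus_proj x) \<partial>cubeM)"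
        by (rule emeasure_volume[OF g]) measurable
      also have "\<dots> \<le> (\<integral>\<^sup>+x. ennreal (M * 2 ^ k) * segment_mean (h k) x \<partial>cubeM)"
      proof (rule nn_integral_mono)
        fix x
        show "ennreal (dens g x) * indicator (B k) (torus_proj x) \<le> ennreal (M * 2 ^ k) * segment_mean (h k) x"
        proof (cases "torus_proj x \<in> B k")
          case True
          then have "(1/2) ^ k < s k x" using proj by blast
          then have "1 \<le> 2 ^ k * s k x" by (simp add: power_one_over field_simps)
          then have "dens g x * 1 \<le> M * (2 ^ k * s k x)"
            using M(2)[of x] M(1) by (intro mult_mono) auto
          then have "ennreal (dens g x) \<le> ennreal (M * 2 ^ k * s k x)" by (intro ennreal_leI) (simp add: mult.assoc)
          then show ?thesis using True M s by (simp add: ennreal_mult)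
        qed simp
      qed
      also have "\<dots> = ennreal (M * 2 ^ k) * (2 * emeasure lborel (hbox (1/4) :: (real^'n) set) * ennreal (\<integral>x. h k x \<partial>cubeM))"
        by (simp add: nn_integral_cmult segment_average.integral_segment_mean[OF h])
      also have "\<dots> \<le> ennreal (M * 2 ^ k) * (2 * ennreal v * ennreal (\<tau> * (1/4) ^ k))"
        unfolding emeasure_hbox v_def[symmetric] by (intro mult_left_mono ennreal_leI small) auto
      also have "\<dots> = ennreal ((M * 2 ^ k) * (2 * v * (\<tau> * (1/4) ^ k)))"
        using M v tau by (simp add: ennreal_mult mult_ac)
      also have "(M * 2 ^ k) * (2 * v * (\<tau> * (1/4) ^ k)) = 2 * M * v * \<tau> * (2 ^ k * (1/4) ^ k)" by (simp add: mult_ac)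
      also have "2 ^ k * (1/4) ^ k = ((1/2) ^ k :: real)" by (simp flip: power_mult_distrib)
      finally show ?thesis .
    qed
    define A where "A = - (\<Union>k. B k)"
    have A: "A \<in> sets borel" unfolding A_def by measurable
    have sets: "sets (volume_measure g) = sets borel" "space (volume_measure g) = UNIV" by (simp_all add: volume_measure_def)
    have "emeasure (volume_measure g) (\<Union>k. B k) \<le> (\<Sum>k. emeasure (volume_measure g) (B k))"
      by (intro emeasure_subadditive_countably) (auto simp: sets)
    also have "\<dots> \<le> (\<Sum>k. ennreal (2 * M * v * \<tau> * (1/2) ^ k))" by (intro suminf_le Bk) auto
    also have "\<dots> = ennreal (2 * M * v * \<tau> * 2)"
    proof (rule suminf_ennreal_eq)
      show "0 \<le> 2 * M * v * \<tau> * (1/2) ^ k" for k using M v tau by simp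
      show "(\<lambda>k. 2 * M * v * \<tau> * (1/2) ^ k) sums (2 * M * v * \<tau> * 2)"
        by (intro sums_mult) (use geometric_sums[of "1/2::real"] in simp)
    qed
    also have "\<dots> \<le> ennreal \<epsilon>" using tau' by (intro ennreal_leI) simp
    finally have Ac: "emeasure (volume_measure g) (\<Union>k. B k) \<le> ennreal \<epsilon>" .
    interpret finite_measure "volume_measure g"
    proof
      have "emeasure (volume_measure g) UNIV \<le> (\<integral>\<^sup>+x. ennreal M \<partial>(cubeM :: (real^'n) measure))"
        unfolding emeasure_volume[OF g space_in_borel]
        by (intro nn_integral_mono) (use M in \<open>auto simp: abs_le_iff intro!: ennreal_leI\<close>)
      also have "\<dots> < top" by (simp add: emeasure_cubeM)
      finally show "emeasure (volume_measure g) (space (volume_measure g)) \<noteq> \<infinity>" by (simp add: sets)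
    qed
    have "measure (volume_measure g) (\<Union>k. B k) \<le> \<epsilon>"
      using Ac eps by (simp add: emeasure_eq_measure)
    moreover have "measure (volume_measure g) A = riem_volume g - measure (volume_measure g) (\<Union>k. B k)"
      unfolding A_def riem_volume_def Compl_eq_Diff_UNIV
      by (rule finite_measure_Diff) (auto simp: sets)
    ultimately have "riem_volume g - \<epsilon> \<le> measure (volume_measure g) A" by simp
    moreover have "segment_mean (h k) x \<le> ennreal ((1/2) ^ k)" if "torus_proj x \<in> A" for k x
      using that proj[of x k] s[of k x] by (auto simp: A_def not_less intro: ennreal_leI)
    ultimately show ?thesis using A by blast
  qed
  with tau that show thesis by blast
qed

lemma speed_upper:
  fixes g :: "'n::finite tensor2"
  assumes "uniformly_elliptic g \<nu> \<Lambda> \<Lambda>1"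
  shows "speed g x v \<le> sqrt (\<Lambda> * real CARD('n)) * norm v"
proof -
  have "\<bar>v \<bullet> (g (torus_proj x) *v v) - v \<bullet> (0 *v v)\<bar> \<le> \<Lambda> * real CARD('n) * (v \<bullet> v)"
    by (rule quadratic_form_close) (use assms in \<open>simp add: uniformly_elliptic_def\<close>)
  then have "v \<bullet> (g (torus_proj x) *v v) \<le> \<Lambda> * real CARD('n) * (norm v)\<^sup>2"
    by (simp add: abs_le_iff power2_norm_eq_inner)
  then have "speed g x v \<le> sqrt (\<Lambda> * real CARD('n) * (norm v)\<^sup>2)" unfolding speed_def by (rule real_sqrt_le_mono)
  then show ?thesis by (simp add: real_sqrt_mult)
qed

lemma speed_nonneg: "riemannian_metric g \<Longrightarrow> speed g x v \<ge> 0"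
  using posdef_riemannian[of g "torus_proj x"] by (cases "v = 0") (auto simp: speed_def posdef_def less_imp_le)

lemma quadratic_form_compare:
  fixes g :: "'n::finite tensor2" and A :: "real^'n^'n"
  assumes g: "uniformly_elliptic g \<nu> \<Lambda> \<Lambda>1" and \<eta>: "\<eta> \<ge> 0"
    and close: "\<And>i j. \<bar>A $ i $ j - g (torus_proj x) $ i $ j\<bar> \<le> \<eta> * \<nu> / real CARD('n)"
  shows "v \<bullet> (A *v v) \<le> (1 + \<eta>) * (v \<bullet> (g (torus_proj x) *v v))" "(1 - \<eta>) * (v \<bullet> (g (torus_proj x) *v v)) \<le> v \<bullet> (A *v v)"
proof -
  have "\<bar>v \<bullet> (A *v v) - v \<bullet> (g (torus_proj x) *v v)\<bar> \<le> \<eta> * \<nu> / real CARD('n) * real CARD('n) * (v \<bullet> v)"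
    by (rule quadratic_form_close[OF close])
  also have "\<dots> = \<eta> * (\<nu> * (v \<bullet> v))" by simp
  also have "\<dots> \<le> \<eta> * (v \<bullet> (g (torus_proj x) *v v))"
    using g \<eta> by (intro mult_left_mono) (auto simp: uniformly_elliptic_def)
  finally show "v \<bullet> (A *v v) \<le> (1 + \<eta>) * (v \<bullet> (g (torus_proj x) *v v))" "(1 - \<eta>) * (v \<bullet> (g (torus_proj x) *v v)) \<le> v \<bullet> (A *v v)"
    by (simp_all add: abs_le_iff algebra_simps)
qed

context conformal_torus
begin

lemma core_mass_pos: "core_mass CARD('n) \<Lambda> > 0"
  using Lam_pos by (simp add: core_mass_def core_radius_def)

lemma box_radius_pos: "box_radius \<nu> > 0"
  using nu by (simp add: box_radius_def)

lemma sup_const_nonneg: "sup_const CARD('n) \<nu> \<Lambda> \<Lambda>1 \<ge> 0"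
proof -
  have "\<Lambda>1 \<ge> 0" by (rule order_trans[OF abs_ge_zero Lam1])
  then have "Lip_const CARD('n) \<nu> \<Lambda> \<Lambda>1 \<ge> 0" using dens_upper_pos by (simp add: Lip_const_def)
  then have "mvK (real CARD('n)) (box_radius \<nu>) \<Lambda> (Lip_const CARD('n) \<nu> \<Lambda> \<Lambda>1) \<ge> 0"
    unfolding mvK_def using Lam_pos box_radius_pos by (intro mult_nonneg_nonneg add_nonneg_nonneg) auto
  then show ?thesis
    unfolding sup_const_def using dens_upper_pos dens_lower_pos core_mass_pos box_radius_pos
    by (intro divide_nonneg_nonneg mult_nonneg_nonneg add_nonneg_nonneg) auto
qed

text \<open>Lower bounds on the metric come from upper bounds on \<open>w\<close>.\<close>

lemma speed_lower:
  assumes g0: "uniformly_elliptic g0 \<nu>' \<Lambda>' \<Lambda>1'" and \<eta>: "0 \<le> \<eta>" "\<eta> < 1"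
    and close: "\<And>i j. \<bar>gt (torus_proj x) $ i $ j - g0 (torus_proj x) $ i $ j\<bar> \<le> \<eta> * \<nu>' / real CARD('n)"
    and w: "w x \<le> b\<^sup>2 / (1 - \<eta>)" and b: "b > 0"
  shows "(1 - \<eta>) * speed (\<lambda>p. (1 / b)\<^sup>2 *\<^sub>R g0 p) x v \<le> speed g x v"
proof -
  let ?q = "v \<bullet> (g0 (torus_proj x) *v v)"
  have rg: "riemannian_metric g0" using g0 by (simp add: uniformly_elliptic_def)
  have q: "?q \<ge> 0" using posdef_riemannian[OF rg] by (cases "v = 0") (auto simp: posdef_def less_imp_le)
  have "w x * (1 - \<eta>) \<le> b\<^sup>2" using w \<eta> by (simp add: pos_le_divide_eq)
  then have 1: "(1 - \<eta>) / b\<^sup>2 \<le> 1 / w x" using w_pos[of x] b by (simp add: field_simps)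
  have "(1 - \<eta>) / b\<^sup>2 * ((1 - \<eta>) * ?q) \<le> 1 / w x * (v \<bullet> (gt (torus_proj x) *v v))"
    using quadratic_form_compare(2)[OF g0 \<eta>(1) close] 1 \<eta> q b w_pos[of x]
    by (intro mult_mono) auto
  then have "sqrt (((1 - \<eta>) / b)\<^sup>2 * ?q) \<le> sqrt (1 / w x * (v \<bullet> (gt (torus_proj x) *v v)))"
    by (intro real_sqrt_le_mono) (simp add: power_divide power2_eq_square mult_ac)
  moreover have "sqrt (1 / w x * (v \<bullet> (gt (torus_proj x) *v v))) = speed g x v"
    unfolding speed_conf unfolding speed_def u_sqrt by (simp add: real_sqrt_mult real_sqrt_divide)
  moreover have "sqrt (((1 - \<eta>) / b)\<^sup>2 * ?q) = (1 - \<eta>) * (1 / b * speed g0 x v)"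
    using \<eta> b by (simp add: real_sqrt_mult speed_def)
  ultimately show ?thesis using b by (simp add: speed_conformal)
qed

end

section \<open>Convergence of the distances\<close>

theorem theorem1p6:
  fixes g gt :: "nat \<Rightarrow> 'n::finite tensor2"
    and g0 :: "'n tensor2"
    and f :: "nat \<Rightarrow> 'n torus \<Rightarrow> real"
    and D0 V0 C \<epsilon> :: real
  assumes dim: "CARD('n) \<ge> 3"
    and metric: "\<And>j. j \<ge> 1 \<Longrightarrow> riemannian_metric (g j)"
    and scal: "\<And>j p. j \<ge> 1 \<Longrightarrow> scalar_curvature (g j) p \<ge> - (1 / real j)"
    and diam: "\<And>j. j \<ge> 1 \<Longrightarrow> riem_diameter (g j) \<le> D0"
    and vol: "\<And>j. j \<ge> 1 \<Longrightarrow> riem_volume (g j) \<le> V0"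
    and g0: "riemannian_metric g0" "flat g0"
    and conformal: "\<And>j p. j \<ge> 1 \<Longrightarrow> g j p = exp (2 * f j p) *\<^sub>R gt j p"
    and background_metric: "\<And>j. j \<ge> 1 \<Longrightarrow> riemannian_metric (gt j)"
    and background_scal: "\<And>j. j \<ge> 1 \<Longrightarrow> \<exists>\<kappa>\<le>0. \<forall>p. scalar_curvature (gt j) p = \<kappa>"
    and background_vol: "\<And>j. j \<ge> 1 \<Longrightarrow> riem_volume (gt j) = 1"
    and background_conv: "C1_converges gt g0"
    and neg_exp: "\<And>j. j \<ge> 1 \<Longrightarrow> (\<integral>p. exp (- 2 * f j p) \<partial>volume_measure (gt j)) \<le> C"
    and eps: "0 < \<epsilon>" "\<epsilon> < riem_volume g0"
  shows "\<exists>(r :: nat \<Rightarrow> nat) (U :: 'n torus set) (c :: real).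
           strict_mono r \<and> (\<forall>k. r k \<ge> 1) \<and>
           U \<in> sets borel \<and> measure (volume_measure g0) U = riem_volume g0 - \<epsilon> \<and>
           c > 0 \<and>
           (\<lambda>k. ((1 / riem_volume (gt (r k))) * (\<integral>p. exp (- f (r k) p) \<partial>volume_measure (gt (r k))))
                   powi (-2)) \<longlonglongrightarrow> c\<^sup>2 \<and>
           uniform_limit (U \<times> U)
             (\<lambda>k (q1, q2). riem_dist (g (r k)) q1 q2)
             (\<lambda>(q1, q2). riem_dist (\<lambda>p. c\<^sup>2 *\<^sub>R g0 p) q1 q2) sequentially"
proof -
  obtain \<nu> \<Lambda> \<Lambda>1 where e0: "uniformly_elliptic g0 \<nu> \<Lambda> \<Lambda>1"
    and "\<forall>\<^sub>F j in sequentially. uniformly_elliptic (gt j) \<nu> \<Lambda> \<Lambda>1"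
    using C1_converges_uniformly_elliptic[OF background_conv g0(1) background_metric] by metis
  then obtain J0 where J0: "\<And>j. j \<ge> J0 \<Longrightarrow> uniformly_elliptic (gt j) \<nu> \<Lambda> \<Lambda>1"
    unfolding eventually_sequentially by blast
  define J where "J = max J0 1"
  have ct: "conformal_torus (g j) (gt j) (f j) \<nu> \<Lambda> \<Lambda>1 (1 / real j)" if "j \<ge> J" for j
  proof
    have j: "j \<ge> 1" "j \<ge> J0" using that by (auto simp: J_def)
    show "uniformly_elliptic (gt j) \<nu> \<Lambda> \<Lambda>1" by (rule J0[OF j(2)])
    show "riemannian_metric (g j)" by (rule metric[OF j(1)])
    show "g j p = exp (2 * f j p) *\<^sub>R gt j p" for p by (rule conformal[OF j(1)])
    show "- (1 / real j) \<le> scalar_curvature (g j) p" for p by (rule scal[OF j(1)])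
    show "scalar_curvature (gt j) p \<le> 0" for p using background_scal[OF j(1)] by auto
    show "riem_volume (gt j) = 1" by (rule background_vol[OF j(1)])
  qed (use dim in auto)
  define u where "u j x = exp (- f j (torus_proj x))" for j x
  define w where "w j x = (u j x)\<^sup>2" for j x
  define A where "A j = (\<integral>p. exp (- f j p) \<partial>volume_measure (gt j))" for j
  have u_eq: "conformal_torus.u (f j) = u j" if "j \<ge> J" for j
    using conformal_torus.u_def[OF ct[OF that]] by (simp add: u_def fun_eq_iff)
  have w_eq: "conformal_torus.w (f j) = w j" if "j \<ge> J" for j
    using conformal_torus.w_u[OF ct[OF that]] by (simp add: w_def fun_eq_iff u_eq[OF that])
  have A_eq: "conformal_torus.a (gt j) (f j) = A j" if "j \<ge> J" for j
    using conformal_torus.a_def[OF ct[OF that]] by (simp add: A_def)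
  have u_pos: "u j x > 0" for j x by (simp add: u_def)
  have pu: "periodic (u j)" for j by (simp add: periodic_def u_def)
  have cu: "continuous_on UNIV (u j)" if "j \<ge> J" for j
    using conformal_torus.cont(2)[OF ct[OF that]] by (simp add: u_eq[OF that])
  have cw: "continuous_on UNIV (w j)" if "j \<ge> J" for j
    unfolding w_def by (intro continuous_intros cu that)
  have pw: "periodic (w j)" for j unfolding w_def by (rule periodic_comp[OF pu])
  \<comment> \<open>The number \<open>t\<close> is so small that the volume bound keeps all means above \<open>t / 2\<close>.\<close>
  define t where "t = min 1 (1 / (2 * (\<bar>V0\<bar> + 1)))"
  have t: "t > 0" "t ^ CARD('n) * V0 \<le> 1/2"
  proof -
    show t0: "t > 0" by (simp add: t_def)
    have "t ^ CARD('n) \<le> t ^ 1" using t0 dim by (intro power_decreasing) (auto simp: t_def)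
    then have "t ^ CARD('n) * V0 \<le> t * (\<bar>V0\<bar> + 1)" using t0
      by (intro order_trans[OF mult_left_mono[of V0 "\<bar>V0\<bar> + 1"]] mult_right_mono) auto
    also have "\<dots> \<le> 1 / (2 * (\<bar>V0\<bar> + 1)) * (\<bar>V0\<bar> + 1)" by (intro mult_right_mono) (auto simp: t_def)
    also have "\<dots> = 1/2"
    proof -
      have "x > 0 \<Longrightarrow> 1 / (2 * x) * x = 1/2" for x :: real by simp
      from this[of "\<bar>V0\<bar> + 1"] show ?thesis by simp
    qed
    finally show "t ^ CARD('n) * V0 \<le> 1/2" .
  qed
  have A_bounds: "A j \<in> {t / 2..(1 + C) / 2}" if "j \<ge> J" for j
  proof -
    have j: "j \<ge> 1" using that by (simp add: J_def)
    show ?thesis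
      using conformal_torus.a_lower[OF ct[OF that] vol[OF j] t] conformal_torus.a_upper[OF ct[OF that] neg_exp[OF j]]
      by (simp add: A_eq[OF that])
  qed
  obtain a s where a: "a \<in> {t / 2..(1 + C) / 2}" and s: "strict_mono s" and "((\<lambda>k. A (J + k)) \<circ> s) \<longlonglongrightarrow> a"
  proof -
    have sc: "seq_compact {t / 2..(1 + C) / 2}"
      using compact_Icc compact_eq_seq_compact_metric by blast
    have "\<forall>k. A (J + k) \<in> {t / 2..(1 + C) / 2}" using A_bounds by simp
    from seq_compactE[OF sc this] show thesis using that by blast
  qed
  define r1 where "r1 k = J + s k" for k
  have r1: "strict_mono r1" "\<And>k. r1 k \<ge> J" using s by (auto simp: r1_def strict_mono_def)
  have Aa: "(\<lambda>k. A (r1 k)) \<longlonglongrightarrow> a"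
    using \<open>((\<lambda>k. A (J + k)) \<circ> s) \<longlonglongrightarrow> a\<close> by (simp add: r1_def o_def)
  have a_pos: "a > 0" using a t by auto
  define c where "c = 1 / a"
  have c: "c > 0" using a_pos by (simp add: c_def)
  have inv_r1: "(\<lambda>k. 1 / real (r1 k)) \<longlonglongrightarrow> 0"
    using LIMSEQ_subseq_LIMSEQ[OF lim_1_over_n r1(1)] by (simp add: o_def)
  define S where "S k = (\<integral>x. (u (r1 k) x - a)\<^sup>2 \<partial>cubeM)" for k
  have S0: "S k \<ge> 0" for k by (simp add: S_def)
  have iS: "integrable cubeM (\<lambda>x. (u (r1 k) x - b)\<^sup>2)" for k b
    by (intro integrable_cube periodic_comp[OF pu] continuous_intros cu r1)
  have S: "S \<longlonglongrightarrow> 0"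
  proof (rule tendsto_sandwich[of "\<lambda>_. 0" _ _ "\<lambda>k. 2 * (variance_const CARD('n) \<nu> \<Lambda> * (1 / real (r1 k))) + 2 * (A (r1 k) - a)\<^sup>2"])
    have "S k \<le> 2 * (variance_const CARD('n) \<nu> \<Lambda> * (1 / real (r1 k))) + 2 * (A (r1 k) - a)\<^sup>2" for k
    proof -
      have "(u (r1 k) x - a)\<^sup>2 \<le> 2 * (u (r1 k) x - A (r1 k))\<^sup>2 + 2 * (A (r1 k) - a)\<^sup>2" for x
        using sum_squares_bound[of "u (r1 k) x - A (r1 k)" "A (r1 k) - a"]
        by (simp add: power2_eq_square algebra_simps)
      then have "S k \<le> (\<integral>x. 2 * (u (r1 k) x - A (r1 k))\<^sup>2 + 2 * (A (r1 k) - a)\<^sup>2 \<partial>cubeM)"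
        unfolding S_def using iS by (intro integral_mono) auto
      also have "\<dots> = 2 * (\<integral>x. (u (r1 k) x - A (r1 k))\<^sup>2 \<partial>cubeM) + 2 * (A (r1 k) - a)\<^sup>2"
        using iS[of k "A (r1 k)"] by (simp add: measure_def emeasure_cubeM)
      also have "\<dots> \<le> 2 * (variance_const CARD('n) \<nu> \<Lambda> * (1 / real (r1 k))) + 2 * (A (r1 k) - a)\<^sup>2"
        using conformal_torus.variance_bound[OF ct[OF r1(2)], of k] by (simp add: u_eq[OF r1(2)] A_eq[OF r1(2)])
      finally show ?thesis .
    qed
    then show "\<forall>\<^sub>F k in sequentially. S k \<le> 2 * (variance_const CARD('n) \<nu> \<Lambda> * (1 / real (r1 k))) + 2 * (A (r1 k) - a)\<^sup>2"
      by simp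
    have "(\<lambda>k. 2 * (variance_const CARD('n) \<nu> \<Lambda> * (1 / real (r1 k))) + 2 * (A (r1 k) - a)\<^sup>2)
        \<longlonglongrightarrow> 2 * (variance_const CARD('n) \<nu> \<Lambda> * 0) + 2 * (a - a)\<^sup>2"
      by (intro tendsto_intros inv_r1 Aa)
    then show "(\<lambda>k. 2 * (variance_const CARD('n) \<nu> \<Lambda> * (1 / real (r1 k))) + 2 * (A (r1 k) - a)\<^sup>2) \<longlonglongrightarrow> 0" by simp
  qed (use S0 in auto)
  define I where "I k = (\<integral>x. \<bar>w (r1 k) x - a\<^sup>2\<bar> \<partial>cubeM)" for k
  have I: "I \<longlonglongrightarrow> 0"
  proof (rule tendsto_sandwich[of "\<lambda>_. 0" _ _ "\<lambda>k. S k + 2 * a * sqrt (S k)"])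
    have "I k \<le> S k + 2 * a * sqrt (S k)" for k
    proof -
      have pc: "periodic (\<lambda>x. u (r1 k) x - a)" "continuous_on UNIV (\<lambda>x. u (r1 k) x - a)"
        by (intro periodic_comp[OF pu] continuous_intros cu r1)+
      have i: "integrable cubeM (\<lambda>x. \<bar>u (r1 k) x - a\<bar>)" "integrable cubeM (\<lambda>x. \<bar>w (r1 k) x - a\<^sup>2\<bar>)"
        by (intro integrable_cube periodic_comp[OF pu] periodic_comp[OF pw] continuous_intros cu cw r1)+
      have "\<bar>w (r1 k) x - a\<^sup>2\<bar> \<le> (u (r1 k) x - a)\<^sup>2 + 2 * a * \<bar>u (r1 k) x - a\<bar>" for x
      proof -
        have "w (r1 k) x - a\<^sup>2 = (u (r1 k) x - a)\<^sup>2 + 2 * a * (u (r1 k) x - a)"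
          by (simp add: w_def power2_eq_square algebra_simps)
        then have "\<bar>w (r1 k) x - a\<^sup>2\<bar> \<le> \<bar>(u (r1 k) x - a)\<^sup>2\<bar> + \<bar>2 * a * (u (r1 k) x - a)\<bar>"
          by (metis abs_triangle_ineq)
        then show ?thesis using a_pos by (simp add: abs_mult)
      qed
      then have "I k \<le> (\<integral>x. (u (r1 k) x - a)\<^sup>2 + 2 * a * \<bar>u (r1 k) x - a\<bar> \<partial>cubeM)"
        unfolding I_def using i iS by (intro integral_mono) auto
      also have "\<dots> = S k + 2 * a * (\<integral>x. \<bar>u (r1 k) x - a\<bar> \<partial>cubeM)"
        unfolding S_def using i iS by simp
      also have "\<dots> \<le> S k + 2 * a * sqrt (S k)"
        using L1_le_L2_cube[OF pc] a_pos by (simp add: S_def)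
      finally show ?thesis .
    qed
    then show "\<forall>\<^sub>F k in sequentially. I k \<le> S k + 2 * a * sqrt (S k)" by simp
    have "(\<lambda>k. S k + 2 * a * sqrt (S k)) \<longlonglongrightarrow> 0 + 2 * a * sqrt 0" by (intro tendsto_intros S)
    then show "(\<lambda>k. S k + 2 * a * sqrt (S k)) \<longlonglongrightarrow> 0" by simp
  qed (auto simp: I_def)
  define H where "H k = (\<integral>x. \<bar>1 / u (r1 k) x - c\<bar> \<partial>cubeM)" for k
  define V1 where "V1 = 1 + \<bar>V0\<bar> / dens_lower CARD('n) \<nu>"
  have V1: "V1 > 0"
  proof -
    have "dens_lower CARD('n) \<nu> > 0" by (rule conformal_torus.dens_lower_pos[OF ct[OF order_refl]])
    then show ?thesis by (simp add: V1_def add_pos_nonneg)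
  qed
  have H: "H \<longlonglongrightarrow> 0"
  proof (rule LIMSEQ_I)
    fix e :: real assume e: "e > 0"
    define \<eta> where "\<eta> = e * a / (2 * V1)"
    have eta: "\<eta> > 0" using e a_pos V1 by (simp add: \<eta>_def)
    have "(\<lambda>k. 1 / a * (\<eta> / 2 * V1 + S k / (2 * \<eta>))) \<longlonglongrightarrow> 1 / a * (\<eta> / 2 * V1 + 0 / (2 * \<eta>))"
      by (intro tendsto_intros S) (use eta in auto)
    moreover have "1 / a * (\<eta> / 2 * V1 + 0 / (2 * \<eta>)) < e"
      using a_pos V1 e by (simp add: \<eta>_def)
    ultimately have "\<forall>\<^sub>F k in sequentially. 1 / a * (\<eta> / 2 * V1 + S k / (2 * \<eta>)) < e" by (rule order_tendstoD(2))
    then have "\<forall>\<^sub>F k in sequentially. norm (H k - 0) < e"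
    proof eventually_elim
      case (elim k)
      have j: "r1 k \<ge> 1" using r1(2)[of k] by (simp add: J_def)
      have V: "riem_volume (g (r1 k)) \<le> \<bar>V0\<bar>" using vol[OF j] by simp
      have "H k \<le> 1 / a * (\<eta> / 2 * V1 + S k / (2 * \<eta>))"
        using conformal_torus.inverse_L1_bound[OF ct[OF r1(2)] V a_pos eta]
        by (simp add: H_def S_def V1_def c_def u_eq[OF r1(2)])
      moreover have "H k \<ge> 0" by (simp add: H_def)
      ultimately show ?case using elim by simp
    qed
    then show "\<exists>N. \<forall>k\<ge>N. norm (H k - 0) < e" by (simp add: eventually_sequentially)
  qed
  \<comment> \<open>The radius \<open>r\<close> is fixed first, to make the part of \<open>sup_bound\<close> small that does not tend to zero.\<close>
  have w_upper: "\<forall>\<^sub>F k in sequentially. \<forall>x. w (r1 k) x \<le> a\<^sup>2 + \<eta>" if eta: "\<eta> > 0" for \<eta>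
  proof -
    define sc where "sc = sup_const CARD('n) \<nu> \<Lambda> \<Lambda>1"
    define cm where "cm = core_mass CARD('n) \<Lambda>"
    have sc: "sc \<ge> 0" unfolding sc_def by (rule conformal_torus.sup_const_nonneg[OF ct[OF order_refl]])
    have cm: "cm > 0" unfolding cm_def by (rule conformal_torus.core_mass_pos[OF ct[OF order_refl]])
    have R: "box_radius \<nu> > 0" by (rule conformal_torus.box_radius_pos[OF ct[OF order_refl]])
    define r where "r = min (min 1 (1 / (4 * box_radius \<nu>))) (min (1 / (2 * (sc + 1))) (\<eta> / (8 * (sc + 1) * (a\<^sup>2 + 1))))"
    have a1: "a\<^sup>2 + 1 > 0" by (simp add: add_nonneg_pos)
    have r: "0 < r" "r \<le> 1" "r * box_radius \<nu> < 1/2" "sc * r \<le> 1/2" "sc * r * (1 + a\<^sup>2) \<le> \<eta> / 8"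
    proof -
      show r0: "0 < r" "r \<le> 1" using R sc eta a1 by (auto simp: r_def)
      have "r * box_radius \<nu> \<le> 1 / (4 * box_radius \<nu>) * box_radius \<nu>"
        using R by (intro mult_right_mono) (auto simp: r_def)
      then show "r * box_radius \<nu> < 1/2" using R by simp
      have "sc * r \<le> (sc + 1) * (1 / (2 * (sc + 1)))" using sc r0 by (intro mult_mono) (auto simp: r_def)
      also have "\<dots> = 1/2"
      proof -
        have "x > 0 \<Longrightarrow> x * (1 / (2 * x)) = 1/2" for x :: real by simp
        from this[of "sc + 1"] show ?thesis using sc by linarith
      qed
      finally show "sc * r \<le> 1/2" .
      have "sc * r \<le> (sc + 1) * (\<eta> / (8 * (sc + 1) * (a\<^sup>2 + 1)))" using sc r0 by (intro mult_mono) (auto simp: r_def)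
      also have "\<dots> = \<eta> / (8 * (a\<^sup>2 + 1))"
      proof -
        have "x > 0 \<Longrightarrow> y > 0 \<Longrightarrow> x * (\<eta> / (8 * x * y)) = \<eta> / (8 * y)" for x y :: real by simp
        from this[of "sc + 1" "a\<^sup>2 + 1"] show ?thesis using sc a1 by linarith
      qed
      finally have "sc * r * (1 + a\<^sup>2) \<le> \<eta> / (8 * (a\<^sup>2 + 1)) * (1 + a\<^sup>2)" using a1 by (intro mult_right_mono) auto
      also have "\<dots> = \<eta> / 8"
      proof -
        have "y > 0 \<Longrightarrow> \<eta> / (8 * y) * y = \<eta> / 8" for y :: real by simp
        from this[OF a1] show ?thesis by (simp only: add.commute)
      qed
      finally show "sc * r * (1 + a\<^sup>2) \<le> \<eta> / 8" .
    qed
    have "(\<lambda>k. 2 * (1 / cm * ((1 / r) ^ CARD('n) * I k))) \<longlonglongrightarrow> 2 * (1 / cm * ((1 / r) ^ CARD('n) * 0))"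
      by (intro tendsto_intros I)
    then have "\<forall>\<^sub>F k in sequentially. 2 * (1 / cm * ((1 / r) ^ CARD('n) * I k)) < \<eta> / 2"
      by (rule order_tendstoD(2)) (use eta in simp)
    then show ?thesis
    proof eventually_elim
      case (elim k)
      show ?case
      proof
        fix x
        have j: "real (r1 k) \<ge> 1" using r1(2)[of k] by (simp add: J_def)
        have "w (r1 k) x - a\<^sup>2 \<le> 2 * (1 / cm * ((1 / r) ^ CARD('n) * I k) + sc * r * (1 / real (r1 k) + a\<^sup>2))"
          using conformal_torus.sup_bound[OF ct[OF r1(2)], of r "a\<^sup>2" k x] r sc cm
          by (simp add: sc_def cm_def I_def w_eq[OF r1(2)])
        moreover have "sc * r * (1 / real (r1 k) + a\<^sup>2) \<le> sc * r * (1 + a\<^sup>2)"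
          using j sc r by (intro mult_left_mono) auto
        ultimately show "w (r1 k) x \<le> a\<^sup>2 + \<eta>" using elim r(5) eta by simp
      qed
    qed
  qed
  \<comment> \<open>The rate \<open>(1/4)^k\<close> beats the loss \<open>2^k\<close> in the Markov inequality for the segment means.\<close>
  obtain \<tau> where tau: "\<tau> > 0" "\<tau> \<le> 1"
    "\<And>h :: nat \<Rightarrow> real^'n \<Rightarrow> real. (\<And>k. segment_average (h k)) \<Longrightarrow> (\<And>k. (\<integral>x. h k x \<partial>cubeM) \<le> \<tau> * (1/4) ^ k) \<Longrightarrow>
      \<exists>A\<in>sets borel. riem_volume g0 - \<epsilon> \<le> measure (volume_measure g0) A \<and>
        (\<forall>k x. torus_proj x \<in> A \<longrightarrow> segment_mean (h k) x \<le> ennreal ((1/2) ^ k))"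
    using small_segment_means[OF g0(1) eps(1)] by metis
  obtain r2 where r2: "strict_mono r2" "\<And>k. H (r2 k) \<le> \<tau> * (1/4) ^ k"
    using subsequence_with_rate[OF H, of "\<lambda>k. \<tau> * (1/4) ^ k"] tau(1) by auto
  define r where "r k = r1 (r2 k)" for k
  have r: "strict_mono r" "\<And>k. r k \<ge> J" "\<And>k. r k \<ge> 1"
  proof -
    show "strict_mono r" using r1(1) r2(1) by (simp add: r_def strict_mono_def)
    show "r k \<ge> J" "r k \<ge> 1" for k using r1(2)[of "r2 k"] by (auto simp: r_def J_def)
  qed
  have sub: "\<forall>\<^sub>F k in sequentially. P (r2 k)" if "\<forall>\<^sub>F k in sequentially. P k" for P
    using that filterlim_subseq[OF r2(1)] by (auto simp: filterlim_iff)
  define h where "h k x = \<bar>1 / u (r k) x - c\<bar>" for k x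
  have h: "segment_average (h k)" for k
  proof
    show "periodic (h k)" unfolding h_def by (rule periodic_comp[OF pu])
    show "continuous_on UNIV (h k)" unfolding h_def
      by (intro continuous_intros cu r) (use u_pos in \<open>simp add: less_imp_neq[THEN not_sym]\<close>)
  qed (simp add: h_def)
  have hH: "(\<integral>x. h k x \<partial>cubeM) \<le> \<tau> * (1/4) ^ k" for k
    using r2(2)[of k] by (simp add: h_def [abs_def] H_def r_def)
  obtain U0 where U0: "U0 \<in> sets borel" "riem_volume g0 - \<epsilon> \<le> measure (volume_measure g0) U0"
    "\<And>k x. torus_proj x \<in> U0 \<Longrightarrow> segment_mean (h k) x \<le> ennreal ((1/2) ^ k)"
    using tau(3)[OF h hH] by blast
  obtain U where U: "U \<subseteq> U0" "U \<in> sets borel" "measure (volume_measure g0) U = riem_volume g0 - \<epsilon>"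
    using exists_subset_of_volume[OF g0(1) U0(1) _ U0(2)] eps by auto
  have limit: "(\<lambda>k. ((1 / riem_volume (gt (r k))) * (\<integral>p. exp (- f (r k) p) \<partial>volume_measure (gt (r k)))) powi (-2)) \<longlonglongrightarrow> c\<^sup>2"
  proof -
    have "(\<lambda>k. A (r k)) \<longlonglongrightarrow> a"
      using LIMSEQ_subseq_LIMSEQ[OF Aa r2(1)] by (simp add: o_def r_def)
    then have "(\<lambda>k. A (r k) powi (-2)) \<longlonglongrightarrow> a powi (-2)"
      by (rule tendsto_power_int) (use a_pos in simp)
    moreover have "a powi (-2) = c\<^sup>2" by (simp add: c_def power_int_minus power_one_over inverse_eq_divide)
    ultimately show ?thesis using background_vol[OF r(3)] by (simp add: A_def)
  qed
  define L where "L = sqrt (\<Lambda> * real CARD('n))"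
  define G where "G = (\<lambda>p. c\<^sup>2 *\<^sub>R g0 p)"
  have nu: "\<nu> > 0" using e0 by (simp add: uniformly_elliptic_def)
  have "\<Lambda> > 0" by (rule conformal_torus.Lam_pos[OF ct[OF order_refl]])
  then have L: "L \<ge> 0" by (simp add: L_def)
  have ct0: "cont_tensor g0" by (rule cont_tensor_riemannian[OF g0(1)])
  have ctG: "cont_tensor G"
    using ct0 unfolding cont_tensor_def G_def by (simp add: continuous_on_mult_left)
  have ctg: "cont_tensor (g (r k))" for k by (rule cont_tensor_riemannian[OF metric[OF r(3)]])
  have sp: "speed g0 x v \<le> L * norm v" "speed (gt (r k)) x v \<le> L * norm v" for x v k
    unfolding L_def by (rule speed_upper[OF e0] speed_upper[OF J0]; use r(2)[of k] in \<open>simp add: J_def\<close>)+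
  have conf: "speed (g (r k)) x v = 1 / u (r k) x * speed (gt (r k)) x v" for k x v
    using conformal_torus.speed_conf[OF ct[OF r(2)]] by (simp add: u_eq[OF r(2)])
  define D where "D = c * L * real CARD('n)"
  have D0: "D \<ge> 0" using c L by (simp add: D_def)
  have "edist G p q \<le> ennreal D" for p q
    unfolding D_def by (rule edist_bounded) (use sp(1) c L in \<open>auto simp: G_def speed_conformal mult.assoc mult_left_mono\<close>)
  then have finG: "edist G p q < \<infinity>" and DG: "riem_dist G p q \<le> D" for p q
  proof -
    assume *: "\<And>p q. edist G p q \<le> ennreal D"
    show "edist G p q < \<infinity>" using *[of p q] by (auto intro: le_less_trans)
    show "riem_dist G p q \<le> D" unfolding riem_dist_edist by (rule enn2real_leI[OF D0 *])
  qed
  have fing: "edist (g (r k)) p q < \<infinity>" for k p q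
  proof -
    have "continuous_on UNIV (\<lambda>x. 1 / u (r k) x)"
      by (intro continuous_intros cu r) (use u_pos in \<open>simp add: less_imp_neq[THEN not_sym]\<close>)
    then obtain M where M: "M > 0" "\<And>x. \<bar>1 / u (r k) x\<bar> \<le> M"
      using periodic_bounded[OF periodic_comp[OF pu]] by blast
    have "edist (g (r k)) p q \<le> ennreal ((M * L) * real CARD('n))"
    proof (rule edist_bounded)
      fix x v
      have "1 / u (r k) x * speed (gt (r k)) x v \<le> M * (L * norm v)"
        using M(2)[of x] M(1) sp(2)[of k x v] speed_nonneg[OF background_metric[OF r(3)]] u_pos[of "r k" x]
        by (intro mult_mono) auto
      then show "speed (g (r k)) x v \<le> M * L * norm v" by (simp add: conf mult.assoc)
    qed (use M L in simp)
    then show ?thesis by (auto intro: le_less_trans)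
  qed
  have "uniform_limit (U \<times> U) (\<lambda>k (q1, q2). riem_dist (g (r k)) q1 q2) (\<lambda>(q1, q2). riem_dist G q1 q2) sequentially"
  proof (rule uniform_limitI)
    fix e :: real assume e: "e > 0"
    define \<eta> where "\<eta> = min (1/2) (e / (8 * (D + 2)))"
    have eta: "0 < \<eta>" "\<eta> < 1" "\<eta> * (D + 2) \<le> e / 8" "\<eta> * D \<le> e / 8"
    proof -
      show e1: "0 < \<eta>" "\<eta> < 1" using e D0 by (auto simp: \<eta>_def)
      have "\<eta> * (D + 2) \<le> e / (8 * (D + 2)) * (D + 2)" using D0 by (intro mult_right_mono) (auto simp: \<eta>_def)
      also have "\<dots> = e / 8"
      proof -
        have "y > 0 \<Longrightarrow> e / (8 * y) * y = e / 8" for y :: real by simp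
        from this[of "D + 2"] show ?thesis using D0 by linarith
      qed
      finally show e2: "\<eta> * (D + 2) \<le> e / 8" .
      have "\<eta> * D \<le> \<eta> * (D + 2)" using e1 by (intro mult_left_mono) auto
      then show "\<eta> * D \<le> e / 8" using e2 by linarith
    qed
    define \<sigma> where "\<sigma> = \<eta> * \<nu> / real CARD('n)"
    have sg: "\<sigma> > 0" using eta nu by (simp add: \<sigma>_def)
    have "\<exists>d>0. \<forall>x y. y \<in> hbox d \<longrightarrow> \<bar>g0 (torus_proj (x + y)) $ i $ k - g0 (torus_proj x) $ i $ k\<bar> \<le> \<sigma> / 2" for i k
    proof -
      have "continuous_on UNIV (\<lambda>x. g0 (torus_proj x) $ i $ k)" using ct0 by (simp add: cont_tensor_def)
      from periodic_uniformly_continuous[OF periodic_tensor this, of "\<sigma> / 2"] show ?thesis using sg by (metis half_gt_zero)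
    qed
    then obtain d where d: "\<And>i k. d i k > 0"
      "\<And>i k x y. y \<in> hbox (d i k) \<Longrightarrow> \<bar>g0 (torus_proj (x + y)) $ i $ k - g0 (torus_proj x) $ i $ k\<bar> \<le> \<sigma> / 2" by metis
    define d' where "d' = Min (range (\<lambda>(i, k). d i k))"
    have d': "d' > 0" "d' \<le> d i k" for i k
    proof -
      show "d' > 0" unfolding d'_def by (subst Min_gr_iff) (use d in auto)
      show "d' \<le> d i k" unfolding d'_def by (rule Min_le) (auto intro: rev_image_eqI[of "(i, k)"])
    qed
    define \<rho> where "\<rho> = min d' (min (1/4) (e / (16 * (L * real CARD('n) * c + 1))))"
    have Lnc: "L * real CARD('n) * c \<ge> 0" using L c by simp
    have rho: "0 < \<rho>" "\<rho> \<le> 1/4" "\<rho> \<le> d'" "2 * (L * (real CARD('n) * \<rho>)) * c \<le> e / 8"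
    proof -
      have "e / (16 * (L * real CARD('n) * c + 1)) > 0" using e Lnc by (intro divide_pos_pos) auto
      then show r0: "0 < \<rho>" "\<rho> \<le> 1/4" "\<rho> \<le> d'" unfolding \<rho>_def using d' by linarith+
      have "(L * real CARD('n) * c) * \<rho> \<le> (L * real CARD('n) * c + 1) * (e / (16 * (L * real CARD('n) * c + 1)))"
        using Lnc r0 by (intro mult_mono) (auto simp: \<rho>_def)
      also have "\<dots> = e / 16"
      proof -
        have "y > 0 \<Longrightarrow> y * (e / (16 * y)) = e / 16" for y :: real by simp
        from this[of "L * real CARD('n) * c + 1"] show ?thesis using Lnc by linarith
      qed
      finally show "2 * (L * (real CARD('n) * \<rho>)) * c \<le> e / 8" by (simp add: mult_ac)
    qed
    define B where "B = (2 * (L * (real CARD('n) * \<rho>)) + 2 * (D + 1) / c) / (2 * \<rho>) ^ CARD('n)"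
    have "(\<lambda>k. B * (1/2) ^ k) \<longlonglongrightarrow> B * 0" by (intro tendsto_intros LIMSEQ_power_zero) simp
    then have ev1: "\<forall>\<^sub>F k in sequentially. B * (1/2) ^ k < e / 8"
      by (rule order_tendstoD(2)) (use e in simp)
    have close: "\<forall>\<^sub>F k in sequentially. \<forall>i l x. \<bar>gt (r k) (torus_proj x) $ i $ l - g0 (torus_proj x) $ i $ l\<bar> \<le> \<sigma> / 2"
    proof -
      have "\<forall>\<^sub>F j in sequentially. \<forall>i l x. \<bar>gt j (torus_proj x) $ i $ l - g0 (torus_proj x) $ i $ l\<bar> \<le> \<sigma> / 2"
        using C1_converges_close[OF background_conv half_gt_zero[OF sg]] by (rule eventually_mono) blast
      then show ?thesis using filterlim_subseq[OF r(1)] by (auto simp: filterlim_iff)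
    qed
    have "a\<^sup>2 / (1 - \<eta>) - a\<^sup>2 > 0"
    proof -
      have "a\<^sup>2 * (1 - \<eta>) < a\<^sup>2 * 1" using a_pos eta by (intro mult_strict_left_mono) auto
      then show ?thesis using eta by (simp add: pos_less_divide_eq)
    qed
    from sub[OF w_upper[OF this]]
    have ev2: "\<forall>\<^sub>F k in sequentially. \<forall>x. w (r k) x \<le> a\<^sup>2 / (1 - \<eta>)" by (simp add: r_def)
    show "\<forall>\<^sub>F k in sequentially. \<forall>x\<in>U \<times> U. dist (case x of (q1, q2) \<Rightarrow> riem_dist (g (r k)) q1 q2) (case x of (q1, q2) \<Rightarrow> riem_dist G q1 q2) < e"
      using ev1 close ev2
    proof eventually_elim
      case (elim k)
      have cl: "\<bar>gt (r k) (torus_proj x) $ i $ l - g0 (torus_proj x) $ i $ l\<bar> \<le> \<eta> * \<nu> / real CARD('n)" for i l x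
        using elim(2)[rule_format, of x i l] sg by (simp add: \<sigma>_def)
      have lower: "riem_dist G p q - e / 8 \<le> riem_dist (g (r k)) p q" for p q
      proof -
        have "(1 - \<eta>) * riem_dist G p q \<le> riem_dist (g (r k)) p q"
        proof (rule riem_dist_lower[OF ctG _ _ fing])
          fix x v
          have "conformal_torus.w (f (r k)) x \<le> a\<^sup>2 / (1 - \<eta>)" using elim(3) by (simp add: w_eq[OF r(2)])
          then show "(1 - \<eta>) * speed G x v \<le> speed (g (r k)) x v"
            using conformal_torus.speed_lower[OF ct[OF r(2)] e0 less_imp_le[OF eta(1)] eta(2) cl _ a_pos]
            unfolding G_def c_def by blast
        qed (use eta in simp)
        moreover have "\<eta> * riem_dist G p q \<le> \<eta> * D" using eta DG by (intro mult_left_mono) auto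
        ultimately show ?thesis using eta(4) by (simp add: left_diff_distrib)
      qed
      have upper: "riem_dist (g (r k)) p q \<le> riem_dist G p q + 3 * (e / 8)" if pq: "p \<in> U" "q \<in> U" for p q
      proof -
        have near: "speed (gt (r k)) (x + y) v \<le> (1 + \<eta>) * speed g0 x v" if y: "y \<in> hbox \<rho>" for x y v
        proof -
          have "\<bar>gt (r k) (torus_proj (x + y)) $ i $ l - g0 (torus_proj x) $ i $ l\<bar> \<le> \<eta> * \<nu> / real CARD('n)" for i l
          proof -
            have "y \<in> hbox (d i l)" using y rho(3) d'(2)[of i l] unfolding mem_hbox by (meson order_trans)
            from d(2)[OF this, of x] elim(2)[rule_format, of "x + y" i l] show ?thesis
              unfolding \<sigma>_def[symmetric] by linarith
          qed
          from quadratic_form_compare(1)[OF e0 less_imp_le[OF eta(1)] this, of v]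
          have "speed (gt (r k)) (x + y) v \<le> sqrt ((1 + \<eta>) * (v \<bullet> (g0 (torus_proj x) *v v)))"
            unfolding speed_def by (rule real_sqrt_le_mono)
          also have "\<dots> = sqrt (1 + \<eta>) * speed g0 x v" by (simp add: speed_def real_sqrt_mult)
          also have "\<dots> \<le> (1 + \<eta>) * speed g0 x v"
          proof (rule mult_right_mono[OF _ speed_nonneg[OF g0(1)]])
            have "sqrt (1 + \<eta>) \<le> sqrt ((1 + \<eta>)\<^sup>2)"
              using eta by (intro real_sqrt_le_mono self_le_power) auto
            then show "sqrt (1 + \<eta>) \<le> 1 + \<eta>" using eta by simp
          qed
          finally show ?thesis .
        qed
        have h4: "\<tau> * (1/4) ^ k \<le> (1/2) ^ k"
        proof -
          have "\<tau> * (1/4) ^ k \<le> 1 * (1/2 :: real) ^ k"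
            using tau by (intro mult_mono power_mono) auto
          then show ?thesis by simp
        qed
        have "riem_dist (g (r k)) p q \<le> riem_dist G p q + \<eta> * (D + 2) + 2 * (L * (real CARD('n) * \<rho>)) * c
           + (2 * (L * (real CARD('n) * \<rho>)) + 2 * (D + 1) / c) * (1/2) ^ k / (2 * \<rho>) ^ CARD('n)"
          unfolding G_def
        proof (rule riem_dist_upper[where \<phi> = "\<lambda>x. 1 / u (r k) x" and gt = "gt (r k)" and h = "h k"])
          show "1 / u (r k) x \<ge> 0" for x using u_pos[of "r k" x] by simp
          show "1 / u (r k) x \<le> c + h k x" for x by (simp add: h_def)
          show "edist (\<lambda>p. c\<^sup>2 *\<^sub>R g0 p) p q < \<infinity>" "riem_dist (\<lambda>p. c\<^sup>2 *\<^sub>R g0 p) p q \<le> D"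
            using finG DG by (simp_all add: G_def)
          show "segment_mean (h k) x \<le> ennreal ((1/2) ^ k)" if "torus_proj x = p \<or> torus_proj x = q" for x
            using that pq U(1) U0(3) by auto
          show "(\<integral>x. h k x \<partial>cubeM) \<le> (1/2) ^ k" using hH[of k] h4 by linarith
        qed (use ct0 ctg c h conf near eta L sp speed_nonneg[OF g0(1)] rho in auto)
        also have "(2 * (L * (real CARD('n) * \<rho>)) + 2 * (D + 1) / c) * (1/2) ^ k / (2 * \<rho>) ^ CARD('n) = B * (1/2) ^ k"
          by (simp add: B_def)
        finally show ?thesis using elim(1) eta(3) rho(4) by linarith
      qed
      show ?case
      proof (clarify)
        fix q1 q2 assume "q1 \<in> U" "q2 \<in> U"
        then show "dist (riem_dist (g (r k)) q1 q2) (riem_dist G q1 q2) < e"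
          using lower[of q1 q2] upper[of q1 q2] e by (simp add: dist_real_def abs_less_iff)
      qed
    qed
  qed
  then show ?thesis
    using r U c limit unfolding G_def by blast
qed

end
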